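(* Let $(\mathfrak g,\langle\cdot,\cdot\rangle)$ be a (finite dimensional real) Lie algebra endowed with a scalar product, let $\pi_\ell$ be the canonical linear Poisson structure on $\mathfrak g^*$, and let $\langle\cdot,\cdot\rangle^*$ be the scalar product on $\mathfrak g^*$ associated to $\langle\cdot,\cdot\rangle$, viewed as a (constant) Riemannian metric on $\mathfrak g^*$. Then $(\pi_\ell,\langle\cdot,\cdot\rangle^* )$ satisfies Hawkins's conditions if and only if $(\mathfrak g,\langle\cdot,\cdot\rangle)$ is a Milnor Lie algebra.
   Context: Milnor Lie algebra: a finite dimensional real Lie algebra $\mathfrak h$ with a (positive definite) scalar product such that, with $S=\{u\in\mathfrak h:\operatorname{ad}_u+\operatorname{ad}_u^t=0\}$ ($\operatorname{ad}_u^t$ is the adjoint with respect to the scalar product): (a) the Lie subalgebra $S$ is abelian; (b) the derived ideal $[\mathfrak h,\mathfrak h]$ is abelian and $S^\perp=[\mathfrak h,\mathfrak h]$. The canonical linear Poisson structure on $\mathfrak g^*$ is $\{f,g\}(\alpha)=\alpha([d_\alpha f,d_\alpha g])$. Hawkins's conditions for a Poisson tensor $\pi$ and a Riemannian metric on a manifold $P$: (1) the associated metric contravariant connection $\mathcal D$ is flat; (2) the metacurvature of $\mathcal D$ vanishes ($\mathcal D$ is metaflat); (3) $d(i_\pi\mu)=0$, where $\mu$ is the Riemannian volume. The notions used are as follows. Levi-Civita contravariant connection: let $\pi_\#:T^*P\to TP$, $\beta(\pi_\#(\alpha))=\pi(\alpha,\beta)$, and let $[\alpha,\beta]_\pi=\mathscr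 L_{\pi_\#(\alpha)}\beta-\mathscr L_{\pi_\#(\beta)}\alpha-d(\pi(\alpha,\beta))$ be the Koszul bracket on 1-forms. A contravariant connection is an $\mathbb R$-bilinear map $\mathcal D:\Omega^1(P)\times\Omega^1(P)\to\Omega^1(P)$ with $\mathcal D_{f\alpha}\beta=f\mathcal D_\alpha\beta$ and $\mathcal D_\alpha(f\beta)=f\mathcal D_\alpha\beta+\pi_\#(\alpha)(f)\beta$; $\mathcal D_\alpha$ is extended to all differential forms as a derivation. With the scalar product $(\cdot,\cdot)$ on $T^*P$ induced by the metric, the associated metric contravariant connection is the unique $\mathcal D$ which is torsion-free ($\mathcal D_\alpha\beta-\mathcal D_\beta\alpha=[\alpha,\beta]_\pi$) and satisfies $\pi_\#(\alpha)\cdot(\beta,\gamma)=(\mathcal D_\alpha\beta,\gamma)+(\beta,\mathcal D_\alpha\gamma)$. It is flat if $K(\alpha,\beta)=\mathcal D_\alpha\mathcal D_\beta-\mathcal D_\beta\mathcal D_\alpha-\mathcal D_{[\alpha,\beta]_\pi}$ vanishes identically. Metacurvature: a torsion-free flat contravariant connection $\mathcal D$ defines a bracket $\{\cdot,\cdot\}$ on $\Omega^*(P)$ (Hawkins' generalized Poisson bracket), which is $\mathbb R$-bilinear of degree 0, satisfies $\{\sigma,\tau\}=-(-1)^{\deg\sigma\deg\tau}\{\tau,\sigma\}$, $d\{\sigma,\tau\}=\{d\sigma,\tau\}+(-1)^{\deg\sigma}\{\sigma,d\tau\}$, $\{\sigma,\tau\wedge\lambda\}=\{\sigma,\tau\}\wedge\lambda+(-1)^{\deg\sigma\deg\tau}\tau\wedge\{\sigma,\lambda\}$,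 coincides with the Poisson bracket on functions, and satisfies $\{f,\sigma\}=\mathcal D_{df}\sigma$ for functions $f$. The metacurvature is the tensor field $\mathcal M$ ($C^\infty(P)$-trilinear map from triples of 1-forms to 2-forms) determined by $\mathcal M(df,\alpha,\beta)=\{f,\{\alpha,\beta\}\}-\{\{f,\alpha\},\beta\}-\{\{f,\beta\},\alpha\}$. *)

theory Defs
  imports "HOL-Analysis.Analysis" "HOL-Library.Function_Algebras"
begin

section \<open>Differential forms on a finite dimensional real vector space\<close>

text \<open>
  The manifold is a finite dimensional real vector space \<open>'v\<close>, with all tangent spaces
  identified with \<open>'v\<close>. In finite dimension the recursion below is the usual notion of a
  \<open>C\<^sup>n\<close> map.
\<close>

primrec times_cont_diff ::
    "nat \<Rightarrow> ('v::real_normed_vector \<Rightarrow> 'w::real_normed_vector) \<Rightarrow> bool" where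
  "times_cont_diff 0 f \<longleftrightarrow> continuous_on UNIV f"
| "times_cont_diff (Suc n) f \<longleftrightarrow>
     (\<forall>x. f differentiable (at x)) \<and>
     (\<forall>v. times_cont_diff n (\<lambda>x. frechet_derivative f (at x) v))"

definition smooth :: "('v::real_normed_vector \<Rightarrow> 'w::real_normed_vector) \<Rightarrow> bool" where
  "smooth f \<longleftrightarrow> (\<forall>n. times_cont_diff n f)"

text \<open>
  A possibly inhomogeneous differential form \<open>\<omega>\<close> takes a point and a list of tangent vectors:
  its degree \<open>k\<close> component is the restriction of \<open>\<omega> x\<close> to lists of length \<open>k\<close>. The graded
  space of all forms and its degree \<open>k\<close> part are as follows. Sums and differences of forms
  are the pointwise ones of \<open>Function_Algebras\<close>; the pointwise product of that
  theory is never used for forms.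
\<close>

type_synonym 'v dform = "'v \<Rightarrow> 'v list \<Rightarrow> real"

definition all_forms :: "'v::real_normed_vector dform set" where
  "all_forms = {\<omega>.
     (\<forall>x vs i. i < length vs \<longrightarrow> linear (\<lambda>u. \<omega> x (vs[i := u]))) \<and>
     (\<forall>x vs i j. i < j \<and> j < length vs \<and> vs ! i = vs ! j \<longrightarrow> \<omega> x vs = 0) \<and>
     (\<forall>vs. smooth (\<lambda>x. \<omega> x vs))}"

definition forms :: "nat \<Rightarrow> 'v::real_normed_vector dform set" where
  "forms k = {\<omega> \<in> all_forms. \<forall>x vs. length vs \<noteq> k \<longrightarrow> \<omega> x vs = 0}"

definition fun_form :: "('v \<Rightarrow> real) \<Rightarrow> 'v dform" where
  "fun_form f x vs = (if vs = [] then f x else 0)"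

definition fscale :: "('v \<Rightarrow> real) \<Rightarrow> 'v dform \<Rightarrow> 'v dform" where
  "fscale f \<omega> x vs = f x * \<omega> x vs"

text \<open>
  The exterior product is the sum over all shuffles: \<open>I\<close> is the set of positions whose vectors
  go to \<open>\<sigma>\<close>, and the exponent counts the inversions of the shuffle. The normalisation is
  \<open>(\<alpha> \<and> \<beta>)(u, v) = \<alpha>(u) \<beta>(v) - \<alpha>(v) \<beta>(u)\<close> for 1-forms.
\<close>

definition wedge :: "'v dform \<Rightarrow> 'v dform \<Rightarrow> 'v dform" (infixr "\<curlywedge>" 70) where
  "(\<sigma> \<curlywedge> \<tau>) x vs =
     (\<Sum>I\<in>Pow {..<length vs}.
        (-1) ^ card {(i, j). i \<in> I \<and> j \<notin> I \<and> j < i} * \<sigma> x (nths vs I) * \<tau> x (nths vs (- I)))"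

definition ext_deriv :: "'v::real_normed_vector dform \<Rightarrow> 'v dform" where
  "ext_deriv \<omega> x vs =
     (\<Sum>i<length vs. (-1) ^ i *
        frechet_derivative (\<lambda>y. \<omega> y (take i vs @ drop (Suc i) vs)) (at x) (vs ! i))"

definition interior_prod :: "('v \<Rightarrow> 'v) \<Rightarrow> 'v dform \<Rightarrow> 'v dform" where
  "interior_prod X \<omega> x vs = \<omega> x (X x # vs)"

definition fun_deriv :: "('v::real_normed_vector \<Rightarrow> 'v) \<Rightarrow> ('v \<Rightarrow> real) \<Rightarrow> 'v \<Rightarrow> real" where
  "fun_deriv X f x = frechet_derivative f (at x) (X x)"

text \<open>The Lie derivative of a form along a vector field, by Cartan's formula.\<close>

definition lie_deriv :: "('v::real_normed_vector \<Rightarrow> 'v) \<Rightarrow> 'v dform \<Rightarrow> 'v dform" where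
  "lie_deriv X \<omega> = interior_prod X (ext_deriv \<omega>) + ext_deriv (interior_prod X \<omega>)"

section \<open>Bivector fields, metrics and contravariant connections\<close>

text \<open>
  A bivector field takes a point and two covectors, a metric takes a point and two tangent
  vectors. Covectors are linear functionals \<open>'v \<Rightarrow> real\<close>; the value of a 1-form
  at a point is turned into a covector by \<open>covec\<close>.
\<close>

type_synonym 'v bivector = "'v \<Rightarrow> ('v \<Rightarrow> real) \<Rightarrow> ('v \<Rightarrow> real) \<Rightarrow> real"
type_synonym 'v metric = "'v \<Rightarrow> 'v \<Rightarrow> 'v \<Rightarrow> real"

definition covec :: "'v dform \<Rightarrow> 'v \<Rightarrow> 'v \<Rightarrow> real" where
  "covec \<alpha> x v = \<alpha> x [v]"

definition bivec_app :: "'v bivector \<Rightarrow> 'v dform \<Rightarrow> 'v dform \<Rightarrow> 'v \<Rightarrow> real" where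
  "bivec_app \<pi> \<alpha> \<beta> x = \<pi> x (covec \<alpha> x) (covec \<beta> x)"

definition sharp :: "'v::real_vector bivector \<Rightarrow> 'v dform \<Rightarrow> 'v \<Rightarrow> 'v" where
  "sharp \<pi> \<alpha> x = (THE v. \<forall>\<phi>. linear \<phi> \<longrightarrow> \<phi> v = \<pi> x (covec \<alpha> x) \<phi>)"

definition koszul_bracket ::
    "'v::real_normed_vector bivector \<Rightarrow> 'v dform \<Rightarrow> 'v dform \<Rightarrow> 'v dform" where
  "koszul_bracket \<pi> \<alpha> \<beta> =
     lie_deriv (sharp \<pi> \<alpha>) \<beta> - lie_deriv (sharp \<pi> \<beta>) \<alpha> - ext_deriv (fun_form (bivec_app \<pi> \<alpha> \<beta>))"

definition metric_dual :: "'v metric \<Rightarrow> 'v \<Rightarrow> ('v \<Rightarrow> real) \<Rightarrow> 'v" where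
  "metric_dual G x \<phi> = (THE v. \<forall>w. G x v w = \<phi> w)"

text \<open>The scalar product induced by the metric \<open>G\<close> on 1-forms.\<close>

definition cometric :: "'v metric \<Rightarrow> 'v dform \<Rightarrow> 'v dform \<Rightarrow> 'v \<Rightarrow> real" where
  "cometric G \<alpha> \<beta> x = G x (metric_dual G x (covec \<alpha> x)) (metric_dual G x (covec \<beta> x))"

text \<open>
  A contravariant connection and its extension to all forms as a derivation are
  represented by one operator \<open>D\<close>: \<open>contravariant_connection\<close> only concerns the values of \<open>D\<close>
  on pairs of 1-forms, and \<open>derivation_extended\<close> states that \<open>D \<alpha>\<close> is a degree 0 derivation
  of the algebra of forms acting on functions by \<open>\<pi>\<^sub>#(\<alpha>)\<close>; this determines \<open>D \<alpha>\<close> on all forms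
  from its values on 1-forms. Real homogeneity is the case of constant \<open>f\<close> in the
  two rules for \<open>fscale\<close>.
\<close>

type_synonym 'v cconnection = "'v dform \<Rightarrow> 'v dform \<Rightarrow> 'v dform"

definition contravariant_connection ::
    "'v::real_normed_vector bivector \<Rightarrow> 'v cconnection \<Rightarrow> bool" where
  "contravariant_connection \<pi> D \<longleftrightarrow>
     (\<forall>\<alpha>\<in>forms 1. \<forall>\<beta>\<in>forms 1. D \<alpha> \<beta> \<in> forms 1) \<and>
     (\<forall>\<alpha>\<in>forms 1. \<forall>\<alpha>'\<in>forms 1. \<forall>\<beta>\<in>forms 1. D (\<alpha> + \<alpha>') \<beta> = D \<alpha> \<beta> + D \<alpha>' \<beta>) \<and>
     (\<forall>\<alpha>\<in>forms 1. \<forall>\<beta>\<in>forms 1. \<forall>\<beta>'\<in>forms 1. D \<alpha> (\<beta> + \<beta>') = D \<alpha> \<beta> + D \<alpha> \<beta>') \<and>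
     (\<forall>f. smooth f \<longrightarrow> (\<forall>\<alpha>\<in>forms 1. \<forall>\<beta>\<in>forms 1.
        D (fscale f \<alpha>) \<beta> = fscale f (D \<alpha> \<beta>) \<and>
        D \<alpha> (fscale f \<beta>) = fscale f (D \<alpha> \<beta>) + fscale (fun_deriv (sharp \<pi> \<alpha>) f) \<beta>))"

definition derivation_extended ::
    "'v::real_normed_vector bivector \<Rightarrow> 'v cconnection \<Rightarrow> bool" where
  "derivation_extended \<pi> D \<longleftrightarrow> (\<forall>\<alpha>\<in>forms 1.
     (\<forall>k. \<forall>\<sigma>\<in>forms k. D \<alpha> \<sigma> \<in> forms k) \<and>
     (\<forall>f. smooth f \<longrightarrow> D \<alpha> (fun_form f) = fun_form (fun_deriv (sharp \<pi> \<alpha>) f)) \<and>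
     (\<forall>\<sigma>\<in>all_forms. \<forall>\<tau>\<in>all_forms. D \<alpha> (\<sigma> + \<tau>) = D \<alpha> \<sigma> + D \<alpha> \<tau>) \<and>
     (\<forall>\<sigma>\<in>all_forms. \<forall>\<tau>\<in>all_forms. D \<alpha> (\<sigma> \<curlywedge> \<tau>) = D \<alpha> \<sigma> \<curlywedge> \<tau> + \<sigma> \<curlywedge> D \<alpha> \<tau>))"

definition torsion_free ::
    "'v::real_normed_vector bivector \<Rightarrow> 'v cconnection \<Rightarrow> bool" where
  "torsion_free \<pi> D \<longleftrightarrow>
     (\<forall>\<alpha>\<in>forms 1. \<forall>\<beta>\<in>forms 1. D \<alpha> \<beta> - D \<beta> \<alpha> = koszul_bracket \<pi> \<alpha> \<beta>)"

definition metric_compatible ::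
    "'v::real_normed_vector bivector \<Rightarrow> 'v metric \<Rightarrow> 'v cconnection \<Rightarrow> bool" where
  "metric_compatible \<pi> G D \<longleftrightarrow> (\<forall>\<alpha>\<in>forms 1. \<forall>\<beta>\<in>forms 1. \<forall>\<gamma>\<in>forms 1. \<forall>x.
     fun_deriv (sharp \<pi> \<alpha>) (cometric G \<beta> \<gamma>) x = cometric G (D \<alpha> \<beta>) \<gamma> x + cometric G \<beta> (D \<alpha> \<gamma>) x)"

definition metric_contravariant_connection ::
    "'v::real_normed_vector bivector \<Rightarrow> 'v metric \<Rightarrow> 'v cconnection \<Rightarrow> bool" where
  "metric_contravariant_connection \<pi> G D \<longleftrightarrow>
     contravariant_connection \<pi> D \<and> torsion_free \<pi> D \<and> metric_compatible \<pi> G D"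

definition flat_connection ::
    "'v::real_normed_vector bivector \<Rightarrow> 'v cconnection \<Rightarrow> bool" where
  "flat_connection \<pi> D \<longleftrightarrow> (\<forall>\<alpha>\<in>forms 1. \<forall>\<beta>\<in>forms 1. \<forall>\<gamma>\<in>forms 1.
     D \<alpha> (D \<beta> \<gamma>) - D \<beta> (D \<alpha> \<gamma>) - D (koszul_bracket \<pi> \<alpha> \<beta>) \<gamma> = 0)"

section \<open>Hawkins's bracket, metacurvature and conditions\<close>

definition hawkins_bracket ::
    "'v::real_normed_vector bivector \<Rightarrow> 'v cconnection \<Rightarrow> ('v dform \<Rightarrow> 'v dform \<Rightarrow> 'v dform) \<Rightarrow> bool"
  where
  "hawkins_bracket \<pi> D B \<longleftrightarrow>
     (\<forall>k l. \<forall>\<sigma>\<in>forms k. \<forall>\<tau>\<in>forms l. B \<sigma> \<tau> \<in> forms (k + l)) \<and>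
     (\<forall>\<sigma>\<in>all_forms. \<forall>\<sigma>'\<in>all_forms. \<forall>\<tau>\<in>all_forms.
        B (\<sigma> + \<sigma>') \<tau> = B \<sigma> \<tau> + B \<sigma>' \<tau> \<and> B \<tau> (\<sigma> + \<sigma>') = B \<tau> \<sigma> + B \<tau> \<sigma>') \<and>
     (\<forall>c. \<forall>\<sigma>\<in>all_forms. \<forall>\<tau>\<in>all_forms.
        B (fscale (\<lambda>_. c) \<sigma>) \<tau> = fscale (\<lambda>_. c) (B \<sigma> \<tau>) \<and>
        B \<sigma> (fscale (\<lambda>_. c) \<tau>) = fscale (\<lambda>_. c) (B \<sigma> \<tau>)) \<and>
     (\<forall>k l. \<forall>\<sigma>\<in>forms k. \<forall>\<tau>\<in>forms l.
        B \<sigma> \<tau> = - fscale (\<lambda>_. (-1) ^ (k * l)) (B \<tau> \<sigma>)) \<and>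
     (\<forall>k l. \<forall>\<sigma>\<in>forms k. \<forall>\<tau>\<in>forms l.
        ext_deriv (B \<sigma> \<tau>) = B (ext_deriv \<sigma>) \<tau> + fscale (\<lambda>_. (-1) ^ k) (B \<sigma> (ext_deriv \<tau>))) \<and>
     (\<forall>k l m. \<forall>\<sigma>\<in>forms k. \<forall>\<tau>\<in>forms l. \<forall>\<rho>\<in>forms m.
        B \<sigma> (\<tau> \<curlywedge> \<rho>) = B \<sigma> \<tau> \<curlywedge> \<rho> + fscale (\<lambda>_. (-1) ^ (k * l)) (\<tau> \<curlywedge> B \<sigma> \<rho>)) \<and>
     (\<forall>f g. smooth f \<and> smooth g \<longrightarrow>
        B (fun_form f) (fun_form g) =
          fun_form (bivec_app \<pi> (ext_deriv (fun_form f)) (ext_deriv (fun_form g)))) \<and>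
     (\<forall>f. smooth f \<longrightarrow> (\<forall>\<sigma>\<in>all_forms. B (fun_form f) \<sigma> = D (ext_deriv (fun_form f)) \<sigma>))"

definition metacurvature ::
    "('v::real_normed_vector dform \<Rightarrow> 'v dform \<Rightarrow> 'v dform) \<Rightarrow>
     ('v dform \<Rightarrow> 'v dform \<Rightarrow> 'v dform \<Rightarrow> 'v dform) \<Rightarrow> bool" where
  "metacurvature B M \<longleftrightarrow>
     (\<forall>\<alpha>\<in>forms 1. \<forall>\<beta>\<in>forms 1. \<forall>\<gamma>\<in>forms 1. M \<alpha> \<beta> \<gamma> \<in> forms 2) \<and>
     (\<forall>\<alpha>\<in>forms 1. \<forall>\<alpha>'\<in>forms 1. \<forall>\<beta>\<in>forms 1. \<forall>\<gamma>\<in>forms 1.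
        M (\<alpha> + \<alpha>') \<beta> \<gamma> = M \<alpha> \<beta> \<gamma> + M \<alpha>' \<beta> \<gamma> \<and>
        M \<beta> (\<alpha> + \<alpha>') \<gamma> = M \<beta> \<alpha> \<gamma> + M \<beta> \<alpha>' \<gamma> \<and>
        M \<beta> \<gamma> (\<alpha> + \<alpha>') = M \<beta> \<gamma> \<alpha> + M \<beta> \<gamma> \<alpha>') \<and>
     (\<forall>f. smooth f \<longrightarrow> (\<forall>\<alpha>\<in>forms 1. \<forall>\<beta>\<in>forms 1. \<forall>\<gamma>\<in>forms 1.
        M (fscale f \<alpha>) \<beta> \<gamma> = fscale f (M \<alpha> \<beta> \<gamma>) \<and>
        M \<alpha> (fscale f \<beta>) \<gamma> = fscale f (M \<alpha> \<beta> \<gamma>) \<and>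
        M \<alpha> \<beta> (fscale f \<gamma>) = fscale f (M \<alpha> \<beta> \<gamma>))) \<and>
     (\<forall>f. smooth f \<longrightarrow> (\<forall>\<alpha>\<in>forms 1. \<forall>\<beta>\<in>forms 1.
        M (ext_deriv (fun_form f)) \<alpha> \<beta> =
          B (fun_form f) (B \<alpha> \<beta>) - B (B (fun_form f) \<alpha>) \<beta> - B (B (fun_form f) \<beta>) \<alpha>))"

text \<open>
  For a flat torsion-free \<open>D\<close> the bracket \<open>B\<close> and the tensor \<open>M\<close> exist and are uniquely
  determined on forms, so the existential quantifiers name the objects attached to \<open>D\<close>.
\<close>

definition metaflat :: "'v::real_normed_vector bivector \<Rightarrow> 'v cconnection \<Rightarrow> bool" where
  "metaflat \<pi> D \<longleftrightarrow> (\<exists>B M. hawkins_bracket \<pi> D B \<and> metacurvature B M \<and>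
     (\<forall>\<alpha>\<in>forms 1. \<forall>\<beta>\<in>forms 1. \<forall>\<gamma>\<in>forms 1. M \<alpha> \<beta> \<gamma> = 0))"

text \<open>
  The contraction \<open>1/2 \<Sum> \<pi>(a\<^sup>*, b\<^sup>*) \<omega>(a, b, \<dots>)\<close> over a basis of \<open>'v\<close> with dual basis
  \<open>a\<^sup>*\<close>; it does not depend on the basis, here the one produced by \<open>real_vector.extend_basis\<close>.
\<close>

definition bivec_contract :: "'v::real_vector bivector \<Rightarrow> 'v dform \<Rightarrow> 'v dform" where
  "bivec_contract \<pi> \<omega> x vs =
     (let E = real_vector.extend_basis ({} :: 'v set); co = (\<lambda>e v. real_vector.representation E v e) in
      1/2 * (\<Sum>a\<in>E. \<Sum>b\<in>E. \<pi> x (co a) (co b) * \<omega> x (a # b # vs)))"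

text \<open>
  There are exactly two Riemannian volume forms, \<open>\<mu>\<close> and \<open>-\<mu>\<close>, one for each orientation
  of \<open>'v\<close>, and \<open>d(i\<^sub>\<pi>\<mu>) = 0\<close> does not distinguish between them.
\<close>

definition riemannian_volume :: "'v::real_normed_vector metric \<Rightarrow> 'v dform \<Rightarrow> bool" where
  "riemannian_volume G \<mu> \<longleftrightarrow>
     \<mu> \<in> forms (dim (UNIV :: 'v set)) \<and>
     (\<forall>x vs. length vs = dim (UNIV :: 'v set) \<and>
        (\<forall>i<length vs. \<forall>j<length vs. G x (vs ! i) (vs ! j) = (if i = j then 1 else 0)) \<longrightarrow>
        \<bar>\<mu> x vs\<bar> = 1)"

text \<open>
  As above, \<open>\<exists>D\<close> names the metric contravariant connection (with its extension to forms), which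
  exists and is unique.
\<close>

definition hawkins_conditions :: "'v::real_normed_vector bivector \<Rightarrow> 'v metric \<Rightarrow> bool" where
  "hawkins_conditions \<pi> G \<longleftrightarrow>
     (\<exists>D. metric_contravariant_connection \<pi> G D \<and> derivation_extended \<pi> D \<and>
          flat_connection \<pi> D \<and> metaflat \<pi> D) \<and>
     (\<forall>\<mu>. riemannian_volume G \<mu> \<longrightarrow> ext_deriv (bivec_contract \<pi> \<mu>) = 0)"

section \<open>Lie algebras with a scalar product and the linear Poisson structure\<close>

definition lie_algebra :: "('a::real_vector \<Rightarrow> 'a \<Rightarrow> 'a) \<Rightarrow> bool" where
  "lie_algebra br \<longleftrightarrow>
     bilinear br \<and> (\<forall>u. br u u = 0) \<and>
     (\<forall>u v w. br u (br v w) + br v (br w u) + br w (br u v) = 0)"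

definition skew_part :: "('a::real_inner \<Rightarrow> 'a \<Rightarrow> 'a) \<Rightarrow> 'a set" where
  "skew_part br = {u. \<forall>v. br u v + adjoint (br u) v = 0}"

definition derived_ideal :: "('a::real_vector \<Rightarrow> 'a \<Rightarrow> 'a) \<Rightarrow> 'a set" where
  "derived_ideal br = span {br u v | u v. True}"

definition abelian_on :: "('a::real_vector \<Rightarrow> 'a \<Rightarrow> 'a) \<Rightarrow> 'a set \<Rightarrow> bool" where
  "abelian_on br U \<longleftrightarrow> (\<forall>u\<in>U. \<forall>v\<in>U. br u v = 0)"

definition milnor_lie_algebra :: "('a::real_inner \<Rightarrow> 'a \<Rightarrow> 'a) \<Rightarrow> bool" where
  "milnor_lie_algebra br \<longleftrightarrow>
     (\<exists>E :: 'a set. finite E \<and> span E = UNIV) \<and> lie_algebra br \<and>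
     abelian_on br (skew_part br) \<and>
     abelian_on br (derived_ideal br) \<and>
     orthogonal_comp (skew_part br) = derived_ideal br"

text \<open>
  The dual of the Lie algebra is \<open>'a \<Rightarrow>\<^sub>L real\<close>, since linear functionals are bounded in finite
  dimension. Its covectors are elements of the bidual; \<open>bidual_rep\<close> is the
  identification of the bidual with the Lie algebra, under which the differential of a function
  on the dual is regarded as an element of the Lie algebra.
\<close>

definition bidual_rep :: "(('a::real_normed_vector \<Rightarrow>\<^sub>L real) \<Rightarrow> real) \<Rightarrow> 'a" where
  "bidual_rep \<phi> = (THE u. \<forall>\<xi>. \<phi> \<xi> = blinfun_apply \<xi> u)"

definition linear_poisson ::
    "('a::real_normed_vector \<Rightarrow> 'a \<Rightarrow> 'a) \<Rightarrow> ('a \<Rightarrow>\<^sub>L real) bivector" where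
  "linear_poisson br \<xi> \<phi> \<psi> = blinfun_apply \<xi> (br (bidual_rep \<phi>) (bidual_rep \<psi>))"

definition riesz :: "('a::real_inner \<Rightarrow>\<^sub>L real) \<Rightarrow> 'a" where
  "riesz \<xi> = (THE u. \<forall>v. blinfun_apply \<xi> v = u \<bullet> v)"

definition dual_inner :: "('a::real_inner \<Rightarrow>\<^sub>L real) \<Rightarrow> ('a \<Rightarrow>\<^sub>L real) \<Rightarrow> real" where
  "dual_inner \<xi> \<eta> = riesz \<xi> \<bullet> riesz \<eta>"

end

theory Submission
  imports Defs "HOL-Library.Multiset"
begin

text \<open>
  A covector on the dual of the Lie algebra is an element of the Lie algebra, so on constant 1-forms
  \<open>\<D>\<close> is the Levi-Civita product \<open>a \<cdot> b = L\<^sub>a b = R\<^sub>b a\<close> of the metric Lie algebra. Flatness of \<open>\<D>\<close> is therefore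
  flatness of this product. Since linear functions generate the bracket and brackets of constant
  1-forms vanish, the metacurvature vanishes as soon as \<open>\<D>\<close> is flat. Finally
  \<open>d(i\<^sub>\<pi>\<mu>)\<close> is \<open>\<mu>\<close> contracted with \<open>u \<mapsto> tr ad\<^sub>u\<close>. So Hawkins's conditions say that the metric Lie algebra
  is flat and unimodular.

  If it is, the traces of the products of right multiplications \<open>R\<^sub>b R\<^sub>c\<close> vanish. For
  \<open>u \<in> S\<close> the operator \<open>R\<^sub>u\<close> is skew, for \<open>u\<close> orthogonal to the derived ideal it is symmetric; in both cases
  it is zero, which gives \<open>S\<^sup>\<bottom> = [\<gg>, \<gg>]\<close>. A Casimir argument on the orthogonal complement of the
  kernel of \<open>a \<mapsto> L\<^sub>a\<close> shows that the derived ideal lies in this kernel, hence is abelian.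
  Conversely, in a Milnor Lie algebra \<open>L\<^sub>a = ad\<^sub>a\<close> on \<open>S\<close> and \<open>L\<^sub>a = 0\<close> on the derived ideal.
\<close>

text \<open>A form is a function of a point and a list of vectors, possibly of mixed degree. Most
  identities of the calculus are therefore proved by induction on the list: contraction with its
  head turns each operator into operators evaluated on the tail. Hawkins's conditions ask for
  objects on all smooth forms, not only on constant ones: a connection, its extension and the
  bracket; to extract unimodularity, a Riemannian volume must exist as well. Each is written down
  explicitly in the linear coordinates of an orthonormal basis. The bracket is dictated by its
  axioms there: \<open>{dx_e, dx_f} = d{x_e, dx_f}\<close> vanishes because
  \<open>\<D>_e dx_f\<close> is constant. Conversely, a connection known only by its axioms is
  determined on constant forms by Koszul's formula, and flatness of the product can be read off
  there. On the Lie algebra side one mechanism recurs: an operator has trace zero although its trace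
  is, up to sign, a sum of squares, so all the squares vanish. Unimodularity supplies the vanishing
  traces of the right multiplications; for the Casimir operator the trace vanishes by invariance of
  the form itself.\<close>

lemma sum_apply: "sum f A x = (\<Sum>a\<in>A. f a x)"
  by (induction A rule: infinite_finite_induct) auto

section \<open>Smooth functions\<close>

abbreviation dd :: "('v::real_normed_vector \<Rightarrow> 'w::real_normed_vector) \<Rightarrow> 'v \<Rightarrow> 'v \<Rightarrow> 'w" where
  "dd f v x \<equiv> frechet_derivative f (at x) v"

lemma smooth_differentiable: "smooth f \<Longrightarrow> f differentiable (at x)"
  unfolding smooth_def by (metis times_cont_diff.simps(2))

lemma smooth_has_derivative:
  "smooth f \<Longrightarrow> (f has_derivative frechet_derivative f (at x)) (at x)"
  using frechet_derivative_works smooth_differentiable by blast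

lemma smooth_dd: "smooth f \<Longrightarrow> smooth (dd f v)"
  unfolding smooth_def by (metis times_cont_diff.simps(2))

lemma smooth_continuous: "smooth f \<Longrightarrow> continuous_on UNIV f"
  unfolding smooth_def by (metis times_cont_diff.simps(1))

lemma dd_eqI: "(f has_derivative f') (at x) \<Longrightarrow> dd f v x = f' v"
  using frechet_derivative_at by metis

lemma dd_linear: "smooth f \<Longrightarrow> linear (\<lambda>v. dd f v x)"
  by (simp add: linear_frechet_derivative smooth_differentiable)

lemma times_cont_diff_const: "times_cont_diff n (\<lambda>x. c)"
proof (induction n arbitrary: c)
  case 0 then show ?case by simp
next
  case (Suc n)
  then show ?case by (simp add: fun_eq_iff)
qed

lemma smooth_const [simp]: "smooth (\<lambda>x. c)"
  by (simp add: smooth_def times_cont_diff_const)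

lemma times_cont_diff_bounded_linear: "bounded_linear f \<Longrightarrow> times_cont_diff n f"
proof (cases n)
  case 0 then show "bounded_linear f \<Longrightarrow> ?thesis"
    by (simp add: linear_continuous_on)
next
  case (Suc m)
  assume f: "bounded_linear f"
  have "dd f v x = f v" for v x
    using bounded_linear.has_derivative[OF f has_derivative_ident] by (rule dd_eqI)
  then show ?thesis
    using Suc f times_cont_diff_const bounded_linear_imp_differentiable by auto
qed

lemma smooth_bounded_linear: "bounded_linear f \<Longrightarrow> smooth f"
  by (simp add: smooth_def times_cont_diff_bounded_linear)

lemma dd_bounded_linear: "bounded_linear f \<Longrightarrow> dd f v x = f v"
  using bounded_linear.has_derivative[OF _ has_derivative_ident] by (metis dd_eqI)

lemma dd_add:
  assumes "f differentiable (at x)" "g differentiable (at x)"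
  shows "dd (\<lambda>y. f y + g y) v x = dd f v x + dd g v x"
  using assms by (intro dd_eqI) (auto intro!: derivative_eq_intros simp: frechet_derivative_works)

lemma dd_mult:
  fixes f g :: "'v::real_normed_vector \<Rightarrow> real"
  assumes "f differentiable (at x)" "g differentiable (at x)"
  shows "dd (\<lambda>y. f y * g y) v x = dd f v x * g x + f x * dd g v x"
proof -
  have "((\<lambda>y. f y * g y) has_derivative (\<lambda>v. f x * dd g v x + dd f v x * g x)) (at x)"
    using assms by (intro has_derivative_mult) (auto simp: frechet_derivative_works)
  from dd_eqI[OF this] show ?thesis by simp
qed

text \<open>The derivative of a product contains the undifferentiated factors, so the induction for
  products needs their regularity at one order less.\<close>

lemma times_cont_diff_Suc_imp: "times_cont_diff (Suc n) f \<Longrightarrow> times_cont_diff n f"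
proof (induction n arbitrary: f)
  case 0 then show ?case
    by (auto intro!: differentiable_imp_continuous_on simp: differentiable_on_def)
next
  case (Suc n)
  from Suc.prems have *: "\<forall>x. f differentiable (at x)"
    "\<forall>v. times_cont_diff (Suc n) (dd f v)"
    using times_cont_diff.simps(2)[of "Suc n" f] by blast+
  show ?case
    unfolding times_cont_diff.simps(2)[of n f] using * Suc.IH by blast
qed

lemma times_cont_diff_add:
  "times_cont_diff n f \<Longrightarrow> times_cont_diff n g \<Longrightarrow> times_cont_diff n (\<lambda>x. f x + g x)"
proof (induction n arbitrary: f g)
  case 0 then show ?case by (auto intro: continuous_intros)
next
  case (Suc n)
  then show ?case by (simp add: dd_add)
qed

lemma times_cont_diff_mult:
  fixes f g :: "'v::real_normed_vector \<Rightarrow> real"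
  shows "times_cont_diff n f \<Longrightarrow> times_cont_diff n g \<Longrightarrow> times_cont_diff n (\<lambda>x. f x * g x)"
proof (induction n arbitrary: f g)
  case 0 then show ?case by (auto intro: continuous_intros)
next
  case (Suc n)
  have "times_cont_diff n f" "times_cont_diff n g"
    using Suc.prems times_cont_diff_Suc_imp by blast+
  with Suc show ?case by (simp add: dd_mult times_cont_diff_add)
qed

lemma smooth_add: "smooth f \<Longrightarrow> smooth g \<Longrightarrow> smooth (\<lambda>x. f x + g x)"
  by (simp add: smooth_def times_cont_diff_add)

lemma smooth_mult:
  fixes f g :: "'v::real_normed_vector \<Rightarrow> real"
  shows "smooth f \<Longrightarrow> smooth g \<Longrightarrow> smooth (\<lambda>x. f x * g x)"
  by (simp add: smooth_def times_cont_diff_mult)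

lemma smooth_cmult:
  fixes f :: "'v::real_normed_vector \<Rightarrow> real"
  shows "smooth f \<Longrightarrow> smooth (\<lambda>x. c * f x)"
  by (rule smooth_mult) auto

lemma smooth_uminus:
  fixes f :: "'v::real_normed_vector \<Rightarrow> real"
  shows "smooth f \<Longrightarrow> smooth (\<lambda>x. - f x)"
  using smooth_cmult[of f "-1"] by simp

lemma smooth_diff:
  fixes f g :: "'v::real_normed_vector \<Rightarrow> real"
  assumes "smooth f" "smooth g"
  shows "smooth (\<lambda>x. f x - g x)"
  using smooth_add[OF assms(1) smooth_uminus[OF assms(2)]] by simp

lemma smooth_sum:
  "(\<And>i. i \<in> A \<Longrightarrow> smooth (f i)) \<Longrightarrow> smooth (\<lambda>x. \<Sum>i\<in>A. f i x)"
  by (induction A rule: infinite_finite_induct) (auto intro: smooth_add)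

lemma smooth_dd_add:
  "smooth f \<Longrightarrow> smooth g \<Longrightarrow> dd (\<lambda>y. f y + g y) v x = dd f v x + dd g v x"
  by (simp add: dd_add smooth_differentiable)

lemma smooth_dd_mult:
  fixes f g :: "'v::real_normed_vector \<Rightarrow> real"
  shows "smooth f \<Longrightarrow> smooth g \<Longrightarrow> dd (\<lambda>y. f y * g y) v x = dd f v x * g x + f x * dd g v x"
  by (simp add: dd_mult smooth_differentiable)

lemma smooth_dd_cmult:
  fixes f :: "'v::real_normed_vector \<Rightarrow> real"
  shows "smooth f \<Longrightarrow> dd (\<lambda>y. c * f y) v x = c * dd f v x"
  by (simp add: smooth_dd_mult)

lemma smooth_dd_diff:
  fixes f g :: "'v::real_normed_vector \<Rightarrow> real"
  assumes "smooth f" "smooth g"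
  shows "dd (\<lambda>y. f y - g y) v x = dd f v x - dd g v x"
  using smooth_dd_add[OF assms(1) smooth_cmult[OF assms(2), of "-1"]]
    smooth_dd_cmult[OF assms(2), of "-1"] by simp

lemma smooth_dd_sum:
  "(\<And>i. i \<in> A \<Longrightarrow> smooth (f i)) \<Longrightarrow> dd (\<lambda>y. \<Sum>i\<in>A. f i y) v x = (\<Sum>i\<in>A. dd (f i) v x)"
  by (induction A rule: infinite_finite_induct) (simp_all add: smooth_dd_add smooth_sum)

text \<open>Restricts \<open>f\<close> to one real variable, where the mean value theorem
  \<open>MVT2\<close> applies.\<close>

lemma dd_along_line:
  fixes f :: "'v::real_normed_vector \<Rightarrow> real"
  assumes "smooth f"
  shows "((\<lambda>t. f (a + t *\<^sub>R v)) has_real_derivative dd f v (a + t *\<^sub>R v)) (at t)"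
proof -
  have "((\<lambda>t. f (a + t *\<^sub>R v)) has_derivative
      (\<lambda>h. frechet_derivative f (at (a + t *\<^sub>R v)) (h *\<^sub>R v))) (at t)"
    by (rule has_derivative_compose[where g=f and f="\<lambda>t. a + t *\<^sub>R v"])
       (auto intro!: derivative_eq_intros smooth_has_derivative assms)
  then show ?thesis
    unfolding has_field_derivative_def
    using linear_scale[OF dd_linear[OF assms]] by (simp add: mult_commute_abs)
qed

text \<open>Symmetry of second derivatives: by the mean value theorem applied twice, the second
  difference of \<open>f\<close> over the parallelogram spanned by \<open>t u\<close> and \<open>t v\<close> is \<open>t\<^sup>2\<close> times a value of
  either mixed derivative near \<open>x\<close>.\<close>

lemma second_difference:
  fixes f :: "'v::real_normed_vector \<Rightarrow> real"
  assumes "smooth f" "t > 0"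
  obtains r s where "0 < r" "r < t" "0 < s" "s < t"
    "f (x + t *\<^sub>R u + t *\<^sub>R v) - f (x + t *\<^sub>R u) - (f (x + t *\<^sub>R v) - f x) =
     t * t * dd (dd f u) v (x + r *\<^sub>R u + s *\<^sub>R v)"
proof -
  \<comment> \<open>\<open>g\<close> is the difference across \<open>t v\<close> as a function of
    the coefficient of \<open>u\<close>. The first mean value step fixes \<open>r\<close>, the
    second then moves along \<open>v\<close>.\<close>
  define g where "g r = f (x + t *\<^sub>R v + r *\<^sub>R u) - f (x + r *\<^sub>R u)" for r
  have "(g has_real_derivative
      dd f u (x + t *\<^sub>R v + r *\<^sub>R u) - dd f u (x + r *\<^sub>R u)) (at r)" for r
    unfolding g_def by (intro DERIV_diff dd_along_line assms)
  from MVT2[OF \<open>t > 0\<close> this] obtain r where r: "0 < r" "r < t"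
    "g t - g 0 = t * (dd f u (x + t *\<^sub>R v + r *\<^sub>R u) - dd f u (x + r *\<^sub>R u))"
    by auto
  from MVT2[OF \<open>t > 0\<close> dd_along_line[OF smooth_dd[OF \<open>smooth f\<close>, of u], of "x + r *\<^sub>R u" v]]
  obtain s where s: "0 < s" "s < t"
    "dd f u (x + r *\<^sub>R u + t *\<^sub>R v) - dd f u (x + r *\<^sub>R u) =
       t * dd (dd f u) v (x + r *\<^sub>R u + s *\<^sub>R v)"
    by auto
  show thesis
    by (rule that[OF r(1,2) s(1,2)]) (use r(3) s(3) in \<open>simp add: g_def algebra_simps\<close>)
qed

lemma dd_commute:
  fixes f :: "'v::real_normed_vector \<Rightarrow> real"
  assumes "smooth f"
  shows "dd (dd f u) v x = dd (dd f v) u x"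
proof -
  define t where "t n = inverse (real (Suc n))" for n
  have tpos: "t n > 0" for n by (simp add: t_def)
  have tlim: "t \<longlonglongrightarrow> 0" unfolding t_def by (rule LIMSEQ_inverse_real_of_nat)
  define \<Delta> where "\<Delta> u v n = (f (x + t n *\<^sub>R u + t n *\<^sub>R v) - f (x + t n *\<^sub>R u) -
      (f (x + t n *\<^sub>R v) - f x)) / (t n * t n)" for u v n
  have lim: "\<Delta> u v \<longlonglongrightarrow> dd (dd f u) v x" for u v
  proof -
    have "\<exists>r s. 0 < r \<and> r < t n \<and> 0 < s \<and> s < t n \<and>
        \<Delta> u v n = dd (dd f u) v (x + r *\<^sub>R u + s *\<^sub>R v)" for n
      using second_difference[OF assms tpos[of n], of x u v] tpos[of n]
      unfolding \<Delta>_def by (smt (verit) nonzero_mult_div_cancel_left mult_pos_pos)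
    then obtain r s where rs: "\<And>n. 0 < r n \<and> r n < t n \<and> 0 < s n \<and> s n < t n \<and>
        \<Delta> u v n = dd (dd f u) v (x + r n *\<^sub>R u + s n *\<^sub>R v)"
      by metis
    have "r \<longlonglongrightarrow> 0" "s \<longlonglongrightarrow> 0"
      by (rule tendsto_sandwich[OF _ _ tendsto_const tlim]; use rs less_imp_le in \<open>auto intro!: always_eventually\<close>)+
    then have *: "(\<lambda>n. x + r n *\<^sub>R u + s n *\<^sub>R v) \<longlonglongrightarrow> x + 0 *\<^sub>R u + 0 *\<^sub>R v"
      by (intro tendsto_intros)
    have "isCont (dd (dd f u) v) x"
      using smooth_continuous[OF smooth_dd[OF smooth_dd[OF assms]]]
      by (simp add: continuous_on_eq_continuous_at)
    then have "(\<lambda>n. dd (dd f u) v (x + r n *\<^sub>R u + s n *\<^sub>R v)) \<longlonglongrightarrow> dd (dd f u) v x"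
      using * by (intro isCont_tendsto_compose[where g="dd (dd f u) v"]) auto
    moreover have "\<Delta> u v = (\<lambda>n. dd (dd f u) v (x + r n *\<^sub>R u + s n *\<^sub>R v))"
      using rs by auto
    ultimately show ?thesis by simp
  qed
  \<comment> \<open>The second difference does not see the order of \<open>u\<close> and
    \<open>v\<close>, so both mixed derivatives are limits of one sequence.\<close>
  have "\<Delta> u v = \<Delta> v u"
    by (rule ext) (simp add: \<Delta>_def algebra_simps)
  then show ?thesis
    using lim[of u v] lim[of v u] LIMSEQ_unique by metis
qed

section \<open>Exterior algebra\<close>

abbreviation contr :: "'v \<Rightarrow> 'v dform \<Rightarrow> 'v dform" where
  "contr v \<equiv> interior_prod (\<lambda>_. v)"

text \<open>The grading automorphism. It carries the sign of the graded Leibniz rules, which can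
  then be stated for inhomogeneous forms without naming a degree.\<close>

definition grade_inv :: "'v dform \<Rightarrow> 'v dform" where
  "grade_inv \<omega> x vs = (-1) ^ length vs * \<omega> x vs"

definition dir_deriv :: "'v::real_normed_vector \<Rightarrow> 'v dform \<Rightarrow> 'v dform" where
  "dir_deriv v \<omega> x vs = dd (\<lambda>y. \<omega> y vs) v x"

text \<open>The extension of the transpose of \<open>T\<close> to a derivation of the exterior algebra.\<close>

definition lin_act :: "('v \<Rightarrow> 'v) \<Rightarrow> 'v dform \<Rightarrow> 'v dform" where
  "lin_act T \<omega> x vs = (\<Sum>i<length vs. \<omega> x (vs[i := T (vs ! i)]))"

definition one_form :: "('v \<Rightarrow> real) \<Rightarrow> 'v dform" where
  "one_form f x vs = (case vs of [v] \<Rightarrow> f v | _ \<Rightarrow> 0)"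

text \<open>Kept apart from multilinearity, alternation and smoothness: the sign rules of the
  exterior product depend on the degree alone.\<close>

definition degree_form :: "nat \<Rightarrow> 'v dform \<Rightarrow> bool" where
  "degree_form k \<omega> \<longleftrightarrow> (\<forall>x vs. length vs \<noteq> k \<longrightarrow> \<omega> x vs = 0)"

lemma interior_prod_apply: "interior_prod X \<omega> x vs = \<omega> x (X x # vs)"
  by (simp add: interior_prod_def)

lemma contr_add [simp]: "interior_prod X (\<sigma> + \<tau>) = interior_prod X \<sigma> + interior_prod X \<tau>"
  by (simp add: fun_eq_iff interior_prod_def)

lemma contr_diff [simp]: "interior_prod X (\<sigma> - \<tau>) = interior_prod X \<sigma> - interior_prod X \<tau>"
  by (simp add: fun_eq_iff interior_prod_def)

lemma contr_zero [simp]: "interior_prod X 0 = 0"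
  by (simp add: fun_eq_iff interior_prod_def)

lemma contr_fscale [simp]: "interior_prod X (fscale f \<sigma>) = fscale f (interior_prod X \<sigma>)"
  by (simp add: fun_eq_iff interior_prod_def fscale_def)

lemma contr_grade_inv: "contr v (grade_inv \<omega>) = - grade_inv (contr v \<omega>)"
  by (simp add: fun_eq_iff interior_prod_def grade_inv_def)

lemma grade_inv_grade_inv [simp]: "grade_inv (grade_inv \<omega>) = \<omega>"
  by (simp add: fun_eq_iff grade_inv_def flip: mult.assoc power_add)

lemma grade_inv_linear [simp]:
  "grade_inv (\<sigma> + \<tau>) = grade_inv \<sigma> + grade_inv \<tau>"
  "grade_inv (\<sigma> - \<tau>) = grade_inv \<sigma> - grade_inv \<tau>"
  "grade_inv (- \<sigma>) = - grade_inv \<sigma>"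
  "grade_inv 0 = 0"
  "grade_inv (fscale f \<sigma>) = fscale f (grade_inv \<sigma>)"
  by (simp_all add: fun_eq_iff grade_inv_def fscale_def algebra_simps)

section \<open>The exterior product as a recursion on the argument list\<close>

lemma wedge_Nil [simp]: "(\<sigma> \<curlywedge> \<tau>) x [] = \<sigma> x [] * \<tau> x []"
  by (simp add: wedge_def)

text \<open>Sorts the shuffles of a nonempty list by whether the head goes to the right or to the
  left factor; the other positions are shifted by \<open>Suc\<close>.\<close>

lemma Pow_lessThan_Suc_split:
  "Pow {..<Suc n} = (`) Suc ` Pow {..<n} \<union> (\<lambda>J. insert 0 (Suc ` J)) ` Pow {..<n}"
proof -
  have "I \<in> (`) Suc ` Pow {..<n} \<union> (\<lambda>J. insert 0 (Suc ` J)) ` Pow {..<n}" if "I \<subseteq> {..<Suc n}" for I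
  proof -
    define J where "J = {j. Suc j \<in> I}"
    have "J \<in> Pow {..<n}" using that by (auto simp: J_def)
    moreover have "I = (if 0 \<in> I then insert 0 (Suc ` J) else Suc ` J)"
      by (auto simp: J_def image_iff) (metis not0_implies_Suc)+
    ultimately show ?thesis by (metis (no_types, lifting) UnI1 UnI2 image_eqI)
  qed
  then show ?thesis
    by (intro equalityI subsetI) (blast, auto)
qed

lemma sum_Pow_lessThan_Suc:
  "(\<Sum>I\<in>Pow {..<Suc n}. g I) =
     (\<Sum>J\<in>Pow {..<n}. g (insert 0 (Suc ` J))) + (\<Sum>J\<in>Pow {..<n}. g (Suc ` J))"
proof -
  have "(\<Sum>I\<in>Pow {..<Suc n}. g I) = sum g ((`) Suc ` Pow {..<n}) +
      sum g ((\<lambda>J. insert 0 (Suc ` J)) ` Pow {..<n})"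
    unfolding Pow_lessThan_Suc_split by (rule sum.union_disjoint) auto
  moreover have "sum g ((`) Suc ` Pow {..<n}) = (\<Sum>J\<in>Pow {..<n}. g (Suc ` J))"
    by (rule sum.reindex[unfolded comp_def]) (auto intro!: inj_onI dest: inj_image_eq_iff[THEN iffD1, rotated])
  moreover have "inj_on (\<lambda>J. insert 0 (Suc ` J)) (Pow {..<n})"
  proof (rule inj_onI)
    fix J K :: "nat set" assume "insert 0 (Suc ` J) = insert 0 (Suc ` K)"
    then have "Suc ` J = Suc ` K" by auto
    then show "J = K" by (simp add: inj_image_eq_iff)
  qed
  ultimately show ?thesis
    by (simp add: sum.reindex add.commute)
qed

abbreviation inversions :: "nat set \<Rightarrow> (nat \<times> nat) set" where
  "inversions I \<equiv> {(i, j). i \<in> I \<and> j \<notin> I \<and> j < i}"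

text \<open>A head that goes to the right factor is overtaken by all \<open>card J\<close> vectors
  of the left one, which costs the sign \<open>(-1) ^ card J\<close>. A head that goes to the left
  factor creates no inversion.\<close>

lemma inversions_image_Suc:
  assumes "finite J"
  shows "card (inversions (Suc ` J)) = card (inversions J) + card J"
    and "card (inversions (insert 0 (Suc ` J))) = card (inversions J)"
proof -
  have fin: "finite (inversions J)"
  proof (rule finite_subset)
    show "inversions J \<subseteq> (SIGMA i:J. {..<i})" by auto
  qed (use assms in auto)
  have 1: "inversions (Suc ` J) = map_prod Suc Suc ` inversions J \<union> (\<lambda>i. (Suc i, 0)) ` J"
  proof (intro set_eqI iffI)
    fix p assume "p \<in> inversions (Suc ` J)"
    then obtain i j where "p = (Suc i, j)" "i \<in> J" "j \<notin> Suc ` J" "j < Suc i" by auto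
    then show "p \<in> map_prod Suc Suc ` inversions J \<union> (\<lambda>i. (Suc i, 0)) ` J"
      by (cases j) force+
  qed auto
  have 2: "inversions (insert 0 (Suc ` J)) = map_prod Suc Suc ` inversions J"
  proof (intro set_eqI iffI)
    fix p assume "p \<in> inversions (insert 0 (Suc ` J))"
    then obtain i j where "p = (Suc i, j)" "i \<in> J" "j \<notin> Suc ` J" "j \<noteq> 0" "j < Suc i" by auto
    then show "p \<in> map_prod Suc Suc ` inversions J"
      by (cases j) force+
  qed auto
  have c: "card (map_prod Suc Suc ` inversions J) = card (inversions J)"
    by (rule card_image) (auto intro!: inj_onI)
  show "card (inversions (insert 0 (Suc ` J))) = card (inversions J)"
    unfolding 2 by (rule c)
  have "card (inversions (Suc ` J)) = card (map_prod Suc Suc ` inversions J) + card ((\<lambda>i. (Suc i, 0::nat)) ` J)"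
    unfolding 1 using fin assms by (intro card_Un_disjoint) auto
  then show "card (inversions (Suc ` J)) = card (inversions J) + card J"
    using c by (simp add: card_image inj_on_def)
qed

text \<open>\<open>card J\<close> new inversions produce the sign that \<open>grade_inv\<close>
  attaches to a left factor with \<open>card J\<close> arguments. Beyond bilinearity, the structural
  rules for \<open>\<curlywedge>\<close> are derived from this recursion and never return to
  shuffles.\<close>

lemma wedge_Cons: "(\<sigma> \<curlywedge> \<tau>) x (v # vs) = (contr v \<sigma> \<curlywedge> \<tau>) x vs + (grade_inv \<sigma> \<curlywedge> contr v \<tau>) x vs"
proof -
  let ?n = "length vs"
  have len: "length (nths vs J) = card J" if "J \<subseteq> {..<?n}" for J
    unfolding length_nths using that by (intro arg_cong[where f=card]) auto
  have Suc: "{j. Suc j \<in> Suc ` J} = J" "{j. Suc j \<in> insert 0 (Suc ` J)} = J"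
    "{j. j \<notin> J} = - J" "{j. Suc j \<notin> insert 0 (Suc ` J)} = - J" "{j. Suc j \<notin> Suc ` J} = - J" for J
    by auto
  have fin: "finite J" if "J \<in> Pow {..<?n}" for J using that finite_subset by auto
  show ?thesis
    unfolding wedge_def length_Cons sum_Pow_lessThan_Suc
    by (intro arg_cong2[where f="(+)"] sum.cong refl, unfold inversions_image_Suc[OF fin])
       (simp_all add: nths_Cons Suc interior_prod_def grade_inv_def len power_add algebra_simps)
qed

lemma contr_wedge: "contr v (\<sigma> \<curlywedge> \<tau>) = contr v \<sigma> \<curlywedge> \<tau> + grade_inv \<sigma> \<curlywedge> contr v \<tau>"
  by (simp add: fun_eq_iff interior_prod_apply wedge_Cons)

lemma wedge_add_left: "(\<sigma> + \<sigma>') \<curlywedge> \<tau> = \<sigma> \<curlywedge> \<tau> + \<sigma>' \<curlywedge> \<tau>"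
  by (simp add: fun_eq_iff wedge_def algebra_simps sum.distrib)

lemma wedge_add_right: "\<sigma> \<curlywedge> (\<tau> + \<tau>') = \<sigma> \<curlywedge> \<tau> + \<sigma> \<curlywedge> \<tau>'"
  by (simp add: fun_eq_iff wedge_def algebra_simps sum.distrib)

lemma wedge_fscale_left [simp]: "fscale f \<sigma> \<curlywedge> \<tau> = fscale f (\<sigma> \<curlywedge> \<tau>)"
  by (simp add: fun_eq_iff wedge_def fscale_def sum_distrib_left mult_ac)

lemma wedge_fscale_right [simp]: "\<sigma> \<curlywedge> fscale f \<tau> = fscale f (\<sigma> \<curlywedge> \<tau>)"
  by (simp add: fun_eq_iff wedge_def fscale_def sum_distrib_left mult_ac)

lemma wedge_zero [simp]: "0 \<curlywedge> \<tau> = 0" "\<sigma> \<curlywedge> 0 = 0"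
  by (simp_all add: fun_eq_iff wedge_def)

lemma wedge_minus [simp]: "(- \<sigma>) \<curlywedge> \<tau> = - (\<sigma> \<curlywedge> \<tau>)" "\<sigma> \<curlywedge> (- \<tau>) = - (\<sigma> \<curlywedge> \<tau>)"
  by (simp_all add: fun_eq_iff wedge_def sum_negf)

lemma wedge_diff_left: "(\<sigma> - \<sigma>') \<curlywedge> \<tau> = \<sigma> \<curlywedge> \<tau> - \<sigma>' \<curlywedge> \<tau>"
  using wedge_add_left[of \<sigma> "- \<sigma>'" \<tau>] by simp

lemma wedge_diff_right: "\<sigma> \<curlywedge> (\<tau> - \<tau>') = \<sigma> \<curlywedge> \<tau> - \<sigma> \<curlywedge> \<tau>'"
  using wedge_add_right[of \<sigma> \<tau> "- \<tau>'"] by simp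

lemma wedge_sum_left: "sum \<sigma> A \<curlywedge> \<tau> = (\<Sum>a\<in>A. \<sigma> a \<curlywedge> \<tau>)"
  by (induction A rule: infinite_finite_induct) (simp_all add: wedge_add_left del: plus_fun_apply zero_fun_apply)

lemma wedge_sum_right: "\<sigma> \<curlywedge> sum \<tau> A = (\<Sum>a\<in>A. \<sigma> \<curlywedge> \<tau> a)"
  by (induction A rule: infinite_finite_induct) (simp_all add: wedge_add_right del: plus_fun_apply zero_fun_apply)

lemma grade_inv_wedge: "grade_inv (\<sigma> \<curlywedge> \<tau>) = grade_inv \<sigma> \<curlywedge> grade_inv \<tau>"
proof -
  have "grade_inv (\<sigma> \<curlywedge> \<tau>) x vs = (grade_inv \<sigma> \<curlywedge> grade_inv \<tau>) x vs" for x vs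
  proof (induction vs arbitrary: \<sigma> \<tau>)
    case Nil then show ?case by (simp add: grade_inv_def)
  next
    case (Cons v vs)
    have "grade_inv (\<sigma> \<curlywedge> \<tau>) x (v # vs) = - grade_inv (contr v \<sigma> \<curlywedge> \<tau>) x vs - grade_inv (grade_inv \<sigma> \<curlywedge> contr v \<tau>) x vs"
      by (simp add: grade_inv_def wedge_Cons algebra_simps)
    then show ?case by (simp add: Cons.IH wedge_Cons contr_grade_inv)
  qed
  then show ?thesis by (simp add: fun_eq_iff)
qed

text \<open>Contraction is an antiderivation, so both bracketings satisfy the same
  recursion.\<close>

lemma wedge_assoc: "(\<sigma> \<curlywedge> \<tau>) \<curlywedge> \<rho> = \<sigma> \<curlywedge> \<tau> \<curlywedge> \<rho>"
proof -
  have "((\<sigma> \<curlywedge> \<tau>) \<curlywedge> \<rho>) x vs = (\<sigma> \<curlywedge> \<tau> \<curlywedge> \<rho>) x vs" for x vs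
  proof (induction vs arbitrary: \<sigma> \<tau> \<rho>)
    case Nil then show ?case by simp
  next
    case (Cons v vs)
    then show ?case
      by (simp add: wedge_Cons contr_wedge wedge_add_left wedge_add_right grade_inv_wedge)
  qed
  then show ?thesis by (simp add: fun_eq_iff)
qed

lemma degree_form_contr: "degree_form (Suc k) \<omega> \<Longrightarrow> degree_form k (contr v \<omega>)"
  by (simp add: degree_form_def interior_prod_def)

lemma contr_degree_0: "degree_form 0 \<omega> \<Longrightarrow> contr v \<omega> = 0"
  by (simp add: degree_form_def interior_prod_def fun_eq_iff)

lemma grade_inv_degree: "degree_form k \<omega> \<Longrightarrow> grade_inv \<omega> = fscale (\<lambda>_. (-1) ^ k) \<omega>"
  by (auto simp add: degree_form_def grade_inv_def fscale_def fun_eq_iff)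

lemma degree_form_linear:
  "degree_form k 0"
  "degree_form k \<sigma> \<Longrightarrow> degree_form k \<tau> \<Longrightarrow> degree_form k (\<sigma> + \<tau>)"
  "degree_form k \<sigma> \<Longrightarrow> degree_form k \<tau> \<Longrightarrow> degree_form k (\<sigma> - \<tau>)"
  "degree_form k \<sigma> \<Longrightarrow> degree_form k (- \<sigma>)"
  "degree_form k \<sigma> \<Longrightarrow> degree_form k (fscale f \<sigma>)"
  by (simp_all add: degree_form_def fscale_def)

lemma degree_form_sum: "(\<And>a. a \<in> A \<Longrightarrow> degree_form k (\<sigma> a)) \<Longrightarrow> degree_form k (sum \<sigma> A)"
  by (simp add: degree_form_def sum_apply)

lemma degree_form_grade_inv: "degree_form k \<sigma> \<Longrightarrow> degree_form k (grade_inv \<sigma>)"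
  by (simp add: degree_form_def grade_inv_def)

lemma degree_form_wedge:
  assumes "degree_form k \<sigma>" "degree_form l \<tau>"
  shows "degree_form (k + l) (\<sigma> \<curlywedge> \<tau>)"
proof -
  have "length vs \<noteq> k + l \<Longrightarrow> (\<sigma> \<curlywedge> \<tau>) x vs = 0" for x vs
    using assms
  proof (induction vs arbitrary: \<sigma> \<tau> k l)
    case Nil then show ?case by (auto simp: degree_form_def)
  next
    case (Cons v vs)
    have "(contr v \<sigma> \<curlywedge> \<tau>) x vs = 0"
    proof (cases k)
      case 0 then show ?thesis using contr_degree_0 Cons.prems by force
    next
      case (Suc m)
      then show ?thesis using Cons.IH[of m l] Cons.prems degree_form_contr by fastforce
    qed
    moreover have "(grade_inv \<sigma> \<curlywedge> contr v \<tau>) x vs = 0"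
    proof (cases l)
      case 0 then show ?thesis using contr_degree_0 Cons.prems by force
    next
      case (Suc m)
      then show ?thesis using Cons.IH[of k m] Cons.prems degree_form_contr degree_form_grade_inv by fastforce
    qed
    ultimately show ?case by (simp add: wedge_Cons)
  qed
  then show ?thesis by (simp add: degree_form_def)
qed

lemma wedge_commute:
  assumes "degree_form k \<sigma>" "degree_form l \<tau>"
  shows "\<sigma> \<curlywedge> \<tau> = fscale (\<lambda>_. (-1) ^ (k * l)) (\<tau> \<curlywedge> \<sigma>)"
proof -
  have "(\<sigma> \<curlywedge> \<tau>) x vs = (-1) ^ (k * l) * (\<tau> \<curlywedge> \<sigma>) x vs" for x vs
    using assms
  proof (induction vs arbitrary: \<sigma> \<tau> k l)
    case Nil then show ?case by (cases "k = 0"; cases "l = 0") (auto simp: degree_form_def)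
  next
    case (Cons v vs)
    \<comment> \<open>Contraction lowers \<open>k\<close> by one, and
      \<open>(-1) ^ ((k - 1) * l)\<close> equals \<open>(-1) ^ (k * l) * (-1) ^ l\<close>; for
      \<open>k = 0\<close> the contraction vanishes. The other summand is treated in the same
      way.\<close>
    have 1: "(contr v \<sigma> \<curlywedge> \<tau>) x vs = (-1) ^ (k * l) * (-1) ^ l * (\<tau> \<curlywedge> contr v \<sigma>) x vs"
    proof (cases k)
      case 0 then show ?thesis using contr_degree_0 Cons.prems by force
    next
      case (Suc m)
      then have "degree_form m (contr v \<sigma>)" using Cons.prems(1) degree_form_contr by metis
      from Cons.IH[OF this Cons.prems(2)] show ?thesis
        by (simp add: Suc power_add mult_ac)
    qed
    have 2: "(\<sigma> \<curlywedge> contr v \<tau>) x vs = (-1) ^ (k * l) * (-1) ^ k * (contr v \<tau> \<curlywedge> \<sigma>) x vs"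
    proof (cases l)
      case 0 then show ?thesis using contr_degree_0 Cons.prems by force
    next
      case (Suc m)
      then have "degree_form m (contr v \<tau>)" using Cons.prems(2) degree_form_contr by metis
      from Cons.IH[OF Cons.prems(1) this] show ?thesis
        by (simp add: Suc power_add mult_ac)
    qed
    show ?case
      unfolding wedge_Cons grade_inv_degree[OF Cons.prems(1)] grade_inv_degree[OF Cons.prems(2)]
        wedge_fscale_left fscale_def 1 2
      by (simp add: distrib_left mult_ac)
  qed
  then show ?thesis by (simp add: fun_eq_iff fscale_def)
qed

section \<open>Derivations of the exterior algebra induced by linear maps\<close>

lemma lin_act_Nil [simp]: "lin_act T \<omega> x [] = 0"
  by (simp add: lin_act_def)

lemma lin_act_Cons: "lin_act T \<omega> x (v # vs) = contr (T v) \<omega> x vs + lin_act T (contr v \<omega>) x vs"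
  unfolding lin_act_def length_Cons sum.lessThan_Suc_shift by (simp add: interior_prod_def)

lemma contr_lin_act: "contr v (lin_act T \<omega>) = contr (T v) \<omega> + lin_act T (contr v \<omega>)"
  by (simp add: fun_eq_iff interior_prod_apply lin_act_Cons)

lemma lin_act_add: "lin_act T (\<sigma> + \<tau>) = lin_act T \<sigma> + lin_act T \<tau>"
  by (simp add: fun_eq_iff lin_act_def sum.distrib)

lemma lin_act_diff: "lin_act T (\<sigma> - \<tau>) = lin_act T \<sigma> - lin_act T \<tau>"
  by (simp add: fun_eq_iff lin_act_def sum_subtractf)

lemma lin_act_zero [simp]: "lin_act T 0 = 0"
  by (simp add: fun_eq_iff lin_act_def)

lemma lin_act_fscale [simp]: "lin_act T (fscale f \<sigma>) = fscale f (lin_act T \<sigma>)"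
  by (simp add: fun_eq_iff lin_act_def sum_distrib_left fscale_def)

lemma lin_act_sum: "lin_act T (sum \<sigma> A) = (\<Sum>a\<in>A. lin_act T (\<sigma> a))"
  by (induction A rule: infinite_finite_induct) (simp_all add: lin_act_add del: plus_fun_apply zero_fun_apply)

lemma lin_act_grade_inv: "lin_act T (grade_inv \<omega>) = grade_inv (lin_act T \<omega>)"
  by (simp add: fun_eq_iff lin_act_def grade_inv_def sum_distrib_left)

lemma degree_form_lin_act: "degree_form k \<omega> \<Longrightarrow> degree_form k (lin_act T \<omega>)"
  by (simp add: degree_form_def lin_act_def)

lemma lin_act_degree_0: "degree_form 0 \<omega> \<Longrightarrow> lin_act T \<omega> = 0"
proof (intro ext)
  fix x vs assume "degree_form 0 \<omega>"
  then show "lin_act T \<omega> x vs = 0 x vs"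
    by (cases "vs = []") (auto simp add: degree_form_def lin_act_def)
qed

lemma lin_act_wedge: "lin_act T (\<sigma> \<curlywedge> \<tau>) = lin_act T \<sigma> \<curlywedge> \<tau> + \<sigma> \<curlywedge> lin_act T \<tau>"
proof -
  have "lin_act T (\<sigma> \<curlywedge> \<tau>) x vs = (lin_act T \<sigma> \<curlywedge> \<tau> + \<sigma> \<curlywedge> lin_act T \<tau>) x vs" for x vs
  proof (induction vs arbitrary: \<sigma> \<tau>)
    case Nil then show ?case by simp
  next
    case (Cons v vs)
    then show ?case
      by (simp add: lin_act_Cons contr_wedge lin_act_add wedge_Cons contr_lin_act wedge_add_left
          wedge_add_right lin_act_grade_inv)
  qed
  then show ?thesis by (simp add: fun_eq_iff)
qed

text \<open>Terms in which \<open>S\<close> and \<open>T\<close> meet different slots cancel. In a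
  single slot the compositions remain, in reversed order because \<open>lin_act\<close> extends the
  transpose.\<close>

lemma lin_act_commutator:
  "lin_act T (lin_act S \<omega>) - lin_act S (lin_act T \<omega>) = lin_act (S \<circ> T) \<omega> - lin_act (T \<circ> S) \<omega>"
proof -
  have "lin_act T (lin_act S \<omega>) x vs - lin_act S (lin_act T \<omega>) x vs =
      lin_act (S \<circ> T) \<omega> x vs - lin_act (T \<circ> S) \<omega> x vs" for x vs
  proof (induction vs arbitrary: \<omega>)
    case Nil then show ?case by simp
  next
    case (Cons v vs)
    then show ?case
      by (simp add: lin_act_Cons contr_lin_act lin_act_add algebra_simps)
  qed
  then show ?thesis by (simp add: fun_eq_iff)
qed

section \<open>Calculus of differential forms\<close>

definition smooth_form :: "'v::real_normed_vector dform \<Rightarrow> bool" where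
  "smooth_form \<omega> \<longleftrightarrow> (\<forall>vs. smooth (\<lambda>x. \<omega> x vs))"

text \<open>Slots are split off as \<open>ws @ u # us\<close> rather than addressed by list update:
  induction on \<open>ws\<close> then reaches every slot by contractions.\<close>

definition multilin :: "'v::real_vector dform \<Rightarrow> bool" where
  "multilin \<omega> \<longleftrightarrow> (\<forall>x ws us. linear (\<lambda>u. \<omega> x (ws @ u # us)))"

text \<open>Restricted to adjacent equal arguments, a condition that survives contraction and is
  easy to check by induction; \<open>altern_repeat\<close> recovers the general case for multilinear
  forms.\<close>

definition altern :: "'v dform \<Rightarrow> bool" where
  "altern \<omega> \<longleftrightarrow> (\<forall>x ws v us. \<omega> x (ws @ v # v # us) = 0)"

lemma smooth_formD: "smooth_form \<omega> \<Longrightarrow> smooth (\<lambda>x. \<omega> x vs)"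
  by (simp add: smooth_form_def)

lemma smooth_form_zero [simp]: "smooth_form 0"
  by (simp add: smooth_form_def)

lemma smooth_form_add: "smooth_form \<sigma> \<Longrightarrow> smooth_form \<tau> \<Longrightarrow> smooth_form (\<sigma> + \<tau>)"
  by (simp add: smooth_form_def smooth_add)

lemma smooth_form_diff: "smooth_form \<sigma> \<Longrightarrow> smooth_form \<tau> \<Longrightarrow> smooth_form (\<sigma> - \<tau>)"
  by (simp add: smooth_form_def smooth_diff)

lemma smooth_form_sum: "(\<And>a. a \<in> A \<Longrightarrow> smooth_form (\<sigma> a)) \<Longrightarrow> smooth_form (sum \<sigma> A)"
  by (simp add: smooth_form_def sum_apply smooth_sum)

lemma smooth_form_fscale: "smooth f \<Longrightarrow> smooth_form \<sigma> \<Longrightarrow> smooth_form (fscale f \<sigma>)"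
  by (simp add: smooth_form_def fscale_def smooth_mult)

lemma smooth_form_grade_inv: "smooth_form \<sigma> \<Longrightarrow> smooth_form (grade_inv \<sigma>)"
  by (simp add: smooth_form_def grade_inv_def smooth_cmult)

lemma smooth_form_contr: "smooth_form \<sigma> \<Longrightarrow> smooth_form (contr v \<sigma>)"
  by (simp add: smooth_form_def interior_prod_def)

lemma smooth_form_lin_act: "smooth_form \<sigma> \<Longrightarrow> smooth_form (lin_act T \<sigma>)"
  by (simp add: smooth_form_def lin_act_def smooth_sum)

lemma smooth_form_dir_deriv: "smooth_form \<sigma> \<Longrightarrow> smooth_form (dir_deriv v \<sigma>)"
  by (simp add: smooth_form_def dir_deriv_def smooth_dd)

lemma smooth_form_wedge:
  assumes "smooth_form \<sigma>" "smooth_form \<tau>"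
  shows "smooth_form (\<sigma> \<curlywedge> \<tau>)"
proof -
  have "smooth (\<lambda>x. (\<sigma> \<curlywedge> \<tau>) x vs)" for vs
    using assms
  proof (induction vs arbitrary: \<sigma> \<tau>)
    case Nil then show ?case by (simp add: smooth_form_def smooth_mult)
  next
    case (Cons v vs)
    then show ?case
      by (simp add: wedge_Cons smooth_add smooth_form_contr smooth_form_grade_inv)
  qed
  then show ?thesis by (simp add: smooth_form_def)
qed

lemma contr_dir_deriv: "contr v (dir_deriv u \<omega>) = dir_deriv u (contr v \<omega>)"
  by (simp add: fun_eq_iff interior_prod_def dir_deriv_def)

lemma dir_deriv_zero [simp]: "dir_deriv v 0 = 0"
  by (simp add: fun_eq_iff dir_deriv_def)

lemma dir_deriv_add:
  "smooth_form \<sigma> \<Longrightarrow> smooth_form \<tau> \<Longrightarrow> dir_deriv v (\<sigma> + \<tau>) = dir_deriv v \<sigma> + dir_deriv v \<tau>"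
  by (simp add: fun_eq_iff dir_deriv_def smooth_dd_add smooth_form_def)

lemma dir_deriv_diff:
  "smooth_form \<sigma> \<Longrightarrow> smooth_form \<tau> \<Longrightarrow> dir_deriv v (\<sigma> - \<tau>) = dir_deriv v \<sigma> - dir_deriv v \<tau>"
  by (simp add: fun_eq_iff dir_deriv_def smooth_dd_diff smooth_form_def)

lemma dir_deriv_fscale:
  "smooth f \<Longrightarrow> smooth_form \<sigma> \<Longrightarrow>
    dir_deriv v (fscale f \<sigma>) = fscale (dd f v) \<sigma> + fscale f (dir_deriv v \<sigma>)"
  by (simp add: fun_eq_iff dir_deriv_def smooth_dd_mult smooth_form_def fscale_def)

lemma dir_deriv_sum:
  "(\<And>a. a \<in> A \<Longrightarrow> smooth_form (\<sigma> a)) \<Longrightarrow> dir_deriv v (sum \<sigma> A) = (\<Sum>a\<in>A. dir_deriv v (\<sigma> a))"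
  by (simp add: fun_eq_iff dir_deriv_def sum_apply smooth_form_def smooth_dd_sum)

lemma dir_deriv_grade_inv: "smooth_form \<sigma> \<Longrightarrow> dir_deriv v (grade_inv \<sigma>) = grade_inv (dir_deriv v \<sigma>)"
  by (simp add: fun_eq_iff dir_deriv_def grade_inv_def smooth_form_def smooth_dd_cmult)

lemma dir_deriv_lin_act: "smooth_form \<sigma> \<Longrightarrow> dir_deriv v (lin_act T \<sigma>) = lin_act T (dir_deriv v \<sigma>)"
  by (simp add: fun_eq_iff dir_deriv_def lin_act_def smooth_form_def smooth_dd_sum)

lemma dir_deriv_commute:
  "smooth_form \<sigma> \<Longrightarrow> dir_deriv u (dir_deriv v \<sigma>) = dir_deriv v (dir_deriv u \<sigma>)"
  unfolding fun_eq_iff dir_deriv_def smooth_form_def using dd_commute by blast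

lemma dir_deriv_wedge:
  assumes "smooth_form \<sigma>" "smooth_form \<tau>"
  shows "dir_deriv v (\<sigma> \<curlywedge> \<tau>) = dir_deriv v \<sigma> \<curlywedge> \<tau> + \<sigma> \<curlywedge> dir_deriv v \<tau>"
proof -
  have "dir_deriv v (\<sigma> \<curlywedge> \<tau>) x vs = (dir_deriv v \<sigma> \<curlywedge> \<tau> + \<sigma> \<curlywedge> dir_deriv v \<tau>) x vs" for x vs
    using assms
  proof (induction vs arbitrary: \<sigma> \<tau>)
    case Nil then show ?case by (simp add: smooth_form_def smooth_dd_mult dir_deriv_def)
  next
    case (Cons u vs)
    have "dir_deriv v (\<sigma> \<curlywedge> \<tau>) x (u # vs) = dir_deriv v (contr u (\<sigma> \<curlywedge> \<tau>)) x vs"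
      by (simp add: dir_deriv_def interior_prod_def)
    also have "\<dots> = dir_deriv v (contr u \<sigma> \<curlywedge> \<tau>) x vs + dir_deriv v (grade_inv \<sigma> \<curlywedge> contr u \<tau>) x vs"
      using Cons.prems by (simp add: contr_wedge dir_deriv_add smooth_form_wedge smooth_form_contr
          smooth_form_grade_inv)
    finally show ?case
      using Cons by (simp add: wedge_Cons smooth_form_contr smooth_form_grade_inv
          contr_dir_deriv dir_deriv_grade_inv)
  qed
  then show ?thesis by (simp add: fun_eq_iff)
qed

lemma dir_deriv_vec_linear:
  assumes "smooth_form \<sigma>"
  shows "dir_deriv (u + v) \<sigma> = dir_deriv u \<sigma> + dir_deriv v \<sigma>"
    and "dir_deriv (c *\<^sub>R v) \<sigma> = fscale (\<lambda>_. c) (dir_deriv v \<sigma>)"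
  using assms
  by (simp_all add: fun_eq_iff dir_deriv_def smooth_form_def fscale_def
      linear_add[OF dd_linear] linear_scale[OF dd_linear])

lemma degree_form_dir_deriv: "degree_form k \<omega> \<Longrightarrow> degree_form k (dir_deriv v \<omega>)"
  by (simp add: degree_form_def dir_deriv_def)

section \<open>The exterior derivative\<close>

lemma ext_deriv_Nil [simp]: "ext_deriv \<omega> x [] = 0"
  by (simp add: ext_deriv_def)

text \<open>Cartan's formula for a constant vector field, whose Lie derivative is
  \<open>dir_deriv v\<close>; it is the recursion on which the later inductions about
  \<open>ext_deriv\<close> rest.\<close>

lemma ext_deriv_Cons: "ext_deriv \<omega> x (v # vs) = dir_deriv v \<omega> x vs - ext_deriv (contr v \<omega>) x vs"
  unfolding ext_deriv_def length_Cons sum.lessThan_Suc_shift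
  by (simp add: interior_prod_def dir_deriv_def sum_negf)

lemma contr_ext_deriv: "contr v (ext_deriv \<omega>) = dir_deriv v \<omega> - ext_deriv (contr v \<omega>)"
  by (simp add: fun_eq_iff interior_prod_apply ext_deriv_Cons)

lemma ext_deriv_add:
  "smooth_form \<sigma> \<Longrightarrow> smooth_form \<tau> \<Longrightarrow> ext_deriv (\<sigma> + \<tau>) = ext_deriv \<sigma> + ext_deriv \<tau>"
  by (simp add: fun_eq_iff ext_deriv_def smooth_form_def smooth_dd_add sum.distrib distrib_left)

lemma ext_deriv_diff:
  "smooth_form \<sigma> \<Longrightarrow> smooth_form \<tau> \<Longrightarrow> ext_deriv (\<sigma> - \<tau>) = ext_deriv \<sigma> - ext_deriv \<tau>"
  by (simp add: fun_eq_iff ext_deriv_def smooth_form_def smooth_dd_diff sum_subtractf right_diff_distrib)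

lemma ext_deriv_zero [simp]: "ext_deriv 0 = 0"
  by (simp add: fun_eq_iff ext_deriv_def)

lemma ext_deriv_minus: "smooth_form \<sigma> \<Longrightarrow> ext_deriv (- \<sigma>) = - ext_deriv \<sigma>"
  using ext_deriv_diff[of 0 \<sigma>] by simp

lemma ext_deriv_sum:
  "(\<And>a. a \<in> A \<Longrightarrow> smooth_form (\<sigma> a)) \<Longrightarrow> ext_deriv (sum \<sigma> A) = (\<Sum>a\<in>A. ext_deriv (\<sigma> a))"
  by (simp add: fun_eq_iff ext_deriv_def sum_apply smooth_form_def smooth_dd_sum sum_distrib_left)
    (intro allI sum.swap)

lemma ext_deriv_grade_inv: "smooth_form \<sigma> \<Longrightarrow> ext_deriv (grade_inv \<sigma>) = - grade_inv (ext_deriv \<sigma>)"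
proof -
  assume "smooth_form \<sigma>"
  then have "ext_deriv (grade_inv \<sigma>) x vs = - grade_inv (ext_deriv \<sigma>) x vs" for x vs
  proof (induction vs arbitrary: \<sigma>)
    case Nil then show ?case by (simp add: grade_inv_def)
  next
    case (Cons v vs)
    have "ext_deriv (grade_inv \<sigma>) x (v # vs) =
        grade_inv (dir_deriv v \<sigma>) x vs + ext_deriv (grade_inv (contr v \<sigma>)) x vs"
      using Cons.prems by (simp add: ext_deriv_Cons contr_grade_inv ext_deriv_minus smooth_form_grade_inv
        smooth_form_contr dir_deriv_grade_inv)
    also have "\<dots> = grade_inv (dir_deriv v \<sigma> - ext_deriv (contr v \<sigma>)) x vs"
      using Cons.prems by (simp add: Cons.IH smooth_form_contr)
    also have "\<dots> = grade_inv (contr v (ext_deriv \<sigma>)) x vs"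
      by (simp only: contr_ext_deriv)
    also have "\<dots> = - grade_inv (ext_deriv \<sigma>) x (v # vs)"
      by (simp add: grade_inv_def interior_prod_def)
    finally show ?case .
  qed
  then show ?thesis by (simp add: fun_eq_iff)
qed

lemma smooth_form_ext_deriv:
  assumes "smooth_form \<sigma>"
  shows "smooth_form (ext_deriv \<sigma>)"
  using assms unfolding smooth_form_def ext_deriv_def
  by (auto intro!: smooth_sum smooth_cmult smooth_dd)

lemma degree_form_ext_deriv: "degree_form k \<omega> \<Longrightarrow> degree_form (Suc k) (ext_deriv \<omega>)"
  unfolding degree_form_def ext_deriv_def by (auto intro!: sum.neutral)

lemma ext_deriv_wedge:
  assumes "smooth_form \<sigma>" "smooth_form \<tau>"
  shows "ext_deriv (\<sigma> \<curlywedge> \<tau>) = ext_deriv \<sigma> \<curlywedge> \<tau> + grade_inv \<sigma> \<curlywedge> ext_deriv \<tau>"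
proof -
  have "ext_deriv (\<sigma> \<curlywedge> \<tau>) x vs = (ext_deriv \<sigma> \<curlywedge> \<tau> + grade_inv \<sigma> \<curlywedge> ext_deriv \<tau>) x vs" for x vs
    using assms
  proof (induction vs arbitrary: \<sigma> \<tau>)
    case Nil then show ?case by simp
  next
    case (Cons v vs)
    note sm = Cons.prems smooth_form_contr smooth_form_grade_inv smooth_form_wedge
    have "ext_deriv (\<sigma> \<curlywedge> \<tau>) x (v # vs) = dir_deriv v (\<sigma> \<curlywedge> \<tau>) x vs -
        ext_deriv (contr v \<sigma> \<curlywedge> \<tau>) x vs - ext_deriv (grade_inv \<sigma> \<curlywedge> contr v \<tau>) x vs"
      by (simp add: ext_deriv_Cons contr_wedge ext_deriv_add sm)
    moreover have "(ext_deriv (grade_inv \<sigma>) \<curlywedge> contr v \<tau>) x vs =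
        - (grade_inv (ext_deriv \<sigma>) \<curlywedge> contr v \<tau>) x vs"
      by (simp only: ext_deriv_grade_inv[OF Cons.prems(1)] wedge_minus uminus_apply)
    ultimately show ?case
      by (simp add: Cons.IH dir_deriv_wedge wedge_Cons contr_grade_inv contr_ext_deriv
          sm wedge_diff_left wedge_diff_right)
  qed
  then show ?thesis by (simp add: fun_eq_iff)
qed

text \<open>Symmetry of second derivatives, in the form \<open>dir_deriv_commute\<close>, matches
  the leading terms of the two recursions.\<close>

lemma ext_deriv_dir_deriv:
  assumes "smooth_form \<sigma>"
  shows "ext_deriv (dir_deriv u \<sigma>) = dir_deriv u (ext_deriv \<sigma>)"
proof -
  have "ext_deriv (dir_deriv u \<sigma>) x vs = dir_deriv u (ext_deriv \<sigma>) x vs" for x vs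
    using assms
  proof (induction vs arbitrary: \<sigma>)
    case Nil then show ?case by (simp add: dir_deriv_def)
  next
    case (Cons v vs)
    have "dir_deriv u (ext_deriv \<sigma>) x (v # vs) = dir_deriv u (contr v (ext_deriv \<sigma>)) x vs"
      by (simp add: dir_deriv_def interior_prod_def)
    then show ?case
      using Cons.prems
      by (simp add: Cons.IH ext_deriv_Cons contr_ext_deriv contr_dir_deriv smooth_form_contr
          dir_deriv_diff smooth_form_dir_deriv smooth_form_ext_deriv dir_deriv_commute[of \<sigma> u v])
  qed
  then show ?thesis by (simp add: fun_eq_iff)
qed

section \<open>Multilinearity, alternation and closure of the space of forms\<close>

lemma multilinD: "multilin \<omega> \<Longrightarrow> linear (\<lambda>u. \<omega> x (ws @ u # us))"
  by (simp add: multilin_def)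

lemma multilin_linear: "multilin \<omega> \<Longrightarrow> linear (\<lambda>u. \<omega> x (u # us))"
  using multilinD[of \<omega> x "[]" us] by simp

lemma contr_vec_linear:
  assumes "multilin \<omega>"
  shows "contr (u + v) \<omega> = contr u \<omega> + contr v \<omega>"
    and "contr (c *\<^sub>R v) \<omega> = fscale (\<lambda>_. c) (contr v \<omega>)"
    and "contr (u - v) \<omega> = contr u \<omega> - contr v \<omega>"
    and "contr 0 \<omega> = 0"
proof -
  have l: "linear (\<lambda>u. \<omega> x (u # us))" for x us
    using assms by (rule multilin_linear)
  show "contr (u + v) \<omega> = contr u \<omega> + contr v \<omega>"
    by (simp add: fun_eq_iff interior_prod_def linear_add[OF l])
  show "contr (u - v) \<omega> = contr u \<omega> - contr v \<omega>"
    by (simp add: fun_eq_iff interior_prod_def linear_diff[OF l])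
  show "contr (c *\<^sub>R v) \<omega> = fscale (\<lambda>_. c) (contr v \<omega>)"
    by (simp add: fun_eq_iff interior_prod_def fscale_def linear_scale[OF l])
  show "contr 0 \<omega> = 0"
    by (simp add: fun_eq_iff interior_prod_def linear_0[OF l])
qed

lemma multilin_contr: "multilin \<omega> \<Longrightarrow> multilin (contr v \<omega>)"
  using multilinD[of \<omega> _ "v # _"] by (simp add: multilin_def interior_prod_def)

lemma alternD: "altern \<omega> \<Longrightarrow> \<omega> x (ws @ v # v # us) = 0"
  by (simp add: altern_def)

lemma altern_contr: "altern \<omega> \<Longrightarrow> altern (contr v \<omega>)"
  using alternD[of \<omega> _ "v # _"] by (simp add: altern_def interior_prod_def)

lemma altern_contr_contr: "altern \<omega> \<Longrightarrow> contr v (contr v \<omega>) = 0"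
  using alternD[of \<omega> _ "[]"] by (simp add: interior_prod_def fun_eq_iff)

text \<open>Polarization of \<open>contr v (contr v \<omega>) = 0\<close> at
  \<open>u + v\<close>.\<close>

lemma contr_anticommute:
  assumes "multilin \<omega>" "altern \<omega>"
  shows "contr u (contr v \<omega>) = - contr v (contr u \<omega>)"
proof -
  have "0 = contr (u + v) (contr (u + v) \<omega>)"
    using altern_contr_contr[OF assms(2)] by simp
  also have "\<dots> = contr u (contr v \<omega>) + contr v (contr u \<omega>)"
    using assms altern_contr_contr[OF assms(2)]
    by (simp add: contr_vec_linear multilin_contr add.commute)
  finally show ?thesis by (simp add: eq_neg_iff_add_eq_0)
qed

lemma altern_swap:
  assumes "multilin \<omega>" "altern \<omega>"
  shows "\<omega> x (ws @ u # v # us) = - \<omega> x (ws @ v # u # us)"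
  using assms
proof (induction ws arbitrary: \<omega>)
  case Nil
  then show ?case using contr_anticommute[of \<omega> v u] by (simp add: fun_eq_iff interior_prod_def)
next
  case (Cons w ws)
  then show ?case using Cons.IH[OF multilin_contr[OF Cons.prems(1)] altern_contr[OF Cons.prems(2)]]
    by (simp add: interior_prod_def)
qed

text \<open>Adjacent transpositions bring the two equal arguments together, at the cost of a
  sign.\<close>

lemma altern_repeat:
  assumes "multilin \<omega>" "altern \<omega>"
  shows "\<omega> x (ws @ v # ms @ v # us) = 0"
proof (induction ms arbitrary: ws)
  case Nil then show ?case using assms(2) by (simp add: altern_def)
next
  case (Cons m ms)
  then show ?case using altern_swap[OF assms, of x ws v m] Cons[of "ws @ [m]"] by simp
qed

lemma all_forms_iff: "\<omega> \<in> all_forms \<longleftrightarrow> multilin \<omega> \<and> altern \<omega> \<and> smooth_form \<omega>"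
proof
  assume \<omega>: "\<omega> \<in> all_forms"
  have "linear (\<lambda>u. \<omega> x (ws @ u # us))" for x ws us
  proof -
    have "\<And>x vs i. i < length vs \<Longrightarrow> linear (\<lambda>u. \<omega> x (vs[i := u]))"
      using \<omega> by (simp add: all_forms_def)
    \<comment> \<open>\<open>undefined\<close> only reserves the slot; the list update overwrites
      it.\<close>
    from this[of "length ws" "ws @ undefined # us" x] show ?thesis by simp
  qed
  moreover have "\<omega> x (ws @ v # v # us) = 0" for x ws v us
  proof -
    have "length ws < Suc (length ws)" "Suc (length ws) < length (ws @ v # v # us)"
      "(ws @ v # v # us) ! length ws = (ws @ v # v # us) ! Suc (length ws)"
      by (simp_all add: nth_append)
    then show ?thesis using \<omega> unfolding all_forms_def by blast
  qed
  ultimately show "multilin \<omega> \<and> altern \<omega> \<and> smooth_form \<omega>"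
    using \<omega> by (simp add: multilin_def altern_def smooth_form_def all_forms_def)
next
  assume *: "multilin \<omega> \<and> altern \<omega> \<and> smooth_form \<omega>"
  have "\<omega> x vs = 0" if "i < j" "j < length vs" "vs ! i = vs ! j" for x vs i j
  proof -
    define ms where "ms = take (j - Suc i) (drop (Suc i) vs)"
    have "j - Suc i < length (drop (Suc i) vs)" using that by simp
    from id_take_nth_drop[OF this] have "drop (Suc i) vs = ms @ vs ! j # drop (Suc j) vs"
      using that by (simp add: ms_def)
    moreover have "vs = take i vs @ vs ! i # drop (Suc i) vs"
      using that by (intro id_take_nth_drop) simp
    ultimately have "vs = take i vs @ vs ! i # ms @ vs ! i # drop (Suc j) vs"
      using that(3) by simp
    then show ?thesis using altern_repeat * by metis
  qed
  moreover have "linear (\<lambda>u. \<omega> x (vs[i := u]))" if "i < length vs" for x vs i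
    using * that by (simp add: upd_conv_take_nth_drop multilin_def)
  ultimately show "\<omega> \<in> all_forms"
    using * by (auto simp: all_forms_def smooth_form_def)
qed

lemma forms_iff: "\<omega> \<in> forms k \<longleftrightarrow> \<omega> \<in> all_forms \<and> degree_form k \<omega>"
  by (auto simp: forms_def degree_form_def)

lemma multilin_zero [simp]: "multilin 0"
  by (simp add: multilin_def linear_iff)

lemma multilin_add: "multilin \<sigma> \<Longrightarrow> multilin \<tau> \<Longrightarrow> multilin (\<sigma> + \<tau>)"
  by (simp add: multilin_def linear_compose_add)

lemma multilin_diff: "multilin \<sigma> \<Longrightarrow> multilin \<tau> \<Longrightarrow> multilin (\<sigma> - \<tau>)"
  by (simp add: multilin_def linear_compose_sub)

lemma multilin_sum: "(\<And>a. a \<in> A \<Longrightarrow> multilin (\<sigma> a)) \<Longrightarrow> multilin (sum \<sigma> A)"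
  by (induction A rule: infinite_finite_induct) (simp_all add: multilin_add del: plus_fun_apply zero_fun_apply)

lemma linear_cmult: "linear f \<Longrightarrow> linear (\<lambda>u. c * f u :: real)"
  using linear_compose_scale_right[of f c] by simp

lemma multilin_fscale: "multilin \<sigma> \<Longrightarrow> multilin (fscale f \<sigma>)"
  unfolding multilin_def fscale_def by (intro allI linear_cmult) blast

lemma multilin_grade_inv: "multilin \<sigma> \<Longrightarrow> multilin (grade_inv \<sigma>)"
  unfolding multilin_def grade_inv_def length_append length_Cons by (intro allI linear_cmult) blast

lemma altern_zero [simp]: "altern 0"
  by (simp add: altern_def)

lemma altern_add: "altern \<sigma> \<Longrightarrow> altern \<tau> \<Longrightarrow> altern (\<sigma> + \<tau>)"
  by (simp add: altern_def)

lemma altern_diff: "altern \<sigma> \<Longrightarrow> altern \<tau> \<Longrightarrow> altern (\<sigma> - \<tau>)"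
  by (simp add: altern_def)

lemma altern_sum: "(\<And>a. a \<in> A \<Longrightarrow> altern (\<sigma> a)) \<Longrightarrow> altern (sum \<sigma> A)"
  by (simp add: altern_def sum_apply)

lemma altern_fscale: "altern \<sigma> \<Longrightarrow> altern (fscale f \<sigma>)"
  by (simp add: altern_def fscale_def)

lemma altern_grade_inv: "altern \<sigma> \<Longrightarrow> altern (grade_inv \<sigma>)"
  by (simp add: altern_def grade_inv_def)

lemma multilin_wedge:
  assumes "multilin \<sigma>" "multilin \<tau>"
  shows "multilin (\<sigma> \<curlywedge> \<tau>)"
proof -
  have "linear (\<lambda>u. (\<sigma> \<curlywedge> \<tau>) x (ws @ u # us))" for x ws us
    using assms
  proof (induction ws arbitrary: \<sigma> \<tau>)
    case Nil
    then show ?case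
      by (auto intro!: linearI simp: wedge_Cons contr_vec_linear wedge_add_left wedge_add_right)
        (simp_all add: fscale_def distrib_left)
  next
    case (Cons w ws)
    then show ?case
      by (auto simp: wedge_Cons multilin_contr multilin_grade_inv intro!: linear_compose_add)
  qed
  then show ?thesis by (simp add: multilin_def)
qed

lemma altern_wedge:
  assumes "altern \<sigma>" "altern \<tau>"
  shows "altern (\<sigma> \<curlywedge> \<tau>)"
proof -
  have "(\<sigma> \<curlywedge> \<tau>) x (ws @ v # v # us) = 0" for x ws v us
    using assms
  proof (induction ws arbitrary: \<sigma> \<tau>)
    case Nil
    then show ?case
      by (simp add: wedge_Cons contr_grade_inv altern_contr_contr)
  next
    case (Cons w ws)
    then show ?case
      by (simp add: wedge_Cons altern_contr altern_grade_inv)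
  qed
  then show ?thesis by (simp add: altern_def)
qed

lemma multilin_lin_act:
  assumes "linear T" "multilin \<sigma>"
  shows "multilin (lin_act T \<sigma>)"
proof -
  have "linear (\<lambda>u. lin_act T \<sigma> x (ws @ u # us))" for x ws us
    using assms(2)
  proof (induction ws arbitrary: \<sigma>)
    case Nil
    then show ?case
      by (auto intro!: linearI simp: lin_act_Cons contr_vec_linear lin_act_add linear_add[OF assms(1)]
          linear_scale[OF assms(1)]) (simp_all add: fscale_def distrib_left)
  next
    case (Cons w ws)
    have "linear (\<lambda>u. contr (T w) \<sigma> x (ws @ u # us))"
      using multilin_contr[OF Cons.prems] by (simp add: multilin_def)
    moreover have "linear (\<lambda>u. lin_act T (contr w \<sigma>) x (ws @ u # us))"
      using Cons by (simp add: multilin_contr)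
    ultimately show ?case
      by (simp add: lin_act_Cons linear_compose_add)
  qed
  then show ?thesis by (simp add: multilin_def)
qed

lemma altern_lin_act:
  assumes "multilin \<sigma>" "altern \<sigma>"
  shows "altern (lin_act T \<sigma>)"
proof -
  have "lin_act T \<sigma> x (ws @ v # v # us) = 0" for x ws v us
    using assms
  proof (induction ws arbitrary: \<sigma>)
    case Nil
    \<comment> \<open>The mixed contractions along \<open>v\<close> and \<open>T v\<close> occur in
      both orders and cancel by anticommutation.\<close>
    have "contr v (contr v (lin_act T \<sigma>)) = 0"
      using Nil contr_anticommute[of \<sigma> "T v" v]
      by (simp add: contr_lin_act altern_contr_contr)
    then show ?case by (simp add: fun_eq_iff interior_prod_def)
  next
    case (Cons w ws)
    have "contr (T w) \<sigma> x (ws @ v # v # us) = 0"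
      using altern_contr[OF Cons.prems(2)] by (simp add: altern_def)
    with Cons show ?case
      by (simp add: lin_act_Cons altern_contr multilin_contr)
  qed
  then show ?thesis by (simp add: altern_def)
qed

lemma multilin_dir_deriv:
  assumes "multilin \<sigma>" "smooth_form \<sigma>"
  shows "multilin (dir_deriv v \<sigma>)"
proof -
  have l: "linear (\<lambda>u. \<sigma> x (ws @ u # us))" for x ws us
    using assms(1) by (simp add: multilin_def)
  show ?thesis
    unfolding multilin_def dir_deriv_def
    using assms(2)
    by (auto intro!: linearI simp: linear_add[OF l] linear_scale[OF l] smooth_form_def
        smooth_dd_add smooth_dd_cmult)
qed

lemma altern_dir_deriv: "altern \<sigma> \<Longrightarrow> altern (dir_deriv v \<sigma>)"
  by (simp add: altern_def dir_deriv_def)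

lemma all_forms_linear:
  "0 \<in> all_forms"
  "\<sigma> \<in> all_forms \<Longrightarrow> \<tau> \<in> all_forms \<Longrightarrow> \<sigma> + \<tau> \<in> all_forms"
  "\<sigma> \<in> all_forms \<Longrightarrow> \<tau> \<in> all_forms \<Longrightarrow> \<sigma> - \<tau> \<in> all_forms"
  "\<sigma> \<in> all_forms \<Longrightarrow> smooth f \<Longrightarrow> fscale f \<sigma> \<in> all_forms"
  by (simp_all add: all_forms_iff multilin_add altern_add smooth_form_add multilin_diff altern_diff
      smooth_form_diff multilin_fscale altern_fscale smooth_form_fscale)

lemma all_forms_sum: "(\<And>a. a \<in> A \<Longrightarrow> \<sigma> a \<in> all_forms) \<Longrightarrow> sum \<sigma> A \<in> all_forms"
  by (simp add: all_forms_iff multilin_sum altern_sum smooth_form_sum)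

lemma all_forms_wedge: "\<sigma> \<in> all_forms \<Longrightarrow> \<tau> \<in> all_forms \<Longrightarrow> \<sigma> \<curlywedge> \<tau> \<in> all_forms"
  by (simp add: all_forms_iff multilin_wedge altern_wedge smooth_form_wedge)

lemma all_forms_lin_act: "linear T \<Longrightarrow> \<sigma> \<in> all_forms \<Longrightarrow> lin_act T \<sigma> \<in> all_forms"
  by (simp add: all_forms_iff multilin_lin_act altern_lin_act smooth_form_lin_act)

lemma all_forms_dir_deriv: "\<sigma> \<in> all_forms \<Longrightarrow> dir_deriv v \<sigma> \<in> all_forms"
  by (simp add: all_forms_iff multilin_dir_deriv altern_dir_deriv smooth_form_dir_deriv)

lemma ext_deriv_all_forms:
  assumes "\<sigma> \<in> all_forms"
  shows "ext_deriv \<sigma> \<in> all_forms"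
proof -
  have "linear (\<lambda>u. ext_deriv \<sigma> x (ws @ u # us))" for x ws us
    using assms
  proof (induction ws arbitrary: \<sigma>)
    case Nil
    then show ?case
      by (auto intro!: linearI simp: all_forms_iff ext_deriv_Cons contr_vec_linear ext_deriv_add
         smooth_form_contr dir_deriv_vec_linear)
        (simp add: fscale_def ext_deriv_def smooth_dd_cmult smooth_form_contr smooth_formD
          sum_distrib_left right_diff_distrib mult.left_commute)
  next
    case (Cons w ws)
    have "contr w \<sigma> \<in> all_forms"
      using Cons.prems by (simp add: all_forms_iff multilin_contr altern_contr smooth_form_contr)
    moreover have "linear (\<lambda>u. dir_deriv w \<sigma> x (ws @ u # us))"
      using multilinD[OF multilin_dir_deriv] Cons.prems unfolding all_forms_iff by blast
    ultimately show ?case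
      using Cons.IH unfolding append_Cons ext_deriv_Cons by (intro linear_compose_sub)
  qed
  then have "multilin (ext_deriv \<sigma>)" unfolding multilin_def by blast
  moreover have "ext_deriv \<sigma> x (ws @ v # v # us) = 0" for x ws v us
    using assms
  proof (induction ws arbitrary: \<sigma>)
    case Nil
    \<comment> \<open>With Cartan's formula used twice, the two terms
      \<open>dir_deriv v (contr v \<sigma>)\<close> cancel, and the rest is the differential of a
      repeated contraction.\<close>
    then have "contr v (contr v (ext_deriv \<sigma>)) = 0"
      by (simp add: all_forms_iff contr_ext_deriv contr_dir_deriv altern_contr_contr)
    then show ?case by (simp add: fun_eq_iff interior_prod_def)
  next
    case (Cons w ws)
    have "contr w \<sigma> \<in> all_forms"
      using Cons.prems by (simp add: all_forms_iff multilin_contr altern_contr smooth_form_contr)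
    moreover have "dir_deriv w \<sigma> x (ws @ v # v # us) = 0"
      using alternD[OF altern_dir_deriv] Cons.prems unfolding all_forms_iff by blast
    ultimately show ?case
      using Cons.IH by (simp add: ext_deriv_Cons)
  qed
  ultimately show ?thesis
    using assms by (simp add: all_forms_iff altern_def smooth_form_ext_deriv)
qed

lemma linear_zero_fun [simp]: "linear (\<lambda>_. 0)"
  by (rule module_hom_zero)

lemma fun_form_forms:
  assumes "smooth f"
  shows "fun_form f \<in> forms 0"
proof -
  have "multilin (fun_form f)" "altern (fun_form f)"
    by (simp_all add: multilin_def altern_def fun_form_def)
  moreover have "smooth (\<lambda>x. fun_form f x vs)" for vs
    using assms by (cases "vs = []") (simp_all add: fun_form_def)
  ultimately show ?thesis
    by (simp add: forms_iff all_forms_iff smooth_form_def degree_form_def fun_form_def)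
qed

lemma fun_form_wedge: "fun_form f \<curlywedge> \<tau> = fscale f \<tau>"
proof -
  have c: "contr v (fun_form f) = 0" "grade_inv (fun_form f) = fun_form f" for v
    by (auto simp: fun_eq_iff interior_prod_def fun_form_def grade_inv_def)
  have "(fun_form f \<curlywedge> \<tau>) x vs = fscale f \<tau> x vs" for x vs
  proof (induction vs arbitrary: \<tau>)
    case Nil then show ?case by (simp add: fun_form_def fscale_def)
  next
    case (Cons v vs) then show ?case by (simp add: wedge_Cons c fscale_def interior_prod_def)
  qed
  then show ?thesis by (simp add: fun_eq_iff)
qed

lemma dir_deriv_fun_form: "dir_deriv v (fun_form f) = fun_form (dd f v)"
  by (auto simp: fun_eq_iff dir_deriv_def fun_form_def)

lemma lin_act_fun_form [simp]: "lin_act T (fun_form f) = 0"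
  by (rule lin_act_degree_0) (simp add: degree_form_def fun_form_def)

lemma ext_deriv_fun_form: "ext_deriv (fun_form f) x [v] = dd f v x"
  by (simp add: ext_deriv_def fun_form_def)

lemma ext_deriv_fun_form_forms: "smooth f \<Longrightarrow> ext_deriv (fun_form f) \<in> forms 1"
  using fun_form_forms[of f] degree_form_ext_deriv[of 0 "fun_form f"]
  by (simp add: forms_iff ext_deriv_all_forms)

lemma one_form_append [simp]:
  "one_form f x (ws @ u # us) = (if ws = [] \<and> us = [] then f u else 0)"
  by (auto simp: one_form_def split: list.splits) (auto simp: append_eq_Cons_conv)

lemma one_form_forms:
  assumes "linear f"
  shows "one_form f \<in> forms 1"
proof -
  have "linear (\<lambda>u. one_form f x (ws @ u # us))" for x ws us
  proof (cases "ws = [] \<and> us = []")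
    case True
    then have "(\<lambda>u. one_form f x (ws @ u # us)) = f" by (simp add: one_form_def)
    then show ?thesis using assms by metis
  next
    case False
    then have "(\<lambda>u. one_form f x (ws @ u # us)) = (\<lambda>_. 0)"
      by (simp only: one_form_append if_False)
    then show ?thesis using linear_zero_fun by metis
  qed
  then have "multilin (one_form f)"
    unfolding multilin_def by blast
  moreover have "altern (one_form f)"
    unfolding altern_def by simp
  moreover have "smooth (\<lambda>x. one_form f x vs)" for vs
    by (simp add: one_form_def)
  ultimately show ?thesis
    by (auto simp: forms_iff all_forms_iff smooth_form_def one_form_def degree_form_def
        split: list.splits)
qed

lemma contr_one_form: "contr v (one_form f) = fun_form (\<lambda>_. f v)"
  by (auto simp: fun_eq_iff interior_prod_def one_form_def fun_form_def split: list.splits)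

lemma forms_1_eqI:
  assumes "\<alpha> \<in> forms 1" "\<beta> \<in> forms 1" "\<And>x v. \<alpha> x [v] = \<beta> x [v]"
  shows "\<alpha> = \<beta>"
proof (intro ext)
  fix x vs
  show "\<alpha> x vs = \<beta> x vs"
  proof (cases "length vs = 1")
    case True then show ?thesis using assms(3) by (auto simp: length_Suc_conv)
  next
    case False then show ?thesis using assms(1,2) by (simp add: forms_def)
  qed
qed

section \<open>Finite dimensional inner product spaces\<close>

lemma bilinear_lsum: "bilinear h \<Longrightarrow> h (sum f A) y = (\<Sum>a\<in>A. h (f a) y)"
  unfolding bilinear_def by (rule linear_sum[of "\<lambda>x. h x y"]) simp

lemma subspace_finite_span:
  fixes E V :: "'a::real_vector set"
  assumes "finite E" "span E = UNIV" "subspace V"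
  obtains B where "finite B" "B \<subseteq> V" "span B = V"
proof -
  obtain B where B: "B \<subseteq> V" "independent B" "V \<subseteq> span B"
    using maximal_independent_subset[of V] by blast
  have "finite B"
    using real_vector.independent_span_bound[OF \<open>finite E\<close> B(2)] assms(2) by simp
  moreover have "span B = V"
    using B assms(3) by (simp add: span_minimal subset_antisym)
  ultimately show thesis using that B(1) by blast
qed

lemma basis_coefficient:
  fixes \<beta> :: "'a::real_vector \<Rightarrow> 'a \<Rightarrow> real"
  assumes \<beta>: "bilinear \<beta>" and F: "finite F" "\<And>a. a \<in> F \<Longrightarrow> \<beta> a f = (if a = f then 1 else 0)" "f \<in> F"
  shows "\<beta> (\<Sum>g\<in>F. c g *\<^sub>R g) f = c f"
proof -
  have "\<beta> (\<Sum>g\<in>F. c g *\<^sub>R g) f = (\<Sum>g\<in>F. if g = f then c g else 0)"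
    unfolding bilinear_lsum[OF \<beta>] bilinear_lmul[OF \<beta>] using F(2) by (intro sum.cong) auto
  then show ?thesis using F(1,3) by simp
qed

text \<open>Formulated for a bilinear form that is positive only on \<open>V\<close>, because it
  serves both the inner product and the form \<open>\<kappa>\<close>, which is definite only on a
  subspace.\<close>

lemma gram_schmidt:
  fixes \<beta> :: "'a::real_vector \<Rightarrow> 'a \<Rightarrow> real"
  assumes \<beta>: "bilinear \<beta>" and sym: "\<And>u v. \<beta> u v = \<beta> v u"
    and V: "subspace V" and pos: "\<And>v. v \<in> V \<Longrightarrow> v \<noteq> 0 \<Longrightarrow> \<beta> v v > 0"
    and B: "finite B" "B \<subseteq> V"
  shows "\<exists>F. finite F \<and> F \<subseteq> V \<and> (\<forall>a\<in>F. \<forall>b\<in>F. \<beta> a b = (if a = b then 1 else 0)) \<and> span F = span B"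
  using B
proof (induction B rule: finite_induct)
  case empty
  then show ?case by (intro exI[of _ "{}"]) auto
next
  case (insert b B)
  then have "B \<subseteq> V" by blast
  with insert.IH obtain F where F: "finite F" "F \<subseteq> V"
    "\<forall>a\<in>F. \<forall>b\<in>F. \<beta> a b = (if a = b then 1 else 0)" "span F = span B"
    by blast
  define p where "p = (\<Sum>f\<in>F. \<beta> b f *\<^sub>R f)"
  define w where "w = b - p"
  have pF: "p \<in> span F" unfolding p_def by (intro span_sum span_scale span_base)
  have pV: "p \<in> V" using pF F(2) V span_minimal by blast
  have wV: "w \<in> V" using pV insert.prems V by (simp add: w_def subspace_diff)
  have wF: "\<beta> w f = 0" if "f \<in> F" for f
    using basis_coefficient[OF \<beta> F(1) _ that, of "\<lambda>g. \<beta> b g"] F(3) that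
    by (simp add: w_def p_def bilinear_lsub[OF \<beta>])
  show ?case
  proof (cases "w = 0")
    case True
    then have "b \<in> span B" using pF F(4) by (simp add: w_def)
    then have "span (insert b B) = span B" by (simp add: span_redundant)
    then show ?thesis using F by (intro exI[of _ F]) auto
  next
    case False
    define c where "c = 1 / sqrt (\<beta> w w)"
    define v where "v = c *\<^sub>R w"
    have ww: "\<beta> w w > 0" using pos[OF wV False] .
    have c: "c \<noteq> 0" using ww by (simp add: c_def)
    have vv: "\<beta> v v = 1"
      using ww by (simp add: v_def c_def bilinear_lmul[OF \<beta>] bilinear_rmul[OF \<beta>])
    have vF: "\<beta> v f = 0" "\<beta> f v = 0" if "f \<in> F" for f
      using wF[OF that] sym by (simp_all add: v_def bilinear_lmul[OF \<beta>] bilinear_rmul[OF \<beta>])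
    have "span (insert b B) = span (insert v F)"
    proof (rule span_eq[THEN iffD2], intro conjI insert_subsetI)
      have "b = (1 / c) *\<^sub>R v + p" using c by (simp add: v_def w_def)
      moreover have "(1 / c) *\<^sub>R v + p \<in> span (insert v F)"
        using pF by (intro span_add span_scale) (auto intro: span_base span_mono[THEN subsetD, rotated])
      ultimately show "b \<in> span (insert v F)" by simp
      show "B \<subseteq> span (insert v F)"
        using F(4) span_superset[of B] span_mono[of F "insert v F"] by auto
      have "p \<in> span (insert b B)" using pF F(4) span_mono[of B "insert b B"] by auto
      then show "v \<in> span (insert b B)"
        unfolding v_def w_def by (intro span_scale span_diff) (auto intro: span_base)
      show "F \<subseteq> span (insert b B)"
        using F(4) span_superset[of F] span_mono[of B "insert b B"] by auto
    qed
    moreover have "v \<notin> F" using vv vF(1)[of v] by auto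
    ultimately show ?thesis
      using F(1,2) vv vF wV subspace_scale[OF V wV, of c] F(3)[rule_format]
      by (intro exI[of _ "insert v F"]) (auto simp: v_def[symmetric])
  qed
qed

lemma span_expand:
  fixes \<beta> :: "'a::real_vector \<Rightarrow> 'a \<Rightarrow> real"
  assumes \<beta>: "bilinear \<beta>" and F: "finite F"
    "\<And>a b. a \<in> F \<Longrightarrow> b \<in> F \<Longrightarrow> \<beta> a b = (if a = b then 1 else 0)" and v: "v \<in> span F"
  shows "v = (\<Sum>f\<in>F. \<beta> v f *\<^sub>R f)"
proof -
  obtain c where c: "v = (\<Sum>f\<in>F. c f *\<^sub>R f)"
    using v span_finite[OF F(1)] by auto
  have "\<beta> v f = c f" if "f \<in> F" for f
    unfolding c by (rule basis_coefficient[OF \<beta> F(1) F(2)[OF _ that] that])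
  then show ?thesis using c by simp
qed

lemma bilinear_inner: "bilinear (\<bullet>)"
  using bilinear_conv_bounded_bilinear bounded_bilinear_inner
  by (simp add: bilinear_def inner_add_left inner_add_right linear_iff)

lemma orthonormal_basis_exists:
  fixes V :: "'a::real_inner set"
  assumes "finite E" "span E = (UNIV :: 'a set)" "subspace V"
  obtains F where "finite F" "F \<subseteq> V" "\<And>a b. a \<in> F \<Longrightarrow> b \<in> F \<Longrightarrow> a \<bullet> b = (if a = b then 1 else 0)"
    "span F = V"
proof -
  obtain B where B: "finite B" "B \<subseteq> V" "span B = V"
    using subspace_finite_span[OF assms] by blast
  from gram_schmidt[OF bilinear_inner inner_commute assms(3) _ B(1,2)] B(3) show thesis
    using that by auto
qed

text \<open>The type is merely \<open>real_inner\<close> and finite dimension is an assumption, so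
  the basis is a parameter. This also allows a second basis to be interpreted when volumes are
  compared.\<close>

locale orthonormal_basis =
  fixes Bs :: "'a::real_inner set"
  assumes fin: "finite Bs"
    and orthonormal: "\<And>a b. a \<in> Bs \<Longrightarrow> b \<in> Bs \<Longrightarrow> a \<bullet> b = (if a = b then 1 else 0)"
    and spans: "span Bs = UNIV"
begin

lemma expand: "(\<Sum>e\<in>Bs. (u \<bullet> e) *\<^sub>R e) = u"
  using span_expand[OF bilinear_inner fin orthonormal, of u] spans by simp

lemma inner_expand: "(\<Sum>e\<in>Bs. (u \<bullet> e) * (v \<bullet> e)) = u \<bullet> v"
proof -
  have "u \<bullet> v = u \<bullet> (\<Sum>e\<in>Bs. (v \<bullet> e) *\<^sub>R e)" by (simp add: expand)
  also have "\<dots> = (\<Sum>e\<in>Bs. (u \<bullet> e) * (v \<bullet> e))"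
    by (simp add: inner_sum_right mult.commute)
  finally show ?thesis by simp
qed

lemma linear_expand:
  assumes "linear f"
  shows "(\<Sum>e\<in>Bs. (u \<bullet> e) *\<^sub>R f e) = f u"
proof -
  have "f u = f (\<Sum>e\<in>Bs. (u \<bullet> e) *\<^sub>R e)" by (simp add: expand)
  then show ?thesis by (simp add: linear_sum[OF assms] linear_scale[OF assms])
qed

lemma trace_commute:
  assumes "linear S" "linear T"
  shows "(\<Sum>e\<in>Bs. S (T e) \<bullet> e) = (\<Sum>e\<in>Bs. T (S e) \<bullet> e)"
proof -
  have *: "(\<Sum>e\<in>Bs. S (T e) \<bullet> e) = (\<Sum>e\<in>Bs. \<Sum>f\<in>Bs. (T e \<bullet> f) * (S f \<bullet> e))"
    if "linear S" for S T :: "'a \<Rightarrow> 'a"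
  proof (rule sum.cong[OF refl])
    fix e
    have "S (T e) \<bullet> e = (\<Sum>f\<in>Bs. (T e \<bullet> f) *\<^sub>R S f) \<bullet> e"
      by (simp only: linear_expand[OF that])
    then show "S (T e) \<bullet> e = (\<Sum>f\<in>Bs. (T e \<bullet> f) * (S f \<bullet> e))"
      by (simp add: inner_sum_left)
  qed
  have "(\<Sum>e\<in>Bs. S (T e) \<bullet> e) = (\<Sum>f\<in>Bs. \<Sum>e\<in>Bs. (T e \<bullet> f) * (S f \<bullet> e))"
    unfolding *[OF assms(1)] by (rule sum.swap)
  also have "\<dots> = (\<Sum>e\<in>Bs. T (S e) \<bullet> e)"
    unfolding *[OF assms(2)] by (simp only: mult.commute)
  finally show ?thesis .
qed

lemma projection:
  fixes V :: "'a set"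
  assumes "subspace V"
  obtains p where "p \<in> V" "\<And>v. v \<in> V \<Longrightarrow> (x - p) \<bullet> v = 0"
proof -
  obtain F where F: "finite F" "F \<subseteq> V" "\<And>a b. a \<in> F \<Longrightarrow> b \<in> F \<Longrightarrow> a \<bullet> b = (if a = b then 1 else 0)"
    "span F = V"
    using orthonormal_basis_exists[OF fin spans assms] by blast
  define p where "p = (\<Sum>f\<in>F. (x \<bullet> f) *\<^sub>R f)"
  have "p \<in> V" unfolding p_def F(4)[symmetric] by (intro span_sum span_scale span_base)
  moreover have "(x - p) \<bullet> v = 0" if "v \<in> V" for v
  proof -
    have "(x - p) \<bullet> f = 0" if "f \<in> F" for f
      using basis_coefficient[OF bilinear_inner F(1) F(3)[OF _ that] that, of "\<lambda>f. x \<bullet> f"]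
      by (simp add: p_def inner_diff_left)
    then have "span F \<subseteq> {v. (x - p) \<bullet> v = 0}"
      by (intro span_minimal) (auto simp: subspace_def inner_add_right)
    then show ?thesis using F(4) that by auto
  qed
  ultimately show thesis using that by blast
qed

text \<open>\<open>adjoint\<close> is a choice; the expansion in the basis provides the witness that
  gives the choice its defining property.\<close>

lemma adjoint_inner:
  fixes f :: "'a \<Rightarrow> 'a"
  assumes "linear f"
  shows "f x \<bullet> y = x \<bullet> adjoint f y"
proof -
  have "\<forall>x y. f x \<bullet> y = x \<bullet> (\<Sum>e\<in>Bs. (f e \<bullet> y) *\<^sub>R e)"
  proof (intro allI)
    fix x y
    have "f x \<bullet> y = (\<Sum>e\<in>Bs. (x \<bullet> e) *\<^sub>R f e) \<bullet> y" by (simp add: linear_expand[OF assms])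
    then show "f x \<bullet> y = x \<bullet> (\<Sum>e\<in>Bs. (f e \<bullet> y) *\<^sub>R e)"
      by (simp add: inner_sum_left inner_sum_right mult.commute)
  qed
  then have "\<exists>f'. \<forall>x y. f x \<bullet> y = x \<bullet> f' y" by (intro exI)
  from someI_ex[OF this] show ?thesis unfolding adjoint_def by blast
qed

end

section \<open>Flat metric Lie algebras\<close>

locale metric_lie_algebra = orthonormal_basis Bs for Bs :: "'a::real_inner set" +
  fixes br :: "'a \<Rightarrow> 'a \<Rightarrow> 'a"
  assumes lie: "lie_algebra br"
begin

lemma br_bilinear: "bilinear br"
  using lie by (simp add: lie_algebra_def)

lemmas br_simps = bilinear_ladd[OF br_bilinear] bilinear_radd[OF br_bilinear]
  bilinear_lmul[OF br_bilinear] bilinear_rmul[OF br_bilinear] bilinear_lneg[OF br_bilinear]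
  bilinear_rneg[OF br_bilinear] bilinear_lzero[OF br_bilinear] bilinear_rzero[OF br_bilinear]
  bilinear_lsub[OF br_bilinear] bilinear_rsub[OF br_bilinear]

lemma br_linear: "linear (br a)" "linear (\<lambda>a. br a b)"
  using br_bilinear by (simp_all add: bilinear_def)

lemma br_swap: "br a b = - br b a"
proof -
  have "\<And>u. br u u = 0" using lie by (simp add: lie_algebra_def)
  from this[of "a + b"] this[of a] this[of b] show ?thesis
    by (simp add: br_simps add_eq_0_iff)
qed

lemma jacobi: "br (br a b) c = br a (br b c) - br b (br a c)"
proof -
  have "br a (br b c) + br b (br c a) + br c (br a b) = 0"
    using lie by (simp add: lie_algebra_def)
  then show ?thesis
    using br_swap[of c a] br_swap[of c "br a b"] by (simp add: br_simps algebra_simps)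
qed

text \<open>Koszul's formula for the Levi-Civita product.\<close>

definition lc :: "'a \<Rightarrow> 'a \<Rightarrow> 'a" where
  "lc a b = (\<Sum>e\<in>Bs. ((br a b \<bullet> e + br e a \<bullet> b + br e b \<bullet> a) / 2) *\<^sub>R e)"

lemma lc_inner: "lc a b \<bullet> c = (br a b \<bullet> c + br c a \<bullet> b + br c b \<bullet> a) / 2"
proof -
  let ?f = "\<lambda>c. (br a b \<bullet> c + br c a \<bullet> b + br c b \<bullet> a) / 2"
  have "linear ?f"
    by (rule linearI) (simp_all add: br_simps inner_add_left inner_add_right algebra_simps add_divide_distrib)
  have "lc a b \<bullet> c = (\<Sum>e\<in>Bs. (c \<bullet> e) *\<^sub>R ?f e)"
    by (simp add: lc_def inner_sum_left inner_sum_right inner_commute mult.commute)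
  also have "\<dots> = ?f c" by (rule linear_expand) fact
  finally show ?thesis .
qed

lemma inner_eqI: "(\<And>w. u \<bullet> w = v \<bullet> w) \<Longrightarrow> u = v" for u v :: 'a
  using vector_eq_rdot by blast

lemma lc_bilinear: "bilinear lc"
  unfolding bilinear_def
proof (intro conjI allI linearI)
  show "lc a (b + b') = lc a b + lc a b'" "lc (b + b') a = lc b a + lc b' a"
    "lc a (r *\<^sub>R b) = r *\<^sub>R lc a b" "lc (r *\<^sub>R b) a = r *\<^sub>R lc b a" for a b b' r
    by (rule inner_eqI, simp add: lc_inner br_simps inner_add_left inner_add_right
        add_divide_distrib distrib_left)+
qed

lemmas lc_simps = bilinear_ladd[OF lc_bilinear] bilinear_radd[OF lc_bilinear]
  bilinear_lmul[OF lc_bilinear] bilinear_rmul[OF lc_bilinear] bilinear_lneg[OF lc_bilinear]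
  bilinear_rneg[OF lc_bilinear] bilinear_lzero[OF lc_bilinear] bilinear_rzero[OF lc_bilinear]
  bilinear_lsub[OF lc_bilinear] bilinear_rsub[OF lc_bilinear]

lemma lc_linear: "linear (lc a)" "linear (\<lambda>a. lc a b)"
  using lc_bilinear by (simp_all add: bilinear_def)

lemma lc_skew: "lc a b \<bullet> c = - (b \<bullet> lc a c)"
  using br_swap[of b c] br_swap[of c a] br_swap[of b a]
  by (simp add: lc_inner inner_commute[of b "lc a c"] field_simps)

lemma lc_torsion: "lc a b - lc b a = br a b"
proof (rule inner_eqI)
  fix c
  show "(lc a b - lc b a) \<bullet> c = br a b \<bullet> c"
    using br_swap[of b a] by (simp add: lc_inner inner_diff_left field_simps)
qed

lemma lc_swap: "lc a b = lc b a + br a b"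
  using lc_torsion[of a b] by (simp add: algebra_simps)

text \<open>Three instances of the torsion identity and three of skewness combine to Koszul's
  formula. It later pins down an arbitrary metric connection on constant forms.\<close>

lemma lc_unique:
  assumes "\<And>a b c. m a b \<bullet> c = - (b \<bullet> m a c)" "\<And>a b. m a b - m b a = br a b"
  shows "m a b = lc a b"
proof (rule inner_eqI)
  fix c
  have t: "m a b = m b a + br a b" for a b using assms(2)[of a b] by (simp add: algebra_simps)
  have "2 * (m a b \<bullet> c) = br a b \<bullet> c + br c a \<bullet> b + br c b \<bullet> a"
    using t[of a b] t[of c a] t[of c b] assms(1)[of a b c] assms(1)[of b a c] assms(1)[of c a b]
    by (simp add: inner_add_left inner_commute algebra_simps)
  then show "m a b \<bullet> c = lc a b \<bullet> c" by (simp add: lc_inner)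
qed

definition flat :: bool where
  "flat \<longleftrightarrow> (\<forall>a b c. lc (br a b) c = lc a (lc b c) - lc b (lc a c))"

definition unimodular :: bool where
  "unimodular \<longleftrightarrow> (\<forall>u. (\<Sum>e\<in>Bs. br u e \<bullet> e) = 0)"

lemma skew_part_iff: "u \<in> skew_part br \<longleftrightarrow> (\<forall>v w. br u v \<bullet> w = - (v \<bullet> br u w))"
proof -
  have "br u v + adjoint (br u) v = 0 \<longleftrightarrow> (\<forall>w. br u v \<bullet> w = - (v \<bullet> br u w))" for v
  proof -
    have "adjoint (br u) v \<bullet> w = v \<bullet> br u w" for w
      using adjoint_inner[OF br_linear(1), of u w v] by (simp add: inner_commute)
    then have "(\<forall>w. br u v \<bullet> w = - (v \<bullet> br u w)) \<longleftrightarrow> (\<forall>w. br u v \<bullet> w = (- adjoint (br u) v) \<bullet> w)"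
      by simp
    also have "\<dots> \<longleftrightarrow> br u v = - adjoint (br u) v" by (rule vector_eq_rdot)
    finally show ?thesis by (simp add: eq_neg_iff_add_eq_0)
  qed
  then show ?thesis by (simp add: skew_part_def)
qed

lemma skew_partD: "u \<in> skew_part br \<Longrightarrow> br u v \<bullet> w = - (v \<bullet> br u w)"
  unfolding skew_part_iff by blast

lemma subspace_skew_part: "subspace (skew_part br)"
  by (simp add: subspace_def skew_part_iff br_simps inner_add_left inner_add_right)

lemma br_derived: "br a b \<in> derived_ideal br"
  unfolding derived_ideal_def by (auto intro: span_base)

lemma sum_inner_eq_0:
  fixes f :: "'b \<Rightarrow> 'a"
  assumes "finite A" "(\<Sum>a\<in>A. f a \<bullet> f a) = 0" "a \<in> A"
  shows "f a = 0"
  using assms sum_nonneg_eq_0_iff[OF assms(1), of "\<lambda>a. f a \<bullet> f a"] by auto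

lemma lc_right_eq_0:
  assumes "\<And>e. e \<in> Bs \<Longrightarrow> lc e u = 0"
  shows "lc a u = 0"
  using linear_expand[OF lc_linear(2), of a u] assms by simp

section \<open>Flat unimodular metric Lie algebras are Milnor\<close>

context
  assumes flat: flat and unimodular: unimodular
begin

lemma lc_lc: "lc (br a b) c = lc a (lc b c) - lc b (lc a c)"
  using flat by (simp add: flat_def)

text \<open>\<open>R_b = L_b - ad_b\<close>, where \<open>L_b\<close> is skew, hence traceless, and
  \<open>ad_b\<close> is traceless by unimodularity.\<close>

lemma trace_right_mult: "(\<Sum>e\<in>Bs. lc e b \<bullet> e) = 0"
proof -
  have "lc e b \<bullet> e = - (br b e \<bullet> e)" for e
    using lc_skew[of b e e] lc_swap[of e b] br_swap[of e b]
    by (simp add: inner_add_left inner_diff_left inner_diff_right inner_commute)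
  then show ?thesis using unimodular by (simp add: unimodular_def sum_negf)
qed

text \<open>Flatness reads \<open>R_c R_b = R_d + [R_c, L_b]\<close> with \<open>d = lc b c\<close>;
  the commutator and \<open>R_d\<close> are both traceless.\<close>

lemma trace_right_mult_mult: "(\<Sum>e\<in>Bs. lc (lc e b) c \<bullet> e) = 0"
proof -
  have "lc (lc e b) c = lc (lc b e) c + lc e (lc b c) - lc b (lc e c)" for e
    by (subst lc_swap[of e b]) (simp add: lc_simps lc_lc)
  then have "(\<Sum>e\<in>Bs. lc (lc e b) c \<bullet> e) =
      (\<Sum>e\<in>Bs. lc (lc b e) c \<bullet> e) + (\<Sum>e\<in>Bs. lc e (lc b c) \<bullet> e) - (\<Sum>e\<in>Bs. lc b (lc e c) \<bullet> e)"
    by (simp add: inner_add_left inner_diff_left sum.distrib sum_subtractf)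
  then show ?thesis
    using trace_commute[OF lc_linear(2) lc_linear(1), of c b] trace_commute[OF lc_linear(2) lc_linear(1), of b c] by (simp add: trace_right_mult)
qed

text \<open>\<open>R_u = L_u - ad_u\<close> is a difference of skew operators, so the vanishing
  trace of its square is minus a sum of squared norms.\<close>

lemma skew_part_lc:
  assumes "u \<in> skew_part br"
  shows "lc a u = 0"
proof (rule lc_right_eq_0)
  fix e assume e: "e \<in> Bs"
  have "lc a u \<bullet> c = - (a \<bullet> lc c u)" for a c
    using assms lc_swap[of a u] lc_swap[of c u] br_swap[of a u] br_swap[of c u] lc_skew[of u a c]
    by (simp add: skew_part_iff inner_add_left inner_add_right inner_diff_left inner_diff_right)
  then have "lc (lc e u) u \<bullet> e = - (lc e u \<bullet> lc e u)" for e by simp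
  then have "(\<Sum>e\<in>Bs. lc e u \<bullet> lc e u) = 0"
    using trace_right_mult_mult[of u u] by (simp add: sum_negf)
  from sum_inner_eq_0[OF fin this e] show "lc e u = 0" .
qed

text \<open>In Koszul's formula for \<open>lc a z \<bullet> c\<close> the term
  \<open>br c a \<bullet> z\<close> drops out, and what is left is symmetric in \<open>a\<close> and
  \<open>c\<close>. Once \<open>R_z\<close> vanishes, \<open>ad_z\<close> equals the skew operator
  \<open>L_z\<close>.\<close>

lemma derived_perp_skew_part:
  assumes "\<And>v. v \<in> derived_ideal br \<Longrightarrow> z \<bullet> v = 0"
  shows "z \<in> skew_part br"
proof -
  have "lc a z \<bullet> c = a \<bullet> lc c z" for a c
    using assms[OF br_derived[of c a]] assms[OF br_derived[of a c]]
    by (simp add: lc_inner inner_commute[of a] inner_commute[of z])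
  then have "lc (lc e z) z \<bullet> e = lc e z \<bullet> lc e z" for e by simp
  then have "(\<Sum>e\<in>Bs. lc e z \<bullet> lc e z) = 0"
    using trace_right_mult_mult[of z z] by simp
  note zero = sum_inner_eq_0[OF fin this]
  have "lc a z = 0" for a
    by (rule lc_right_eq_0) (rule zero)
  then have "br z v = lc z v" for v
    using lc_torsion[of z v] by simp
  then show ?thesis by (simp add: skew_part_iff lc_skew)
qed

lemma skew_part_perp: "orthogonal_comp (skew_part br) = derived_ideal br"
proof
  show "orthogonal_comp (skew_part br) \<subseteq> derived_ideal br"
  proof
    fix x assume x: "x \<in> orthogonal_comp (skew_part br)"
    obtain p where p: "p \<in> derived_ideal br" "\<And>v. v \<in> derived_ideal br \<Longrightarrow> (x - p) \<bullet> v = 0"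
      using projection[of "derived_ideal br" x] by (auto simp: derived_ideal_def)
    \<comment> \<open>The residual of the projection onto the derived ideal lies in
      \<open>skew_part br\<close>, so it is orthogonal to \<open>x\<close> as well as to
      \<open>p\<close>, hence to itself.\<close>
    have "x - p \<in> skew_part br" using derived_perp_skew_part p(2) by blast
    then have "(x - p) \<bullet> x = 0" using x by (auto simp: orthogonal_comp_def orthogonal_def)
    with p have "(x - p) \<bullet> (x - p) = 0" by (simp add: inner_diff_right)
    then show "x \<in> derived_ideal br" using p(1) by simp
  qed
  have "br a b \<in> orthogonal_comp (skew_part br)" for a b
  proof -
    \<comment> \<open>Skewness of \<open>L_a\<close> moves the product onto \<open>s\<close>, where
      \<open>R_s = 0\<close> applies; brackets are differences of such products.\<close>
    have "s \<bullet> lc a b = 0" if "s \<in> skew_part br" for s a b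
      using lc_skew[of a s b] skew_part_lc[OF that] by simp
    then show ?thesis
      by (simp add: orthogonal_comp_def orthogonal_def inner_diff_right flip: lc_torsion)
  qed
  then show "derived_ideal br \<subseteq> orthogonal_comp (skew_part br)"
    unfolding derived_ideal_def by (intro span_minimal subspace_orthogonal_comp) auto
qed

abbreviation lc_kernel :: "'a set" where
  "lc_kernel \<equiv> {a. \<forall>c. lc a c = 0}"

abbreviation lc_coker :: "'a set" where
  "lc_coker \<equiv> {a. \<forall>c\<in>lc_kernel. a \<bullet> c = 0}"

text \<open>Since each \<open>L_a\<close> is skew, this is \<open>- tr (L_a L_b)\<close>, minus the
  trace form of the representation \<open>a \<mapsto> L_a\<close>; the sign makes it positive
  semidefinite.\<close>

definition \<kappa> :: "'a \<Rightarrow> 'a \<Rightarrow> real" where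
  "\<kappa> a b = (\<Sum>e\<in>Bs. lc a e \<bullet> lc b e)"

lemma bilinear_\<kappa>: "bilinear \<kappa>"
  unfolding bilinear_def \<kappa>_def
  by (auto intro!: linearI simp: lc_simps inner_add_left inner_add_right sum.distrib sum_distrib_left)

lemma \<kappa>_sym: "\<kappa> a b = \<kappa> b a"
  by (simp add: \<kappa>_def inner_commute)

text \<open>Flatness turns \<open>L\<close> of a bracket into a commutator; invariance is then
  cyclicity of the trace of three left multiplications, with skewness translating between traces and
  inner products.\<close>

lemma \<kappa>_invariant: "\<kappa> (br c a) b = - \<kappa> a (br c b)"
proof -
  have "lc c e \<bullet> lc a (lc b e) = lc b (lc a (lc c e)) \<bullet> e" for e
    using lc_skew[of a "lc c e" "lc b e"] lc_skew[of b "lc a (lc c e)" e] by simp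
  then have "(\<Sum>e\<in>Bs. lc c e \<bullet> lc a (lc b e)) = (\<Sum>e\<in>Bs. lc b (lc a (lc c e)) \<bullet> e)"
    by simp
  also have "\<dots> = (\<Sum>e\<in>Bs. lc c (lc b (lc a e)) \<bullet> e)"
    using trace_commute[OF linear_compose[OF lc_linear(1) lc_linear(1)] lc_linear(1), of b a c]
    by simp
  also have "\<dots> = (\<Sum>e\<in>Bs. lc a e \<bullet> lc b (lc c e))"
    using lc_skew[of c "lc b (lc a _)"] lc_skew[of b "lc a _" "lc c _"] by simp
  finally have *: "(\<Sum>e\<in>Bs. lc c e \<bullet> lc a (lc b e)) = (\<Sum>e\<in>Bs. lc a e \<bullet> lc b (lc c e))" .
  have "\<kappa> (br c a) b = (\<Sum>e\<in>Bs. lc c e \<bullet> lc a (lc b e)) - (\<Sum>e\<in>Bs. lc a e \<bullet> lc c (lc b e))"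
    using lc_skew[of c "lc a _" "lc b _"] lc_skew[of a "lc c _" "lc b _"]
    by (simp add: \<kappa>_def lc_lc inner_diff_left sum_subtractf sum_negf)
  then show ?thesis
    by (simp add: * \<kappa>_def lc_lc inner_diff_right sum_subtractf)
qed

text \<open>For \<open>u\<close> in the kernel, \<open>lc a u\<close> is the bracket of
  \<open>a\<close> and \<open>u\<close>, and the kernel of a representation is an ideal. By skewness
  of \<open>L_a\<close> the orthogonal complement is then invariant too.\<close>

lemma lc_kernel_lc: "u \<in> lc_kernel \<Longrightarrow> lc a u \<in> lc_kernel"
proof -
  assume u: "u \<in> lc_kernel"
  then have "br a u = lc a u" using lc_torsion[of a u] by simp
  with u show ?thesis using lc_lc[of a u] by (simp add: lc_simps)
qed

lemma lc_coker_lc: "b \<in> lc_coker \<Longrightarrow> lc a b \<in> lc_coker"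
  using lc_kernel_lc[of _ a] by (auto simp: lc_skew)

lemma lc_coker_br: "a \<in> lc_coker \<Longrightarrow> b \<in> lc_coker \<Longrightarrow> br a b \<in> lc_coker"
  using lc_coker_lc[of a b] lc_coker_lc[of b a]
  by (simp add: inner_diff_left flip: lc_torsion)

lemma subspace_lc_kernel: "subspace lc_kernel"
  by (simp add: subspace_def lc_simps)

lemma subspace_lc_coker: "subspace lc_coker"
  by (simp add: subspace_def inner_add_left)

text \<open>A null vector of \<open>\<kappa>\<close> has \<open>L_v = 0\<close>, so it lies in the
  kernel as well as in its complement.\<close>

lemma \<kappa>_pos:
  assumes "v \<in> lc_coker" "v \<noteq> 0"
  shows "\<kappa> v v > 0"
proof -
  have "\<kappa> v v \<noteq> 0"
  proof
    assume "\<kappa> v v = 0"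
    then have lv: "lc v e = 0" if "e \<in> Bs" for e
      using that sum_inner_eq_0[OF fin] unfolding \<kappa>_def by blast
    have "lc v c = 0" for c
      using linear_expand[OF lc_linear(1)[of v], of c] lv by simp
    then have "v \<bullet> v = 0" using assms(1) by blast
    with assms(2) show False by simp
  qed
  moreover have "\<kappa> v v \<ge> 0" by (simp add: \<kappa>_def sum_nonneg)
  ultimately show ?thesis by simp
qed

lemma eq_neg_self: "x = 0" if "x = - x" for x :: 'a
proof -
  have "2 *\<^sub>R x = x + x" by (rule scaleR_2)
  also have "\<dots> = 0" using that by (metis add.right_inverse)
  finally show ?thesis by simp
qed

text \<open>The orthogonal complement of the kernel of \<open>lc\<close> is a subalgebra on which the invariant form
  \<open>\<kappa>\<close> is positive definite. With \<open>w = \<Sum> f \<cdot> f\<close> over a \<open>\<kappa>\<close>-orthonormal basis, right multiplication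
  by \<open>w\<close> is the Casimir operator \<open>\<Sum> L\<^sub>f L\<^sub>f \<le> 0\<close>, but its trace vanishes.\<close>

lemma lc_coker_lc_zero:
  assumes "a \<in> lc_coker" "b \<in> lc_coker"
  shows "lc a b = 0"
proof -
  obtain B where B: "finite B" "B \<subseteq> lc_coker" "span B = lc_coker"
    using subspace_finite_span[OF fin spans subspace_lc_coker] by blast
  from gram_schmidt[OF bilinear_\<kappa> \<kappa>_sym subspace_lc_coker \<kappa>_pos B(1,2)]
  obtain F where F0: "finite F" "F \<subseteq> lc_coker"
    "\<forall>a\<in>F. \<forall>b\<in>F. \<kappa> a b = (if a = b then 1 else 0)" "span F = span B"
    by blast
  note F = F0(1,2) F0(3)[rule_format] F0(4)[unfolded B(3)]
  obtain G where G: "finite G" "G \<subseteq> lc_coker"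
    "\<And>a b. a \<in> G \<Longrightarrow> b \<in> G \<Longrightarrow> a \<bullet> b = (if a = b then 1 else 0)" "span G = lc_coker"
    using orthonormal_basis_exists[OF fin spans subspace_lc_coker] by blast
  have expF: "(\<Sum>f\<in>F. \<kappa> v f *\<^sub>R f) = v" if "v \<in> lc_coker" for v
    using span_expand[OF bilinear_\<kappa> F(1,3), of v] F(4) that by simp
  have expG: "(\<Sum>g\<in>G. (v \<bullet> g) *\<^sub>R g) = v" if "v \<in> lc_coker" for v
    using span_expand[OF bilinear_inner G(1,3), of v] G(4) that by simp
  define w where "w = (\<Sum>f\<in>F. lc f f)"
  have w: "w \<in> lc_coker"
    unfolding w_def using F(2) lc_coker_lc by (intro subspace_sum[OF subspace_lc_coker]) blast
  have casimir: "lc a w = (\<Sum>f\<in>F. lc f (lc f a))" if a: "a \<in> lc_coker" for a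
  proof -
    have ex: "br a f = (\<Sum>g\<in>F. \<kappa> (br a f) g *\<^sub>R g)" if "f \<in> F" for f
      by (rule expF[OF lc_coker_br[OF a subsetD[OF F(2) that]], symmetric])
    \<comment> \<open>\<open>s f g\<close> is symmetric, while by invariance
      \<open>\<kappa> (br a f) g\<close> is antisymmetric in \<open>f\<close> and \<open>g\<close>.
      The double sum of their products is therefore its own negative, and only the Casimir terms
      survive in \<open>lc a w\<close>.\<close>
    define s where "s f g = lc g f + lc f g" for f g
    have "lc (br a f) f + lc f (br a f) = (\<Sum>g\<in>F. \<kappa> (br a f) g *\<^sub>R s f g)" if "f \<in> F" for f
      by (subst (1 2) ex[OF that])
        (simp add: s_def linear_sum[OF lc_linear(1)] linear_sum[OF lc_linear(2)] lc_simps sum.distrib scaleR_add_right)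
    then have E: "(\<Sum>f\<in>F. lc (br a f) f + lc f (br a f)) = (\<Sum>f\<in>F. \<Sum>g\<in>F. \<kappa> (br a f) g *\<^sub>R s f g)"
      by simp
    also have "\<dots> = (\<Sum>g\<in>F. \<Sum>f\<in>F. \<kappa> (br a f) g *\<^sub>R s f g)" by (rule sum.swap)
    also have "\<dots> = (\<Sum>g\<in>F. \<Sum>f\<in>F. - (\<kappa> (br a g) f *\<^sub>R s g f))"
    proof (intro sum.cong refl)
      fix f g
      have "\<kappa> (br a f) g = - \<kappa> (br a g) f" using \<kappa>_invariant[of a f g] \<kappa>_sym by simp
      then show "\<kappa> (br a f) g *\<^sub>R s f g = - (\<kappa> (br a g) f *\<^sub>R s g f)"
        by (simp add: s_def add.commute)
    qed
    also have "\<dots> = - (\<Sum>f\<in>F. lc (br a f) f + lc f (br a f))"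
      unfolding E by (simp only: sum_negf)
    finally have zero: "(\<Sum>f\<in>F. lc (br a f) f + lc f (br a f)) = 0"
      by (rule eq_neg_self)
    have "lc a (lc f f) = lc (br a f) f + lc f (br a f) + lc f (lc f a)" for f
      using lc_lc[of a f f] lc_swap[of a f] by (simp add: lc_simps algebra_simps)
    then have "lc a w = (\<Sum>f\<in>F. lc (br a f) f + lc f (br a f)) + (\<Sum>f\<in>F. lc f (lc f a))"
      by (simp add: w_def linear_sum[OF lc_linear(1)] sum.distrib)
    with zero show ?thesis by simp
  qed
  \<comment> \<open>The trace of \<open>ad_w\<close> on the complement does not depend on the basis.
    Passing from the orthonormal basis \<open>G\<close> to the \<open>\<kappa>\<close>-orthonormal
    basis \<open>F\<close>, every diagonal entry vanishes by invariance of
    \<open>\<kappa>\<close>.\<close>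
  have "(\<Sum>g\<in>G. br w g \<bullet> g) = (\<Sum>g\<in>G. \<Sum>f\<in>F. \<kappa> g f * (br w f \<bullet> g))"
  proof (intro sum.cong refl)
    fix g assume "g \<in> G"
    then have "br w g = (\<Sum>f\<in>F. \<kappa> g f *\<^sub>R br w f)"
      using expF[of g] G(2) linear_sum[OF br_linear(1)[of w], of "\<lambda>f. \<kappa> g f *\<^sub>R f" F]
      by (simp add: br_simps subset_iff)
    then show "br w g \<bullet> g = (\<Sum>f\<in>F. \<kappa> g f * (br w f \<bullet> g))"
      by (simp add: inner_sum_left)
  qed
  also have "\<dots> = (\<Sum>f\<in>F. \<Sum>g\<in>G. \<kappa> g f * (br w f \<bullet> g))" by (rule sum.swap)
  also have "\<dots> = (\<Sum>f\<in>F. \<kappa> (br w f) f)"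
  proof (intro sum.cong refl)
    fix f assume "f \<in> F"
    from expG[OF lc_coker_br[OF w subsetD[OF F(2) this]], symmetric]
    have "\<kappa> (br w f) f = \<kappa> (\<Sum>g\<in>G. (br w f \<bullet> g) *\<^sub>R g) f" by simp
    also have "\<dots> = (\<Sum>g\<in>G. \<kappa> g f * (br w f \<bullet> g))"
      using bilinear_lsum[OF bilinear_\<kappa>, of "\<lambda>g. (br w f \<bullet> g) *\<^sub>R g" G f]
      by (simp add: bilinear_lmul[OF bilinear_\<kappa>] mult.commute)
    finally show "(\<Sum>g\<in>G. \<kappa> g f * (br w f \<bullet> g)) = \<kappa> (br w f) f" by simp
  qed
  also have "\<dots> = 0"
  proof (intro sum.neutral ballI)
    fix f
    show "\<kappa> (br w f) f = 0" using \<kappa>_invariant[of w f f] \<kappa>_sym[of f "br w f"] by simp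
  qed
  finally have tr_ad: "(\<Sum>g\<in>G. br w g \<bullet> g) = 0" .
  have "lc g w \<bullet> g = - (br w g \<bullet> g)" for g
    using lc_skew[of w g g] lc_swap[of g w] br_swap[of g w]
    by (simp add: inner_add_left inner_diff_left inner_diff_right inner_commute)
  then have "(\<Sum>g\<in>G. lc g w \<bullet> g) = 0" using tr_ad by (simp add: sum_negf)
  moreover have "lc g w \<bullet> g = - (\<Sum>f\<in>F. lc f g \<bullet> lc f g)" if "g \<in> G" for g
    using casimir[of g] that G(2)
    by (simp add: subset_iff inner_sum_left lc_skew sum_negf)
  ultimately have "(\<Sum>g\<in>G. \<Sum>f\<in>F. lc f g \<bullet> lc f g) = 0" by (simp add: sum_negf)
  then have zero: "(\<Sum>f\<in>F. lc f g \<bullet> lc f g) = 0" if "g \<in> G" for g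
    using that sum_nonneg_eq_0_iff[OF G(1), of "\<lambda>g. \<Sum>f\<in>F. lc f g \<bullet> lc f g"] by (simp add: sum_nonneg)
  have fg: "lc f g = 0" if "f \<in> F" "g \<in> G" for f g
    by (rule sum_inner_eq_0[OF F(1) zero[OF that(2)] that(1)])
  have "lc f b = 0" if "f \<in> F" for f
  proof -
    have "lc f b = lc f (\<Sum>g\<in>G. (b \<bullet> g) *\<^sub>R g)" using expG[OF assms(2)] by simp
    then show ?thesis using fg[OF that] by (simp add: linear_sum[OF lc_linear(1)] lc_simps)
  qed
  moreover have "lc a b = lc (\<Sum>f\<in>F. \<kappa> a f *\<^sub>R f) b" using expF[OF assms(1)] by simp
  ultimately show ?thesis by (simp add: linear_sum[OF lc_linear(2)] lc_simps)
qed

text \<open>Left multiplications depend only on the components in the complement, where all products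
  vanish. Hence \<open>[L_x, L_y]\<close>, which is \<open>L\<close> of the bracket, is
  zero.\<close>

lemma br_lc_kernel: "br x y \<in> lc_kernel"
proof -
  have dec: "\<exists>x'\<in>lc_coker. \<forall>c. lc x c = lc x' c" for x
  proof -
    obtain p where p: "p \<in> lc_kernel" "\<And>v. v \<in> lc_kernel \<Longrightarrow> (x - p) \<bullet> v = 0"
      using projection[OF subspace_lc_kernel, of x] by blast
    then show ?thesis by (intro bexI[of _ "x - p"]) (auto simp: lc_simps)
  qed
  obtain x' y' where xy: "x' \<in> lc_coker" "y' \<in> lc_coker" "\<And>c. lc x c = lc x' c" "\<And>c. lc y c = lc y' c"
    using dec[of x] dec[of y] by blast
  have "br x' y' = 0"
    using lc_coker_lc_zero[OF xy(1,2)] lc_coker_lc_zero[OF xy(2,1)] by (simp flip: lc_torsion)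
  then have "lc x' (lc y' c) - lc y' (lc x' c) = 0" for c
    using lc_lc[of x' y' c] by (simp add: lc_simps)
  then show ?thesis by (simp add: lc_lc xy(3,4))
qed

lemma flat_unimodular_imp_milnor: "milnor_lie_algebra br"
proof -
  have "derived_ideal br \<subseteq> lc_kernel"
    unfolding derived_ideal_def using br_lc_kernel by (intro span_minimal subspace_lc_kernel) auto
  then have "lc u v = 0" if "u \<in> derived_ideal br" for u v using that by blast
  then have "abelian_on br (derived_ideal br)"
    unfolding abelian_on_def using lc_torsion by (metis diff_self)
  moreover have "abelian_on br (skew_part br)"
    unfolding abelian_on_def using lc_torsion skew_part_lc by (metis diff_self)
  ultimately show ?thesis
    using lie fin spans skew_part_perp unfolding milnor_lie_algebra_def by blast
qed

end

section \<open>Milnor Lie algebras are flat and unimodular\<close>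

context
  assumes milnor: "milnor_lie_algebra br"
begin

lemma skew_derived:
  assumes "s \<in> skew_part br" "t \<in> derived_ideal br"
  shows "s \<bullet> t = 0" "t \<bullet> s = 0"
proof -
  have "t \<in> orthogonal_comp (skew_part br)"
    using assms(2) milnor by (simp add: milnor_lie_algebra_def)
  with assms(1) show "s \<bullet> t = 0" "t \<bullet> s = 0"
    by (auto simp: orthogonal_comp_def orthogonal_def inner_commute)
qed

lemma skew_derived_decomposition:
  obtains s t where "s \<in> skew_part br" "t \<in> derived_ideal br" "x = s + t"
proof -
  obtain p where p: "p \<in> skew_part br" "\<And>v. v \<in> skew_part br \<Longrightarrow> (x - p) \<bullet> v = 0"
    using projection[OF subspace_skew_part, of x] by blast
  then have "x - p \<in> derived_ideal br"
    using milnor by (auto simp: milnor_lie_algebra_def orthogonal_comp_def orthogonal_def inner_commute)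
  then show thesis using that[of p "x - p"] p(1) by simp
qed

lemma br_abelian:
  "s \<in> skew_part br \<Longrightarrow> s' \<in> skew_part br \<Longrightarrow> br s s' = 0"
  "t \<in> derived_ideal br \<Longrightarrow> t' \<in> derived_ideal br \<Longrightarrow> br t t' = 0"
  using milnor by (simp_all add: milnor_lie_algebra_def abelian_on_def)

text \<open>In Koszul's formula the term paired with \<open>s\<close> vanishes because brackets are
  orthogonal to \<open>s\<close>; skewness of \<open>ad_s\<close> makes the other two equal.\<close>

lemma lc_skew_part:
  assumes s: "s \<in> skew_part br"
  shows "lc s b = br s b"
proof (rule inner_eqI)
  fix c
  have "br c s \<bullet> b = br s b \<bullet> c"
    using skew_partD[OF s, of c b] by (simp add: br_swap[of c s] inner_commute[of c])
  then show "lc s b \<bullet> c = br s b \<bullet> c"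
    using skew_derived(2)[OF s br_derived[of c b]] by (simp add: lc_inner)
qed

text \<open>Split \<open>b\<close> and \<open>c\<close> along the orthogonal decomposition. Only
  brackets of the skew part with the derived ideal survive in Koszul's formula, and they cancel by
  skewness of \<open>ad\<close> at the skew components.\<close>

lemma lc_derived:
  assumes t: "t \<in> derived_ideal br"
  shows "lc t b = 0"
proof (rule inner_eqI)
  fix c
  obtain bs bi where b: "bs \<in> skew_part br" "bi \<in> derived_ideal br" "b = bs + bi"
    using skew_derived_decomposition[of b] by blast
  obtain cs ci where c: "cs \<in> skew_part br" "ci \<in> derived_ideal br" "c = cs + ci"
    using skew_derived_decomposition[of c] by blast
  have "br t b \<bullet> c = br t bs \<bullet> ci"
    using b c t by (simp add: br_simps br_abelian inner_add_right skew_derived br_derived)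
  moreover have "br c t \<bullet> b = br cs t \<bullet> bi"
    using b c t by (simp add: br_simps br_abelian inner_add_right skew_derived br_derived)
  moreover have "br c b \<bullet> t = br cs bi \<bullet> t + br ci bs \<bullet> t"
    using b c t by (simp add: br_simps br_abelian inner_add_left)
  moreover have "br cs bi \<bullet> t = - (br cs t \<bullet> bi)" "br bs ci \<bullet> t = - (br bs t \<bullet> ci)"
    using skew_partD[OF c(1), of bi t] skew_partD[OF b(1), of ci t] by (simp_all add: inner_commute)
  ultimately show "lc t b \<bullet> c = 0 \<bullet> c"
    using br_swap[of ci bs] br_swap[of t bs] by (simp add: lc_inner)
qed

lemma milnor_imp_flat: flat
  unfolding flat_def
proof (intro allI)
  fix a b c
  obtain as ai where a: "as \<in> skew_part br" "ai \<in> derived_ideal br" "a = as + ai"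
    using skew_derived_decomposition[of a] by blast
  obtain bs bi where b: "bs \<in> skew_part br" "bi \<in> derived_ideal br" "b = bs + bi"
    using skew_derived_decomposition[of b] by blast
  have "lc a x = br as x" "lc b x = br bs x" for x
    using a b by (simp_all add: lc_simps lc_skew_part lc_derived)
  moreover have "br as (br bs c) - br bs (br as c) = 0"
    using jacobi[of as bs c] br_abelian(1)[OF a(1) b(1)] by (simp add: br_simps)
  ultimately show "lc (br a b) c = lc a (lc b c) - lc b (lc a c)"
    by (simp add: lc_derived br_derived)
qed

text \<open>\<open>ad\<close> is skew on one summand of the decomposition; on the derived ideal it
  is a linear combination of commutators. Both kinds are traceless.\<close>

lemma milnor_imp_unimodular: unimodular
  unfolding unimodular_def
proof
  fix u
  obtain s t where st: "s \<in> skew_part br" "t \<in> derived_ideal br" "u = s + t"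
    using skew_derived_decomposition[of u] by blast
  have "br s e \<bullet> e = 0" for e
  proof -
    show ?thesis using skew_partD[OF st(1), of e e] by (simp add: inner_commute)
  qed
  moreover have "(\<Sum>e\<in>Bs. br t e \<bullet> e) = 0"
  proof -
    have "(\<Sum>e\<in>Bs. br (br x y) e \<bullet> e) = 0" for x y
      using trace_commute[OF br_linear(1) br_linear(1), of x y]
      by (simp add: jacobi inner_diff_left sum_subtractf)
    moreover have "subspace {t. (\<Sum>e\<in>Bs. br t e \<bullet> e) = 0}"
      by (simp add: subspace_def br_simps inner_add_left sum.distrib flip: sum_distrib_left)
    ultimately have "derived_ideal br \<subseteq> {t. (\<Sum>e\<in>Bs. br t e \<bullet> e) = 0}"
      unfolding derived_ideal_def by (intro span_minimal) auto
    with st(2) show ?thesis by blast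
  qed
  ultimately show "(\<Sum>e\<in>Bs. br u e \<bullet> e) = 0"
    by (simp add: st(3) br_simps inner_add_left sum.distrib)
qed

end

lemma milnor_iff: "milnor_lie_algebra br \<longleftrightarrow> flat \<and> unimodular"
  using flat_unimodular_imp_milnor milnor_imp_flat milnor_imp_unimodular by blast

end

section \<open>Operators on forms on the dual of a Lie algebra\<close>

type_synonym 'a dual = "'a \<Rightarrow>\<^sub>L real"

context orthonormal_basis
begin

definition dual_vec :: "'a \<Rightarrow> 'a dual" where
  "dual_vec e = blinfun_inner_left e"

lemma dual_vec_apply [simp]: "blinfun_apply (dual_vec e) u = u \<bullet> e"
  by (simp add: dual_vec_def)

text \<open>For linear \<open>L\<close> this is \<open>v \<circ> L\<close>; as a sum it needs no proof of boundedness.\<close>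

definition dual_map :: "('a \<Rightarrow> 'a) \<Rightarrow> 'a dual \<Rightarrow> 'a dual" where
  "dual_map L v = (\<Sum>e\<in>Bs. blinfun_apply v (L e) *\<^sub>R dual_vec e)"

lemma blinfun_apply_sum: "blinfun_apply (sum f A) u = (\<Sum>a\<in>A. blinfun_apply (f a) u)"
  by (simp add: blinfun.sum_left)

lemma dual_map_apply:
  assumes "linear L"
  shows "blinfun_apply (dual_map L v) u = blinfun_apply v (L u)"
proof -
  have "blinfun_apply v (L u) = blinfun_apply v (\<Sum>e\<in>Bs. (u \<bullet> e) *\<^sub>R L e)"
    by (simp add: linear_expand[OF assms])
  then show ?thesis
    by (simp add: dual_map_def blinfun_apply_sum blinfun.sum_right blinfun.scaleR_left
        blinfun.scaleR_right mult.commute)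
qed

lemma dual_expand: "(\<Sum>e\<in>Bs. blinfun_apply v e *\<^sub>R dual_vec e) = v"
proof (rule blinfun_eqI)
  fix u
  show "blinfun_apply (\<Sum>e\<in>Bs. blinfun_apply v e *\<^sub>R dual_vec e) u = blinfun_apply v u"
    using dual_map_apply[OF linear_id, of v u] by (simp add: dual_map_def)
qed

lemma apply_expand: "(\<Sum>e\<in>Bs. blinfun_apply v e * (u \<bullet> e)) = blinfun_apply v u"
proof -
  have "blinfun_apply v u = blinfun_apply (\<Sum>e\<in>Bs. blinfun_apply v e *\<^sub>R dual_vec e) u"
    by (simp only: dual_expand)
  then show ?thesis by (simp add: blinfun_apply_sum blinfun.scaleR_left)
qed

lemma linear_dual_map: "linear (dual_map L)"
  by (rule linearI) (simp_all add: dual_map_def blinfun.add_left blinfun.scaleR_left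
      scaleR_add_left sum.distrib scaleR_sum_right)

lemma smooth_apply: "smooth (\<lambda>x :: 'a dual. blinfun_apply x u)"
  by (intro smooth_bounded_linear blinfun.bounded_linear_left)

lemma dd_apply: "dd (\<lambda>x :: 'a dual. blinfun_apply x u) v x = blinfun_apply v u"
  by (intro dd_bounded_linear blinfun.bounded_linear_left)

definition const_form :: "'a \<Rightarrow> 'a dual dform" where
  "const_form u = one_form (\<lambda>v. blinfun_apply v u)"

lemma const_form_forms: "const_form u \<in> forms 1"
  unfolding const_form_def
  by (rule one_form_forms) (simp add: linear_iff blinfun.add_left blinfun.scaleR_left)

lemma const_form_apply [simp]: "const_form u x [v] = blinfun_apply v u"
  by (simp add: const_form_def one_form_def)

lemma const_form_diff: "const_form (u - w) = const_form u - const_form w"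
  by (auto simp: fun_eq_iff const_form_def one_form_def blinfun.diff_right split: list.splits)

lemma ext_deriv_linear_fun: "ext_deriv (fun_form (\<lambda>x. blinfun_apply x u)) = const_form u"
proof (rule forms_1_eqI)
  show "ext_deriv (fun_form (\<lambda>x. blinfun_apply x u)) \<in> forms 1"
    by (rule ext_deriv_fun_form_forms[OF smooth_apply])
qed (rule const_form_forms, simp add: ext_deriv_fun_form dd_apply)

lemma dir_deriv_expand:
  assumes "smooth_form \<tau>"
  shows "dir_deriv v \<tau> = (\<Sum>e\<in>Bs. fscale (\<lambda>_. blinfun_apply v e) (dir_deriv (dual_vec e) \<tau>))"
proof -
  have l: "linear (\<lambda>v. dir_deriv v \<tau> x vs)" for x vs
    using dd_linear[OF smooth_formD[OF assms]] unfolding dir_deriv_def .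
  have "dir_deriv (\<Sum>e\<in>Bs. blinfun_apply v e *\<^sub>R dual_vec e) \<tau> x vs =
      (\<Sum>e\<in>Bs. blinfun_apply v e * dir_deriv (dual_vec e) \<tau> x vs)" for x vs
    by (simp add: linear_sum[OF l] linear_scale[OF l])
  then show ?thesis
    by (simp add: dual_expand fun_eq_iff sum_apply fscale_def)
qed

text \<open>Acting after differentiation, \<open>T\<close> also hits the slot that holds the
  direction of differentiation; the right hand side is this extra contribution.\<close>

lemma lin_act_ext_deriv:
  assumes "linear T" "smooth_form \<omega>" "multilin \<omega>"
  shows "lin_act T (ext_deriv \<omega>) - ext_deriv (lin_act T \<omega>) =
    (\<Sum>e\<in>Bs. one_form (\<lambda>v. blinfun_apply (T v) e) \<curlywedge> dir_deriv (dual_vec e) \<omega>)"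
proof -
  have "lin_act T (ext_deriv \<omega>) x vs - ext_deriv (lin_act T \<omega>) x vs =
    (\<Sum>e\<in>Bs. (one_form (\<lambda>v. blinfun_apply (T v) e) \<curlywedge> dir_deriv (dual_vec e) \<omega>) x vs)" for x vs
    using assms(2,3)
  proof (induction vs arbitrary: \<omega>)
    case Nil then show ?case by (simp add: one_form_def)
  next
    case (Cons v vs)
    note sm = Cons.prems(1) smooth_form_contr smooth_form_lin_act smooth_form_dir_deriv
    have g: "grade_inv (one_form f) = - one_form f" for f :: "'a dual \<Rightarrow> real"
      by (auto simp: fun_eq_iff grade_inv_def one_form_def split: list.splits)
    have "lin_act T (ext_deriv \<omega>) x (v # vs) = dir_deriv (T v) \<omega> x vs - ext_deriv (contr (T v) \<omega>) x vs +
        lin_act T (dir_deriv v \<omega>) x vs - lin_act T (ext_deriv (contr v \<omega>)) x vs"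
      by (simp add: lin_act_Cons contr_ext_deriv lin_act_diff)
    moreover have "ext_deriv (lin_act T \<omega>) x (v # vs) = lin_act T (dir_deriv v \<omega>) x vs -
        ext_deriv (contr (T v) \<omega>) x vs - ext_deriv (lin_act T (contr v \<omega>)) x vs"
      by (simp add: ext_deriv_Cons contr_lin_act ext_deriv_add dir_deriv_lin_act sm)
    moreover have "(one_form f \<curlywedge> dir_deriv u \<omega>) x (v # vs) =
        f v * dir_deriv u \<omega> x vs - (one_form f \<curlywedge> dir_deriv u (contr v \<omega>)) x vs" for f u
      by (simp add: wedge_Cons contr_one_form fun_form_wedge fscale_def contr_dir_deriv g)
    moreover have "dir_deriv (T v) \<omega> x vs = (\<Sum>e\<in>Bs. blinfun_apply (T v) e * dir_deriv (dual_vec e) \<omega> x vs)"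
      by (subst dir_deriv_expand[OF Cons.prems(1)]) (simp add: sum_apply fscale_def)
    ultimately show ?case
      using Cons.IH[OF smooth_form_contr[OF Cons.prems(1)] multilin_contr[OF Cons.prems(2)], of v]
      by (simp add: sum_subtractf)
  qed
  then show ?thesis by (simp add: fun_eq_iff sum_apply)
qed

lemma lin_act_vec_sum:
  assumes "multilin \<omega>"
  shows "lin_act (\<lambda>v. \<Sum>a\<in>A. c a *\<^sub>R T a v) \<omega> = (\<Sum>a\<in>A. fscale (\<lambda>_. c a) (lin_act (T a) \<omega>))"
proof -
  have l: "linear (\<lambda>u. \<omega> x (vs[i := u]))" if "i < length vs" for x vs i
    using multilinD[OF assms] that by (simp add: upd_conv_take_nth_drop)
  have "lin_act (\<lambda>v. \<Sum>a\<in>A. c a *\<^sub>R T a v) \<omega> x vs = (\<Sum>a\<in>A. c a * lin_act (T a) \<omega> x vs)" for x vs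
  proof -
    have "lin_act (\<lambda>v. \<Sum>a\<in>A. c a *\<^sub>R T a v) \<omega> x vs =
        (\<Sum>i<length vs. \<Sum>a\<in>A. c a * \<omega> x (vs[i := T a (vs ! i)]))"
      unfolding lin_act_def by (intro sum.cong refl) (simp add: linear_sum[OF l] linear_scale[OF l])
    also have "\<dots> = (\<Sum>a\<in>A. c a * lin_act (T a) \<omega> x vs)"
      unfolding lin_act_def sum_distrib_left by (rule sum.swap)
    finally show ?thesis .
  qed
  then show ?thesis by (simp add: fun_eq_iff sum_apply fscale_def)
qed

lemma lin_act_vec_diff:
  assumes "multilin \<omega>"
  shows "lin_act (\<lambda>v. S v - T v) \<omega> = lin_act S \<omega> - lin_act T \<omega>"
proof -
  have l: "linear (\<lambda>u. \<omega> x (vs[i := u]))" if "i < length vs" for x vs i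
    using multilinD[OF assms] that by (simp add: upd_conv_take_nth_drop)
  show ?thesis
    by (simp add: fun_eq_iff lin_act_def linear_diff[OF l] sum_subtractf)
qed

lemma ext_deriv_fscale:
  assumes "smooth f" "smooth_form \<sigma>"
  shows "ext_deriv (fscale f \<sigma>) = ext_deriv (fun_form f) \<curlywedge> \<sigma> + fscale f (ext_deriv \<sigma>)"
proof -
  have "smooth_form (fun_form f)" "grade_inv (fun_form f) = fun_form f"
    using fun_form_forms[OF assms(1)]
    by (auto simp: forms_iff all_forms_iff grade_inv_def fun_form_def fun_eq_iff)
  then show ?thesis
    using ext_deriv_wedge[OF _ assms(2), of "fun_form f"] by (simp add: fun_form_wedge)
qed

end

lemma fscale_algebra:
  "fscale f (\<sigma> + \<tau>) = fscale f \<sigma> + fscale f \<tau>"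
  "fscale f (\<sigma> - \<tau>) = fscale f \<sigma> - fscale f \<tau>"
  "fscale f (- \<sigma>) = - fscale f \<sigma>"
  "fscale f 0 = 0"
  "fscale f (fscale g \<sigma>) = fscale (\<lambda>x. f x * g x) \<sigma>"
  by (simp_all add: fun_eq_iff fscale_def algebra_simps)

lemma fscale_sum: "fscale f (sum \<sigma> A) = (\<Sum>a\<in>A. fscale f (\<sigma> a))"
  by (simp add: fun_eq_iff fscale_def sum_apply sum_distrib_left)

context metric_lie_algebra
begin

abbreviation "pd e \<equiv> dir_deriv (dual_vec e)"

text \<open>\<open>pd e\<close> is the partial derivative along \<open>e\<close>, \<open>ham a\<close> the derivative along the Hamiltonian
  vector field of the linear function \<open>a\<close>, and \<open>conn a\<close> the covariant derivative \<open>\<D>\<close> along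
  the constant 1-form \<open>a\<close>.\<close>

definition ham :: "'a \<Rightarrow> 'a dual dform \<Rightarrow> 'a dual dform" where
  "ham a \<tau> = (\<Sum>e\<in>Bs. fscale (\<lambda>x. blinfun_apply x (br a e)) (pd e \<tau>))"

definition lc_act :: "'a \<Rightarrow> 'a dual dform \<Rightarrow> 'a dual dform" where
  "lc_act a = lin_act (dual_map (lc a))"

definition conn :: "'a \<Rightarrow> 'a dual dform \<Rightarrow> 'a dual dform" where
  "conn a \<tau> = ham a \<tau> + lc_act a \<tau>"

lemma all_forms_ham: "\<tau> \<in> all_forms \<Longrightarrow> ham a \<tau> \<in> all_forms"
  unfolding ham_def by (intro all_forms_sum all_forms_linear smooth_apply all_forms_dir_deriv)

lemma all_forms_lc_act: "\<tau> \<in> all_forms \<Longrightarrow> lc_act a \<tau> \<in> all_forms"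
  unfolding lc_act_def by (intro all_forms_lin_act linear_dual_map)

lemma all_forms_conn: "\<tau> \<in> all_forms \<Longrightarrow> conn a \<tau> \<in> all_forms"
  unfolding conn_def by (intro all_forms_linear all_forms_ham all_forms_lc_act)

lemma smooth_form_all_forms: "\<tau> \<in> all_forms \<Longrightarrow> smooth_form \<tau>"
  by (simp add: all_forms_iff)

lemma smooth_form_ham: "smooth_form \<tau> \<Longrightarrow> smooth_form (ham a \<tau>)"
  unfolding ham_def by (intro smooth_form_sum smooth_form_fscale smooth_apply smooth_form_dir_deriv)

lemma smooth_form_lc_act: "smooth_form \<tau> \<Longrightarrow> smooth_form (lc_act a \<tau>)"
  unfolding lc_act_def by (rule smooth_form_lin_act)

lemma smooth_form_conn: "smooth_form \<tau> \<Longrightarrow> smooth_form (conn a \<tau>)"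
  unfolding conn_def by (intro smooth_form_add smooth_form_ham smooth_form_lc_act)

lemma degree_form_ham: "degree_form k \<tau> \<Longrightarrow> degree_form k (ham a \<tau>)"
  unfolding ham_def by (intro degree_form_sum degree_form_linear degree_form_dir_deriv)

lemma degree_form_lc_act: "degree_form k \<tau> \<Longrightarrow> degree_form k (lc_act a \<tau>)"
  unfolding lc_act_def by (rule degree_form_lin_act)

lemma degree_form_conn: "degree_form k \<tau> \<Longrightarrow> degree_form k (conn a \<tau>)"
  unfolding conn_def by (intro degree_form_linear degree_form_ham degree_form_lc_act)

text \<open>At a fixed point \<open>ham a\<close> is an ordinary directional derivative. The
  definition as a sum keeps the dependence on the point in scalar coefficients, which can themselves
  be differentiated.\<close>

lemma ham_apply:
  assumes "smooth_form \<tau>"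
  shows "ham a \<tau> x vs = dir_deriv (dual_map (br a) x) \<tau> x vs"
proof -
  have l: "linear (\<lambda>v. dir_deriv v \<tau> x vs)"
    using dd_linear[OF smooth_formD[OF assms]] unfolding dir_deriv_def .
  show ?thesis
    by (simp add: linear_sum[OF l] linear_scale[OF l] ham_def dual_map_def sum_apply fscale_def)
qed

lemma ham_add: "smooth_form \<sigma> \<Longrightarrow> smooth_form \<tau> \<Longrightarrow> ham a (\<sigma> + \<tau>) = ham a \<sigma> + ham a \<tau>"
  by (simp add: ham_def dir_deriv_add fscale_algebra sum.distrib)

lemma ham_fscale:
  assumes "smooth f" "smooth_form \<tau>"
  shows "ham a (fscale f \<tau>) = fscale (\<lambda>x. dd f (dual_map (br a) x) x) \<tau> + fscale f (ham a \<tau>)"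
  by (simp add: fun_eq_iff ham_apply assms smooth_form_fscale dir_deriv_fscale)
    (simp add: fscale_def ham_apply assms)

lemma ham_wedge:
  assumes "smooth_form \<sigma>" "smooth_form \<tau>"
  shows "ham a (\<sigma> \<curlywedge> \<tau>) = ham a \<sigma> \<curlywedge> \<tau> + \<sigma> \<curlywedge> ham a \<tau>"
  by (simp add: ham_def dir_deriv_wedge assms wedge_sum_left wedge_sum_right fscale_algebra sum.distrib)

lemma lc_act_wedge: "lc_act a (\<sigma> \<curlywedge> \<tau>) = lc_act a \<sigma> \<curlywedge> \<tau> + \<sigma> \<curlywedge> lc_act a \<tau>"
  by (simp add: lc_act_def lin_act_wedge)

lemma conn_wedge:
  "smooth_form \<sigma> \<Longrightarrow> smooth_form \<tau> \<Longrightarrow> conn a (\<sigma> \<curlywedge> \<tau>) = conn a \<sigma> \<curlywedge> \<tau> + \<sigma> \<curlywedge> conn a \<tau>"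
  by (simp add: conn_def ham_wedge lc_act_wedge wedge_add_left wedge_add_right add_ac)

lemma lc_act_add: "lc_act a (\<sigma> + \<tau>) = lc_act a \<sigma> + lc_act a \<tau>"
  by (simp add: lc_act_def lin_act_add)

lemma lc_act_sum: "lc_act a (sum \<sigma> A) = (\<Sum>i\<in>A. lc_act a (\<sigma> i))"
  by (simp add: lc_act_def lin_act_sum)

lemma lc_act_fscale [simp]: "lc_act a (fscale f \<tau>) = fscale f (lc_act a \<tau>)"
  by (simp add: lc_act_def)

lemma conn_add: "smooth_form \<sigma> \<Longrightarrow> smooth_form \<tau> \<Longrightarrow> conn a (\<sigma> + \<tau>) = conn a \<sigma> + conn a \<tau>"
  by (simp add: conn_def ham_add lc_act_add add_ac)

lemma conn_fscale:
  assumes "smooth f" "smooth_form \<tau>"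
  shows "conn a (fscale f \<tau>) = fscale (\<lambda>x. dd f (dual_map (br a) x) x) \<tau> + fscale f (conn a \<tau>)"
  by (simp add: conn_def ham_fscale assms fscale_algebra add_ac)

lemma conn_zero [simp]: "conn a 0 = 0"
  by (simp add: conn_def ham_def lc_act_def fscale_algebra)

lemma conn_sum:
  "(\<And>i. i \<in> A \<Longrightarrow> smooth_form (\<sigma> i)) \<Longrightarrow> conn a (sum \<sigma> A) = (\<Sum>i\<in>A. conn a (\<sigma> i))"
  by (induction A rule: infinite_finite_induct)
    (simp_all add: conn_add smooth_form_sum del: plus_fun_apply zero_fun_apply)

lemma pd_lc_act: "smooth_form \<tau> \<Longrightarrow> dir_deriv u (lc_act a \<tau>) = lc_act a (dir_deriv u \<tau>)"
  by (simp add: lc_act_def dir_deriv_lin_act)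

lemma pd_ham:
  assumes "smooth_form \<tau>"
  shows "dir_deriv u (ham a \<tau>) =
    (\<Sum>e\<in>Bs. fscale (\<lambda>_. blinfun_apply u (br a e)) (pd e \<tau>)) + ham a (dir_deriv u \<tau>)"
  using assms
  by (simp add: ham_def dir_deriv_sum dir_deriv_fscale smooth_form_fscale smooth_apply
      smooth_form_dir_deriv dd_apply sum.distrib dir_deriv_commute[of \<tau> u])

lemma pd_conn:
  assumes "smooth_form \<tau>"
  shows "dir_deriv u (conn a \<tau>) =
    (\<Sum>e\<in>Bs. fscale (\<lambda>_. blinfun_apply u (br a e)) (pd e \<tau>)) + conn a (dir_deriv u \<tau>)"
  using assms
  by (simp add: conn_def dir_deriv_add smooth_form_ham smooth_form_lc_act pd_ham pd_lc_act add_ac)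

text \<open>The first order terms combine by the Jacobi identity; the second order terms agree by
  symmetry of second derivatives.\<close>

lemma ham_ham:
  assumes "smooth_form \<tau>"
  shows "ham a (ham b \<tau>) - ham b (ham a \<tau>) = ham (br a b) \<tau>"
proof -
  have *: "ham a (ham b \<tau>) x vs = (\<Sum>e\<in>Bs. blinfun_apply x (br a (br b e)) * pd e \<tau> x vs) +
      (\<Sum>f\<in>Bs. \<Sum>e\<in>Bs. blinfun_apply x (br a f) * blinfun_apply x (br b e) * pd e (pd f \<tau>) x vs)"
    for a b x vs
  proof -
    have "ham a (ham b \<tau>) x vs = dir_deriv (dual_map (br a) x) (ham b \<tau>) x vs"
      using assms by (simp add: ham_apply smooth_form_ham)
    also have "\<dots> = (\<Sum>e\<in>Bs. blinfun_apply x (br a (br b e)) * pd e \<tau> x vs) +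
        ham b (dir_deriv (dual_map (br a) x) \<tau>) x vs"
      using assms by (simp add: pd_ham sum_apply fscale_def dual_map_apply[OF br_linear(1)])
    also have "ham b (dir_deriv (dual_map (br a) x) \<tau>) x vs =
       (\<Sum>e\<in>Bs. blinfun_apply x (br b e) * dir_deriv (dual_map (br a) x) (pd e \<tau>) x vs)"
      using assms by (simp add: ham_def sum_apply fscale_def dir_deriv_commute[of \<tau> _ "dual_map (br a) x"])
    also have "\<dots> = (\<Sum>e\<in>Bs. blinfun_apply x (br b e) * ham a (pd e \<tau>) x vs)"
      using assms by (simp add: ham_apply smooth_form_dir_deriv)
    also have "\<dots> = (\<Sum>e\<in>Bs. \<Sum>f\<in>Bs. blinfun_apply x (br a f) * blinfun_apply x (br b e) * pd e (pd f \<tau>) x vs)"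
      using assms by (simp add: ham_def sum_apply fscale_def sum_distrib_left dir_deriv_commute[of \<tau> "dual_vec _" "dual_vec _"] mult_ac)
    also have "\<dots> = (\<Sum>f\<in>Bs. \<Sum>e\<in>Bs. blinfun_apply x (br a f) * blinfun_apply x (br b e) * pd e (pd f \<tau>) x vs)"
      by (rule sum.swap)
    finally show ?thesis .
  qed
  have s: "(\<Sum>f\<in>Bs. \<Sum>e\<in>Bs. blinfun_apply x (br a f) * blinfun_apply x (br b e) * pd e (pd f \<tau>) x vs) =
      (\<Sum>f\<in>Bs. \<Sum>e\<in>Bs. blinfun_apply x (br b f) * blinfun_apply x (br a e) * pd e (pd f \<tau>) x vs)" for x vs
    by (subst sum.swap) (intro sum.cong refl, simp add: dir_deriv_commute[OF assms, of "dual_vec _" "dual_vec _"] mult.commute)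
  have "(ham a (ham b \<tau>) - ham b (ham a \<tau>)) x vs = ham (br a b) \<tau> x vs" for x vs
    using s[of x vs]
    by (simp add: * ham_def[of "br a b"] sum_apply fscale_def jacobi blinfun.diff_right left_diff_distrib sum_subtractf)
  then show ?thesis by (simp add: fun_eq_iff)
qed

text \<open>\<open>dual_map\<close> reverses compositions and \<open>lin_act\<close> reverses them
  again, so flatness of \<open>lc\<close> becomes the representation property without a
  sign.\<close>

lemma lc_act_lc_act:
  assumes flat "multilin \<tau>"
  shows "lc_act a (lc_act b \<tau>) - lc_act b (lc_act a \<tau>) = lc_act (br a b) \<tau>"
proof -
  have "dual_map (lc (br a b)) v = (dual_map (lc b) \<circ> dual_map (lc a)) v - (dual_map (lc a) \<circ> dual_map (lc b)) v" for v
    using assms(1)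
    by (intro blinfun_eqI) (simp add: dual_map_apply lc_linear blinfun.diff_left flat_def blinfun.diff_right)
  then have "dual_map (lc (br a b)) = (\<lambda>v. (dual_map (lc b) \<circ> dual_map (lc a)) v - (dual_map (lc a) \<circ> dual_map (lc b)) v)"
    by (rule ext)
  then have "lc_act (br a b) \<tau> = lin_act (dual_map (lc b) \<circ> dual_map (lc a)) \<tau> - lin_act (dual_map (lc a) \<circ> dual_map (lc b)) \<tau>"
    unfolding lc_act_def by (simp only: lin_act_vec_diff[OF assms(2), symmetric])
  then show ?thesis by (simp only: lc_act_def lin_act_commutator)
qed

lemma ham_lc_act: "smooth_form \<tau> \<Longrightarrow> ham a (lc_act b \<tau>) = lc_act b (ham a \<tau>)"
  by (simp add: ham_def pd_lc_act lc_act_sum)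

lemma conn_lc_act:
  assumes flat "\<tau> \<in> all_forms"
  shows "conn a (lc_act b \<tau>) = lc_act b (conn a \<tau>) + lc_act (br a b) \<tau>"
  using lc_act_lc_act[OF assms(1), of \<tau> a b] assms(2)
  by (simp add: all_forms_iff conn_def ham_lc_act lc_act_add algebra_simps)

text \<open>\<open>conn\<close> is the sum of two representations that commute with each other,
  since \<open>lc_act\<close> has constant coefficients.\<close>

lemma conn_conn:
  assumes flat "\<tau> \<in> all_forms"
  shows "conn a (conn b \<tau>) - conn b (conn a \<tau>) = conn (br a b) \<tau>"
proof -
  have sm: "smooth_form \<tau>" "multilin \<tau>" using assms(2) by (simp_all add: all_forms_iff)
  have "conn a (conn b \<tau>) = ham a (ham b \<tau>) + ham a (lc_act b \<tau>) + lc_act a (ham b \<tau>) + lc_act a (lc_act b \<tau>)"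
    for a b using sm by (simp add: conn_def ham_add lc_act_add smooth_form_ham smooth_form_lc_act add_ac)
  then show ?thesis
    using ham_ham[OF sm(1), of a b] lc_act_lc_act[OF assms(1) sm(2), of a b] sm
    by (simp add: ham_lc_act conn_def algebra_simps)
qed

lemma lc_act_expand:
  assumes "multilin \<tau>"
  shows "lc_act a \<tau> = (\<Sum>e\<in>Bs. fscale (\<lambda>_. a \<bullet> e) (lc_act e \<tau>))"
proof -
  have "dual_map (lc a) v = (\<Sum>e\<in>Bs. (a \<bullet> e) *\<^sub>R dual_map (lc e) v)" for v
  proof (rule blinfun_eqI)
    fix u
    have "blinfun_apply v (lc a u) = blinfun_apply v (\<Sum>e\<in>Bs. (a \<bullet> e) *\<^sub>R lc e u)"
      using linear_expand[OF lc_linear(2), of a u] by simp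
    then show "blinfun_apply (dual_map (lc a) v) u = blinfun_apply (\<Sum>e\<in>Bs. (a \<bullet> e) *\<^sub>R dual_map (lc e) v) u"
      by (simp add: dual_map_apply lc_linear blinfun_apply_sum blinfun.scaleR_left blinfun.sum_right blinfun.scaleR_right)
  qed
  then have "dual_map (lc a) = (\<lambda>v. \<Sum>e\<in>Bs. (a \<bullet> e) *\<^sub>R dual_map (lc e) v)" by (rule ext)
  then show ?thesis
    unfolding lc_act_def by (simp only: lin_act_vec_sum[OF assms])
qed

lemma ham_expand: "ham a \<tau> = (\<Sum>e\<in>Bs. fscale (\<lambda>_. a \<bullet> e) (ham e \<tau>))"
proof -
  have "ham a \<tau> x vs = (\<Sum>e\<in>Bs. (a \<bullet> e) * ham e \<tau> x vs)" for x vs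
  proof -
    have "blinfun_apply x (br a f) = (\<Sum>e\<in>Bs. (a \<bullet> e) * blinfun_apply x (br e f))" for f
    proof -
      have "blinfun_apply x (br a f) = blinfun_apply x (\<Sum>e\<in>Bs. (a \<bullet> e) *\<^sub>R br e f)"
        using linear_expand[OF br_linear(2), of a f] by simp
      then show ?thesis by (simp add: blinfun.sum_right blinfun.scaleR_right)
    qed
    then have "ham a \<tau> x vs = (\<Sum>f\<in>Bs. \<Sum>e\<in>Bs. (a \<bullet> e) * blinfun_apply x (br e f) * pd f \<tau> x vs)"
      by (simp add: ham_def sum_apply fscale_def sum_distrib_right)
    also have "\<dots> = (\<Sum>e\<in>Bs. \<Sum>f\<in>Bs. (a \<bullet> e) * blinfun_apply x (br e f) * pd f \<tau> x vs)"
      by (rule sum.swap)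
    finally show ?thesis by (simp add: ham_def sum_apply fscale_def sum_distrib_left mult.assoc)
  qed
  then show ?thesis by (simp add: fun_eq_iff sum_apply fscale_def)
qed

lemma conn_expand:
  assumes "multilin \<tau>"
  shows "conn a \<tau> = (\<Sum>e\<in>Bs. fscale (\<lambda>_. a \<bullet> e) (conn e \<tau>))"
proof -
  have "conn a \<tau> = (\<Sum>e\<in>Bs. fscale (\<lambda>_. a \<bullet> e) (ham e \<tau>)) + (\<Sum>e\<in>Bs. fscale (\<lambda>_. a \<bullet> e) (lc_act e \<tau>))"
    unfolding conn_def by (intro arg_cong2[where f="(+)"] ham_expand lc_act_expand assms)
  then show ?thesis by (simp add: conn_def fscale_algebra sum.distrib)
qed

lemma ext_deriv_ham:
  assumes "smooth_form \<tau>"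
  shows "ext_deriv (ham a \<tau>) = (\<Sum>e\<in>Bs. const_form (br a e) \<curlywedge> pd e \<tau>) + ham a (ext_deriv \<tau>)"
  using assms
  by (simp add: ham_def ext_deriv_sum smooth_form_fscale smooth_apply smooth_form_dir_deriv
      ext_deriv_fscale ext_deriv_linear_fun sum.distrib ext_deriv_dir_deriv)

lemma ext_deriv_lc_act:
  assumes "smooth_form \<tau>" "multilin \<tau>"
  shows "ext_deriv (lc_act a \<tau>) = lc_act a (ext_deriv \<tau>) - (\<Sum>e\<in>Bs. const_form (lc a e) \<curlywedge> pd e \<tau>)"
  using lin_act_ext_deriv[OF linear_dual_map assms, of "lc a"]
  by (simp add: lc_act_def dual_map_apply lc_linear flip: const_form_def) (simp add: algebra_simps)

text \<open>The defects of \<open>ham a\<close> and \<open>lc_act a\<close> involve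
  \<open>br a e\<close> and \<open>lc a e\<close>. Vanishing torsion merges them into
  \<open>lc e a\<close>, the shape that cancels in \<open>hbracket_ext_deriv\<close>.\<close>

lemma ext_deriv_conn:
  assumes "smooth_form \<tau>" "multilin \<tau>"
  shows "ext_deriv (conn a \<tau>) = conn a (ext_deriv \<tau>) - (\<Sum>e\<in>Bs. const_form (lc e a) \<curlywedge> pd e \<tau>)"
proof -
  have "ext_deriv (conn a \<tau>) = conn a (ext_deriv \<tau>) +
      ((\<Sum>e\<in>Bs. const_form (br a e) \<curlywedge> pd e \<tau>) - (\<Sum>e\<in>Bs. const_form (lc a e) \<curlywedge> pd e \<tau>))"
    using assms by (simp add: conn_def ext_deriv_add smooth_form_ham smooth_form_lc_act ext_deriv_ham
        ext_deriv_lc_act algebra_simps)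
  also have "(\<Sum>e\<in>Bs. const_form (br a e) \<curlywedge> pd e \<tau>) - (\<Sum>e\<in>Bs. const_form (lc a e) \<curlywedge> pd e \<tau>) =
      - (\<Sum>e\<in>Bs. const_form (lc e a) \<curlywedge> pd e \<tau>)"
    by (simp add: const_form_diff wedge_diff_left sum_subtractf flip: lc_torsion)
  finally show ?thesis by (simp only: diff_conv_add_uminus)
qed

end

section \<open>The Levi-Civita contravariant connection\<close>

context orthonormal_basis
begin

text \<open>The value of a 1-form at a point as an element of the Lie algebra, through the
  identification of the bidual.\<close>

definition form_vec :: "'a dual dform \<Rightarrow> 'a dual \<Rightarrow> 'a" where
  "form_vec \<alpha> x = (\<Sum>e\<in>Bs. \<alpha> x [dual_vec e] *\<^sub>R e)"

lemma sum_inner_basis: "e \<in> Bs \<Longrightarrow> (\<Sum>f\<in>Bs. c f *\<^sub>R f) \<bullet> e = c e"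
  by (rule basis_coefficient[OF bilinear_inner fin orthonormal])

lemma form_vec_inner: "e \<in> Bs \<Longrightarrow> form_vec \<alpha> x \<bullet> e = \<alpha> x [dual_vec e]"
  by (simp add: form_vec_def sum_inner_basis)

lemma form_vec_inner_vec: "form_vec \<alpha> x \<bullet> form_vec \<beta> y = (\<Sum>e\<in>Bs. \<alpha> x [dual_vec e] * \<beta> y [dual_vec e])"
  by (subst inner_expand[symmetric]) (simp add: form_vec_inner)

lemma forms_1_apply:
  assumes "\<alpha> \<in> forms 1"
  shows "\<alpha> x [v] = blinfun_apply v (form_vec \<alpha> x)"
proof -
  have l: "linear (\<lambda>v. \<alpha> x [v])"
    using multilin_linear[of \<alpha> x "[]"] assms by (simp add: forms_iff all_forms_iff)
  have "\<alpha> x [v] = \<alpha> x [\<Sum>e\<in>Bs. blinfun_apply v e *\<^sub>R dual_vec e]"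
    by (simp only: dual_expand)
  also have "\<dots> = (\<Sum>e\<in>Bs. blinfun_apply v e * \<alpha> x [dual_vec e])"
    by (simp add: linear_sum[OF l] linear_scale[OF l])
  finally show ?thesis
    by (simp add: form_vec_def blinfun.sum_right blinfun.scaleR_right mult.commute)
qed

lemma form_vec_eqI:
  assumes "\<And>v. \<alpha> x [v] = blinfun_apply v u"
  shows "form_vec \<alpha> x = u"
  by (simp add: form_vec_def assms expand)

lemma form_vec_const_form [simp]: "form_vec (const_form u) x = u"
  by (rule form_vec_eqI) simp

lemma dual_separates:
  assumes "\<And>\<xi> :: 'a dual. blinfun_apply \<xi> u = blinfun_apply \<xi> w"
  shows "u = w"
proof -
  have "blinfun_apply (blinfun_inner_left (u - w)) (u - w) = 0"
    using assms by (simp add: blinfun.diff_right del: blinfun_inner_left.rep_eq)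
  then show ?thesis by simp
qed

lemma bidual_rep_eval [simp]: "bidual_rep (\<lambda>\<xi>. blinfun_apply \<xi> u) = u" for u :: 'a
  unfolding bidual_rep_def
proof (rule the_equality)
  fix w assume "\<forall>\<xi> :: 'a dual. blinfun_apply \<xi> u = blinfun_apply \<xi> w"
  then show "w = u" by (intro dual_separates) simp
qed simp

lemma linear_eval: "linear (\<lambda>\<xi> :: 'a dual. blinfun_apply \<xi> u)"
  by (simp add: linear_iff blinfun.add_left blinfun.scaleR_left)

text \<open>Reflexivity in finite dimension, read off from the expansion of the constant form
  \<open>one_form \<phi>\<close>.\<close>

lemma linear_bidual:
  assumes "linear \<phi>"
  obtains u where "\<phi> = (\<lambda>\<xi> :: 'a dual. blinfun_apply \<xi> u)"
proof -
  have "one_form \<phi> \<in> forms 1" by (rule one_form_forms[OF assms])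
  from forms_1_apply[OF this, of 0] have "\<phi> v = blinfun_apply v (form_vec (one_form \<phi>) 0)" for v
    by (simp add: one_form_def)
  then show thesis using that by blast
qed

lemma covec_eq: "\<alpha> \<in> forms 1 \<Longrightarrow> covec \<alpha> x = (\<lambda>\<xi>. blinfun_apply \<xi> (form_vec \<alpha> x))"
  by (simp add: fun_eq_iff covec_def forms_1_apply)

lemma sum_basis_inner:
  "(\<Sum>e\<in>Bs. blinfun_apply \<xi> e *\<^sub>R e) \<bullet> v = blinfun_apply \<xi> v"
  by (simp add: inner_sum_left inner_commute[of v] flip: apply_expand[of \<xi> v])

lemma riesz_eq: "riesz \<xi> = (\<Sum>e\<in>Bs. blinfun_apply \<xi> e *\<^sub>R e)"
  unfolding riesz_def
proof (rule the_equality)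
  show "\<forall>v. blinfun_apply \<xi> v = (\<Sum>e\<in>Bs. blinfun_apply \<xi> e *\<^sub>R e) \<bullet> v"
    by (simp add: sum_basis_inner)
  fix u assume "\<forall>v. blinfun_apply \<xi> v = u \<bullet> v"
  then show "u = (\<Sum>e\<in>Bs. blinfun_apply \<xi> e *\<^sub>R e)" by (simp add: expand)
qed

lemma riesz_inner: "riesz \<xi> \<bullet> v = blinfun_apply \<xi> v" for v :: 'a
  by (simp add: riesz_eq sum_basis_inner)

lemma riesz_dual_vec [simp]: "riesz (dual_vec u) = u"
  by (simp add: riesz_eq expand inner_commute[of _ u])

lemma dual_inner_eq: "dual_inner \<xi> \<eta> = blinfun_apply \<eta> (riesz \<xi>)" for \<xi> \<eta> :: "'a dual"
  unfolding dual_inner_def by (subst inner_commute) (rule riesz_inner)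

lemma metric_dual_eq: "metric_dual (\<lambda>_. dual_inner) x (\<lambda>\<xi>. blinfun_apply \<xi> u) = dual_vec u"
  unfolding metric_dual_def
proof (rule the_equality)
  show "\<forall>w. dual_inner (dual_vec u) w = blinfun_apply w u" by (simp add: dual_inner_eq)
  fix v assume "\<forall>w. dual_inner v w = blinfun_apply w u"
  then have "riesz v = u" using dual_separates by (simp add: dual_inner_eq)
  then show "v = dual_vec u"
    by (intro blinfun_eqI) (metis riesz_inner inner_commute dual_vec_apply)
qed

lemma cometric_eq:
  assumes "\<alpha> \<in> forms 1" "\<beta> \<in> forms 1"
  shows "cometric (\<lambda>_. dual_inner) \<alpha> \<beta> x = form_vec \<alpha> x \<bullet> form_vec \<beta> x"
  using assms by (simp add: cometric_def covec_eq metric_dual_eq dual_inner_def)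

end

section \<open>The explicit metric connection and its curvature\<close>

context metric_lie_algebra
begin

abbreviation "\<pi>\<^sub>l \<equiv> linear_poisson br"

lemma bivec_app_eq:
  assumes "\<alpha> \<in> forms 1" "\<beta> \<in> forms 1"
  shows "bivec_app \<pi>\<^sub>l \<alpha> \<beta> x = blinfun_apply x (br (form_vec \<alpha> x) (form_vec \<beta> x))"
  using assms by (simp add: bivec_app_def linear_poisson_def covec_eq)

lemma sharp_eq:
  assumes "\<alpha> \<in> forms 1"
  shows "sharp \<pi>\<^sub>l \<alpha> x = dual_map (br (form_vec \<alpha> x)) x"
  unfolding sharp_def
proof (rule the_equality)
  show "\<forall>\<phi>. linear \<phi> \<longrightarrow> \<phi> (dual_map (br (form_vec \<alpha> x)) x) = \<pi>\<^sub>l x (covec \<alpha> x) \<phi>"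
  proof (intro allI impI)
    fix \<phi> :: "'a dual \<Rightarrow> real" assume "linear \<phi>"
    then obtain u where "\<phi> = (\<lambda>\<xi>. blinfun_apply \<xi> u)" by (rule linear_bidual)
    then show "\<phi> (dual_map (br (form_vec \<alpha> x)) x) = \<pi>\<^sub>l x (covec \<alpha> x) \<phi>"
      using assms by (simp add: linear_poisson_def covec_eq dual_map_apply br_linear)
  qed
next
  fix v assume *: "\<forall>\<phi>. linear \<phi> \<longrightarrow> \<phi> v = \<pi>\<^sub>l x (covec \<alpha> x) \<phi>"
  show "v = dual_map (br (form_vec \<alpha> x)) x"
  proof (rule blinfun_eqI)
    fix u
    show "blinfun_apply v u = blinfun_apply (dual_map (br (form_vec \<alpha> x)) x) u"
      using *[rule_format, OF linear_eval[of u]] assms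
      by (simp add: linear_poisson_def covec_eq dual_map_apply br_linear)
  qed
qed

text \<open>Defined on forms of every degree at once, so that one operator is both the connection on
  1-forms and its extension as a derivation.\<close>

definition lc_conn :: "'a dual cconnection" where
  "lc_conn \<alpha> \<sigma> = (\<Sum>e\<in>Bs. fscale (\<lambda>x. \<alpha> x [dual_vec e]) (conn e \<sigma>))"

lemma conn_linear:
  assumes "multilin \<tau>"
  shows "linear (\<lambda>a. conn a \<tau> x vs)"
proof -
  have *: "conn a \<tau> x vs = (\<Sum>e\<in>Bs. (a \<bullet> e) * conn e \<tau> x vs)" for a
    by (subst conn_expand[OF assms]) (simp add: sum_apply fscale_def)
  show ?thesis
  proof (rule linearI)
    fix a b c
    show "conn (a + b) \<tau> x vs = conn a \<tau> x vs + conn b \<tau> x vs"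
      unfolding *[of "a + b"] *[of a] *[of b] by (simp add: inner_add_left distrib_right sum.distrib)
    show "conn (c *\<^sub>R b) \<tau> x vs = c *\<^sub>R conn b \<tau> x vs"
      unfolding *[of "c *\<^sub>R b"] *[of b] by (simp add: sum_distrib_left mult.assoc)
  qed
qed

lemma lc_conn_apply:
  assumes "multilin \<sigma>"
  shows "lc_conn \<alpha> \<sigma> x vs = conn (form_vec \<alpha> x) \<sigma> x vs"
  by (simp add: linear_sum[OF conn_linear[OF assms]] linear_scale[OF conn_linear[OF assms]] lc_conn_def form_vec_def sum_apply fscale_def)

lemma conn_apply:
  "smooth_form \<sigma> \<Longrightarrow> conn a \<sigma> x vs = dir_deriv (dual_map (br a) x) \<sigma> x vs + lc_act a \<sigma> x vs"
  by (simp add: conn_def ham_apply)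

lemma smooth_component: "\<alpha> \<in> forms k \<Longrightarrow> smooth (\<lambda>x. \<alpha> x vs)"
  by (simp add: forms_iff all_forms_iff smooth_formD)

lemma lc_conn_forms:
  assumes "\<alpha> \<in> forms 1" "\<sigma> \<in> forms k"
  shows "lc_conn \<alpha> \<sigma> \<in> forms k"
  using assms unfolding forms_iff lc_conn_def
  by (intro conjI all_forms_sum all_forms_linear all_forms_conn degree_form_sum degree_form_linear
      degree_form_conn smooth_formD) (simp_all add: all_forms_iff)

lemma lc_conn_add_left: "lc_conn (\<alpha> + \<alpha>') \<sigma> = lc_conn \<alpha> \<sigma> + lc_conn \<alpha>' \<sigma>"
  by (simp add: lc_conn_def fun_eq_iff sum_apply fscale_def distrib_right sum.distrib)

lemma lc_conn_fscale_left: "lc_conn (fscale f \<alpha>) \<sigma> = fscale f (lc_conn \<alpha> \<sigma>)"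
  by (simp add: lc_conn_def fun_eq_iff sum_apply fscale_def sum_distrib_left mult.assoc)

lemma lc_conn_add_right:
  "smooth_form \<sigma> \<Longrightarrow> smooth_form \<tau> \<Longrightarrow> lc_conn \<alpha> (\<sigma> + \<tau>) = lc_conn \<alpha> \<sigma> + lc_conn \<alpha> \<tau>"
  by (simp add: lc_conn_def conn_add fscale_algebra sum.distrib)

lemma lc_conn_sum_right:
  "(\<And>i. i \<in> A \<Longrightarrow> smooth_form (\<sigma> i)) \<Longrightarrow> lc_conn \<alpha> (sum \<sigma> A) = (\<Sum>i\<in>A. lc_conn \<alpha> (\<sigma> i))"
  by (simp add: lc_conn_def conn_sum fscale_sum) (rule sum.swap)

lemma lc_conn_wedge:
  "smooth_form \<sigma> \<Longrightarrow> smooth_form \<tau> \<Longrightarrow> lc_conn \<alpha> (\<sigma> \<curlywedge> \<tau>) = lc_conn \<alpha> \<sigma> \<curlywedge> \<tau> + \<sigma> \<curlywedge> lc_conn \<alpha> \<tau>"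
  by (simp add: lc_conn_def conn_wedge fscale_algebra sum.distrib wedge_sum_left wedge_sum_right)

lemma dual_map_br_vec: "dual_map (br (form_vec \<alpha> x)) y = (\<Sum>e\<in>Bs. \<alpha> x [dual_vec e] *\<^sub>R dual_map (br e) y)"
  by (rule blinfun_eqI)
    (simp add: dual_map_apply br_linear form_vec_def linear_sum[OF br_linear(2)] br_simps
      blinfun.sum_right blinfun_apply_sum blinfun.scaleR_left blinfun.scaleR_right)

lemma fun_deriv_sharp:
  assumes "\<alpha> \<in> forms 1" "smooth f"
  shows "fun_deriv (sharp \<pi>\<^sub>l \<alpha>) f x = (\<Sum>e\<in>Bs. \<alpha> x [dual_vec e] * dd f (dual_map (br e) x) x)"
  by (simp add: linear_sum[OF dd_linear[OF assms(2)]] linear_scale[OF dd_linear[OF assms(2)]] fun_deriv_def sharp_eq[OF assms(1)] dual_map_br_vec)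

lemma lc_conn_fscale_right:
  assumes "\<alpha> \<in> forms 1" "smooth f" "smooth_form \<sigma>"
  shows "lc_conn \<alpha> (fscale f \<sigma>) = fscale f (lc_conn \<alpha> \<sigma>) + fscale (fun_deriv (sharp \<pi>\<^sub>l \<alpha>) f) \<sigma>"
  by (simp add: lc_conn_def conn_fscale assms fun_eq_iff sum_apply fscale_def fun_deriv_sharp[OF assms(1,2)]
      sum_distrib_left sum_distrib_right distrib_left sum.distrib mult_ac)

lemma lc_conn_fun_form:
  assumes "\<alpha> \<in> forms 1" "smooth f"
  shows "lc_conn \<alpha> (fun_form f) = fun_form (fun_deriv (sharp \<pi>\<^sub>l \<alpha>) f)"
proof -
  have "lc_act e (fun_form f) = 0" for e by (simp add: lc_act_def)
  moreover have "smooth_form (fun_form f)" using fun_form_forms[OF assms(2)] by (simp add: forms_iff all_forms_iff)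
  ultimately have "conn e (fun_form f) x vs = fun_form (dd f (dual_map (br e) x)) x vs" for e x vs
    by (simp add: conn_apply dir_deriv_fun_form)
  then show ?thesis
    by (simp add: lc_conn_def fun_eq_iff sum_apply fscale_def fun_deriv_sharp[OF assms] fun_form_def)
qed

lemma contravariant_lc_conn: "contravariant_connection \<pi>\<^sub>l lc_conn"
proof -
  have "smooth_form \<beta>" if "\<beta> \<in> forms 1" for \<beta> :: "'a dual dform"
    using that by (simp add: forms_iff all_forms_iff)
  then show ?thesis
    unfolding contravariant_connection_def
    by (intro conjI ballI allI impI lc_conn_forms lc_conn_add_left lc_conn_add_right
        lc_conn_fscale_left lc_conn_fscale_right) blast+
qed

lemma derivation_extended_lc_conn: "derivation_extended \<pi>\<^sub>l lc_conn"
  unfolding derivation_extended_def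
  by (intro conjI ballI allI impI lc_conn_forms lc_conn_fun_form lc_conn_add_right lc_conn_wedge
      smooth_form_all_forms) auto

lemma dir_deriv_forms: "\<alpha> \<in> forms k \<Longrightarrow> dir_deriv v \<alpha> \<in> forms k"
  by (simp add: forms_iff all_forms_dir_deriv degree_form_dir_deriv)

lemma form_vec_lc_act:
  assumes "\<beta> \<in> forms 1"
  shows "form_vec (lc_act a \<beta>) x = lc a (form_vec \<beta> x)"
proof (rule form_vec_eqI)
  fix v
  have "lc_act a \<beta> x [v] = \<beta> x [dual_map (lc a) v]" by (simp add: lc_act_def lin_act_def)
  then show "lc_act a \<beta> x [v] = blinfun_apply v (lc a (form_vec \<beta> x))"
    by (simp add: forms_1_apply[OF assms] dual_map_apply lc_linear)
qed

text \<open>Separates the derivative of the components from the algebraic product, so that torsion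
  and metric compatibility reduce pointwise to \<open>lc_torsion\<close> and
  \<open>lc_skew\<close>.\<close>

lemma lc_conn_vec:
  assumes "\<alpha> \<in> forms 1" "\<beta> \<in> forms 1"
  shows "form_vec (lc_conn \<alpha> \<beta>) x = form_vec (dir_deriv (sharp \<pi>\<^sub>l \<alpha> x) \<beta>) x + lc (form_vec \<alpha> x) (form_vec \<beta> x)"
proof (rule form_vec_eqI)
  fix v
  have b: "multilin \<beta>" "smooth_form \<beta>" "lc_act (form_vec \<alpha> x) \<beta> \<in> forms 1"
    using assms(2) by (simp_all add: forms_iff all_forms_lc_act degree_form_lc_act) (simp_all add: all_forms_iff)
  show "lc_conn \<alpha> \<beta> x [v] = blinfun_apply v (form_vec (dir_deriv (sharp \<pi>\<^sub>l \<alpha> x) \<beta>) x + lc (form_vec \<alpha> x) (form_vec \<beta> x))"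
    using forms_1_apply[OF dir_deriv_forms[OF assms(2)]] forms_1_apply[OF b(3)]
    by (simp add: lc_conn_apply[OF b(1)] conn_apply[OF b(2)] sharp_eq[OF assms(1)] form_vec_lc_act[OF assms(2)]
        blinfun.add_right)
qed

lemma ext_deriv_pair: "ext_deriv \<beta> x [u, v] = dir_deriv u \<beta> x [v] - dir_deriv v \<beta> x [u]"
proof -
  have "{..<2::nat} = {0, 1}" by auto
  then show ?thesis by (simp add: ext_deriv_def dir_deriv_def numeral_2_eq_2)
qed

text \<open>\<open>g\<close> stays general: it will be evaluation at a point of the dual as well as
  \<open>\<lambda>a. conn a \<gamma> x vs\<close>.\<close>

lemma br_vec_expand:
  fixes g :: "'a \<Rightarrow> real"
  assumes g: "linear g"
  shows "g (br (form_vec \<alpha> y) (form_vec \<beta> z)) =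
    (\<Sum>e\<in>Bs. \<Sum>f\<in>Bs. \<alpha> y [dual_vec e] * (\<beta> z [dual_vec f] * g (br e f)))"
proof -
  have "g (br u w) = (\<Sum>e\<in>Bs. (u \<bullet> e) * (\<Sum>f\<in>Bs. (w \<bullet> f) * g (br e f)))" for u w
    using linear_expand[OF linear_compose[OF br_linear(2)[of w] g], of u, symmetric]
      linear_expand[OF linear_compose[OF br_linear(1) g], of w, symmetric] by simp
  from this[of "form_vec \<alpha> y" "form_vec \<beta> z"] show ?thesis
    by (simp add: form_vec_inner sum_distrib_left)
qed

lemma dd_poisson:
  assumes "\<alpha> \<in> forms 1" "\<beta> \<in> forms 1"
  shows "dd (\<lambda>y. blinfun_apply y (br (form_vec \<alpha> y) (form_vec \<beta> y))) v x =
    blinfun_apply v (br (form_vec \<alpha> x) (form_vec \<beta> x)) + blinfun_apply x (br (form_vec (dir_deriv v \<alpha>) x) (form_vec \<beta> x)) +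
    blinfun_apply x (br (form_vec \<alpha> x) (form_vec (dir_deriv v \<beta>) x))"
proof -
  note sm = smooth_component[OF assms(1)] smooth_component[OF assms(2)] smooth_apply smooth_mult
  have "dd (\<lambda>y. \<Sum>e\<in>Bs. \<Sum>f\<in>Bs. \<alpha> y [dual_vec e] * (\<beta> y [dual_vec f] * blinfun_apply y (br e f))) v x =
     (\<Sum>e\<in>Bs. \<Sum>f\<in>Bs. dir_deriv v \<alpha> x [dual_vec e] * (\<beta> x [dual_vec f] * blinfun_apply x (br e f)) +
       \<alpha> x [dual_vec e] * (dir_deriv v \<beta> x [dual_vec f] * blinfun_apply x (br e f) +
         \<beta> x [dual_vec f] * blinfun_apply v (br e f)))"
    by (simp add: smooth_dd_sum smooth_sum smooth_dd_mult sm dir_deriv_def dd_apply)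
  then show ?thesis
    by (simp add: br_vec_expand[OF bounded_linear.linear[OF blinfun.bounded_linear_right]] distrib_left sum.distrib)
qed

text \<open>The two Lie derivatives contribute the algebraic bracket twice, by antisymmetry.
  Subtracting the differential of the Poisson pairing removes one copy together with the terms that
  differentiate \<open>\<alpha>\<close> or \<open>\<beta>\<close> inside the bracket.\<close>

lemma koszul_bracket_apply:
  assumes "\<alpha> \<in> forms 1" "\<beta> \<in> forms 1"
  shows "koszul_bracket \<pi>\<^sub>l \<alpha> \<beta> x [v] = dir_deriv (sharp \<pi>\<^sub>l \<alpha> x) \<beta> x [v] -
    dir_deriv (sharp \<pi>\<^sub>l \<beta> x) \<alpha> x [v] + blinfun_apply v (br (form_vec \<alpha> x) (form_vec \<beta> x))"
proof -
  have L: "lie_deriv (sharp \<pi>\<^sub>l \<alpha>) \<beta> x [v] = dir_deriv (sharp \<pi>\<^sub>l \<alpha> x) \<beta> x [v] +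
      blinfun_apply v (br (form_vec \<alpha> x) (form_vec \<beta> x)) + blinfun_apply x (br (form_vec (dir_deriv v \<alpha>) x) (form_vec \<beta> x))"
    if "\<alpha> \<in> forms 1" "\<beta> \<in> forms 1" for \<alpha> \<beta>
  proof -
    have "ext_deriv (interior_prod (sharp \<pi>\<^sub>l \<alpha>) \<beta>) x [v] = dd (\<lambda>y. blinfun_apply y (br (form_vec \<alpha> y) (form_vec \<beta> y))) v x"
      using that by (simp add: ext_deriv_def interior_prod_def forms_1_apply sharp_eq dual_map_apply br_linear)
    moreover have "dir_deriv v \<beta> x [sharp \<pi>\<^sub>l \<alpha> x] = blinfun_apply x (br (form_vec \<alpha> x) (form_vec (dir_deriv v \<beta>) x))"
      using that by (simp add: forms_1_apply[OF dir_deriv_forms] sharp_eq dual_map_apply br_linear)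
    ultimately show ?thesis
      using that by (simp add: lie_deriv_def interior_prod_apply ext_deriv_pair dd_poisson)
  qed
  have B: "ext_deriv (fun_form (bivec_app \<pi>\<^sub>l \<alpha> \<beta>)) x [v] = dd (\<lambda>y. blinfun_apply y (br (form_vec \<alpha> y) (form_vec \<beta> y))) v x"
  proof -
    have "bivec_app \<pi>\<^sub>l \<alpha> \<beta> = (\<lambda>y. blinfun_apply y (br (form_vec \<alpha> y) (form_vec \<beta> y)))"
      using bivec_app_eq[OF assms] by (rule ext)
    then show ?thesis by (simp only: ext_deriv_fun_form)
  qed
  show ?thesis
    unfolding koszul_bracket_def minus_apply L[OF assms] L[OF assms(2,1)] B dd_poisson[OF assms]
    using br_swap[of "form_vec \<beta> x" "form_vec \<alpha> x"] br_swap[of "form_vec (dir_deriv v \<beta>) x" "form_vec \<alpha> x"]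
    by (simp add: blinfun.minus_right)
qed

text \<open>Equality of forms concerns lists of every length, so the torsion identity also needs
  this vanishing, before the Koszul bracket is known to be a form.\<close>

lemma koszul_bracket_degree:
  assumes "\<alpha> \<in> forms 1" "\<beta> \<in> forms 1" "length vs \<noteq> 1"
  shows "koszul_bracket \<pi>\<^sub>l \<alpha> \<beta> x vs = 0"
proof -
  have "lie_deriv X \<beta> x vs = 0" if "\<beta> \<in> forms 1" for X \<beta>
  proof -
    have "degree_form 0 (interior_prod X \<beta>)" "degree_form 2 (ext_deriv \<beta>)"
      using that degree_form_ext_deriv[of 1 \<beta>]
      by (auto simp: forms_iff degree_form_def interior_prod_def numeral_2_eq_2)
    then show ?thesis
      using assms(3) degree_form_ext_deriv[of 0 "interior_prod X \<beta>"]
      by (simp add: lie_deriv_def degree_form_def interior_prod_apply)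
  qed
  moreover have "ext_deriv (fun_form f) x vs = 0" for f
    using degree_form_ext_deriv[of 0 "fun_form f"] assms(3) by (simp add: degree_form_def fun_form_def)
  ultimately show ?thesis using assms by (simp add: koszul_bracket_def)
qed

lemma torsion_free_lc_conn: "torsion_free \<pi>\<^sub>l lc_conn"
  unfolding torsion_free_def
proof (intro ballI ext)
  fix \<alpha> \<beta> :: "'a dual dform" and x vs
  assume ab: "\<alpha> \<in> forms 1" "\<beta> \<in> forms 1"
  note f = lc_conn_forms[OF ab] lc_conn_forms[OF ab(2,1)]
  show "(lc_conn \<alpha> \<beta> - lc_conn \<beta> \<alpha>) x vs = koszul_bracket \<pi>\<^sub>l \<alpha> \<beta> x vs"
  proof (cases "length vs = 1")
    case True
    then obtain v where "vs = [v]" by (auto simp: length_Suc_conv)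
    then show ?thesis
      using ab dir_deriv_forms
      by (simp add: forms_1_apply[OF f(1)] forms_1_apply[OF f(2)] lc_conn_vec koszul_bracket_apply blinfun.add_right
         forms_1_apply[OF dir_deriv_forms[OF ab(1)]] forms_1_apply[OF dir_deriv_forms[OF ab(2)]]
         blinfun.diff_right flip: lc_torsion)
  next
    case False
    then show ?thesis using f koszul_bracket_degree[OF ab] by (simp add: forms_def)
  qed
qed

lemma metric_compatible_lc_conn: "metric_compatible \<pi>\<^sub>l (\<lambda>_. dual_inner) lc_conn"
  unfolding metric_compatible_def
proof (intro ballI allI)
  fix \<alpha> \<beta> \<gamma> :: "'a dual dform" and x
  assume abc: "\<alpha> \<in> forms 1" "\<beta> \<in> forms 1" "\<gamma> \<in> forms 1"
  let ?X = "sharp \<pi>\<^sub>l \<alpha> x"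
  have "cometric (\<lambda>_. dual_inner) \<beta> \<gamma> = (\<lambda>y. \<Sum>e\<in>Bs. \<beta> y [dual_vec e] * \<gamma> y [dual_vec e])"
    using cometric_eq[OF abc(2,3)] by (auto simp: form_vec_inner_vec)
  then have "fun_deriv (sharp \<pi>\<^sub>l \<alpha>) (cometric (\<lambda>_. dual_inner) \<beta> \<gamma>) x =
      form_vec (dir_deriv ?X \<beta>) x \<bullet> form_vec \<gamma> x + form_vec \<beta> x \<bullet> form_vec (dir_deriv ?X \<gamma>) x"
    using smooth_component[OF abc(2)] smooth_component[OF abc(3)]
    by (simp add: fun_deriv_def form_vec_inner_vec smooth_dd_sum smooth_mult smooth_dd_mult dir_deriv_def sum.distrib)
  then show "fun_deriv (sharp \<pi>\<^sub>l \<alpha>) (cometric (\<lambda>_. dual_inner) \<beta> \<gamma>) x =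
      cometric (\<lambda>_. dual_inner) (lc_conn \<alpha> \<beta>) \<gamma> x + cometric (\<lambda>_. dual_inner) \<beta> (lc_conn \<alpha> \<gamma>) x"
    using abc lc_skew[of "form_vec \<alpha> x" "form_vec \<beta> x" "form_vec \<gamma> x"]
    by (simp add: cometric_eq lc_conn_forms[OF abc(1)] lc_conn_vec inner_add_left inner_add_right)
qed

lemma metric_connection_lc_conn: "metric_contravariant_connection \<pi>\<^sub>l (\<lambda>_. dual_inner) lc_conn"
  by (simp add: metric_contravariant_connection_def contravariant_lc_conn torsion_free_lc_conn
      metric_compatible_lc_conn)

text \<open>Tensoriality of the curvature, carried out in coordinates. Products of coefficients meet
  commutators, which \<open>conn_conn\<close> evaluates; derivatives of coefficients give the
  derivative part of the Koszul bracket.\<close>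

lemma flat_lc_conn:
  assumes flat
  shows "flat_connection \<pi>\<^sub>l lc_conn"
  unfolding flat_connection_def
proof (intro ballI ext)
  fix \<alpha> \<beta> \<gamma> :: "'a dual dform" and x vs
  assume abc: "\<alpha> \<in> forms 1" "\<beta> \<in> forms 1" "\<gamma> \<in> forms 1"
  have \<gamma>: "multilin \<gamma>" "smooth_form \<gamma>" "\<gamma> \<in> all_forms" using abc(3) by (simp_all add: forms_iff all_forms_iff)
  have *: "lc_conn \<alpha> (lc_conn \<beta> \<gamma>) x vs =
      (\<Sum>f\<in>Bs. \<Sum>e\<in>Bs. \<beta> x [dual_vec f] * (\<alpha> x [dual_vec e] * conn e (conn f \<gamma>) x vs)) +
      (\<Sum>f\<in>Bs. dir_deriv (sharp \<pi>\<^sub>l \<alpha> x) \<beta> x [dual_vec f] * conn f \<gamma> x vs)"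
    if "\<alpha> \<in> forms 1" "\<beta> \<in> forms 1" for \<alpha> \<beta>
  proof -
    have "lc_conn \<alpha> (lc_conn \<beta> \<gamma>) = (\<Sum>f\<in>Bs. lc_conn \<alpha> (fscale (\<lambda>x. \<beta> x [dual_vec f]) (conn f \<gamma>)))"
      unfolding lc_conn_def[of \<beta>] using \<gamma>(2) smooth_component[OF that(2)]
      by (intro lc_conn_sum_right smooth_form_fscale smooth_form_conn)
    also have "\<dots> = (\<Sum>f\<in>Bs. fscale (\<lambda>x. \<beta> x [dual_vec f]) (lc_conn \<alpha> (conn f \<gamma>)) +
        fscale (fun_deriv (sharp \<pi>\<^sub>l \<alpha>) (\<lambda>x. \<beta> x [dual_vec f])) (conn f \<gamma>))"
      using \<gamma>(2) that smooth_component[OF that(2)]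
      by (intro sum.cong refl lc_conn_fscale_right smooth_form_conn)
    finally show ?thesis
      by (simp add: sum_apply fscale_def sum.distrib lc_conn_def sum_distrib_left fun_deriv_def dir_deriv_def)
  qed
  define A where "A e f = \<beta> x [dual_vec f] * \<alpha> x [dual_vec e]" for e f
  have "(\<Sum>f\<in>Bs. \<Sum>e\<in>Bs. \<beta> x [dual_vec f] * (\<alpha> x [dual_vec e] * conn e (conn f \<gamma>) x vs)) -
      (\<Sum>f\<in>Bs. \<Sum>e\<in>Bs. \<alpha> x [dual_vec f] * (\<beta> x [dual_vec e] * conn e (conn f \<gamma>) x vs)) =
      (\<Sum>e\<in>Bs. \<Sum>f\<in>Bs. A e f * (conn e (conn f \<gamma>) - conn f (conn e \<gamma>)) x vs)"
    by (subst (1) sum.swap) (simp add: A_def right_diff_distrib sum_subtractf mult_ac)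
  also have "\<dots> = (\<Sum>e\<in>Bs. \<Sum>f\<in>Bs. A e f * conn (br e f) \<gamma> x vs)"
    by (simp only: conn_conn[OF assms \<gamma>(3)])
  also have "\<dots> = conn (br (form_vec \<alpha> x) (form_vec \<beta> x)) \<gamma> x vs"
    by (simp add: A_def br_vec_expand[OF conn_linear[OF \<gamma>(1)]] mult_ac)
  finally have c: "(\<Sum>f\<in>Bs. \<Sum>e\<in>Bs. \<beta> x [dual_vec f] * (\<alpha> x [dual_vec e] * conn e (conn f \<gamma>) x vs)) -
      (\<Sum>f\<in>Bs. \<Sum>e\<in>Bs. \<alpha> x [dual_vec f] * (\<beta> x [dual_vec e] * conn e (conn f \<gamma>) x vs)) =
      conn (br (form_vec \<alpha> x) (form_vec \<beta> x)) \<gamma> x vs" .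
  have "form_vec (koszul_bracket \<pi>\<^sub>l \<alpha> \<beta>) x = form_vec (dir_deriv (sharp \<pi>\<^sub>l \<alpha> x) \<beta>) x -
      form_vec (dir_deriv (sharp \<pi>\<^sub>l \<beta> x) \<alpha>) x + br (form_vec \<alpha> x) (form_vec \<beta> x)"
    by (rule form_vec_eqI) (simp add: koszul_bracket_apply[OF abc(1,2)] blinfun.add_right blinfun.diff_right
        forms_1_apply[OF dir_deriv_forms[OF abc(1)]] forms_1_apply[OF dir_deriv_forms[OF abc(2)]])
  moreover have "(\<Sum>f\<in>Bs. \<rho> x [dual_vec f] * conn f \<gamma> x vs) = conn (form_vec \<rho> x) \<gamma> x vs" for \<rho>
    using lc_conn_apply[OF \<gamma>(1), of \<rho> x vs] by (simp add: lc_conn_def sum_apply fscale_def)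
  ultimately show "(lc_conn \<alpha> (lc_conn \<beta> \<gamma>) - lc_conn \<beta> (lc_conn \<alpha> \<gamma>) -
      lc_conn (koszul_bracket \<pi>\<^sub>l \<alpha> \<beta>) \<gamma>) x vs = 0 x vs"
    using c by (simp add: *[OF abc(1,2)] *[OF abc(2,1)] lc_conn_apply[OF \<gamma>(1)]
        linear_add[OF conn_linear[OF \<gamma>(1)]] linear_diff[OF conn_linear[OF \<gamma>(1)]])
qed

end

section \<open>Hawkins's bracket\<close>

lemma sum_rotate:
  "(\<Sum>i\<in>A. \<Sum>j\<in>B. \<Sum>k\<in>C. h i j k) = (\<Sum>j\<in>B. \<Sum>k\<in>C. \<Sum>i\<in>A. h i j k)"
proof -
  have "(\<Sum>i\<in>A. \<Sum>j\<in>B. \<Sum>k\<in>C. h i j k) = (\<Sum>j\<in>B. \<Sum>i\<in>A. \<Sum>k\<in>C. h i j k)"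
    by (rule sum.swap)
  also have "\<dots> = (\<Sum>j\<in>B. \<Sum>k\<in>C. \<Sum>i\<in>A. h i j k)"
    by (rule sum.cong[OF refl], rule sum.swap)
  finally show ?thesis .
qed

context metric_lie_algebra
begin

text \<open>The graded biderivation with \<open>{x\<^sub>e, x\<^sub>f} = \<pi>(dx\<^sub>e, dx\<^sub>f)\<close>, \<open>{x\<^sub>e, dx\<^sub>f} = \<D>\<^sub>e dx\<^sub>f\<close> and
  \<open>{dx\<^sub>e, dx\<^sub>f} = 0\<close> in linear coordinates.\<close>

definition hbracket :: "'a dual dform \<Rightarrow> 'a dual dform \<Rightarrow> 'a dual dform" where
  "hbracket \<sigma> \<tau> = (\<Sum>e\<in>Bs. pd e \<sigma> \<curlywedge> conn e \<tau> - lc_act e \<sigma> \<curlywedge> pd e \<tau>)"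

lemma hbracket_all_forms: "\<sigma> \<in> all_forms \<Longrightarrow> \<tau> \<in> all_forms \<Longrightarrow> hbracket \<sigma> \<tau> \<in> all_forms"
  unfolding hbracket_def
  by (intro all_forms_sum all_forms_linear all_forms_wedge all_forms_dir_deriv all_forms_conn all_forms_lc_act)

lemma hbracket_forms:
  assumes "\<sigma> \<in> forms k" "\<tau> \<in> forms l"
  shows "hbracket \<sigma> \<tau> \<in> forms (k + l)"
proof -
  have "degree_form (k + l) (hbracket \<sigma> \<tau>)"
    using assms unfolding hbracket_def forms_iff
    by (intro degree_form_sum degree_form_linear degree_form_wedge degree_form_dir_deriv degree_form_conn
        degree_form_lc_act) simp_all
  then show ?thesis using assms hbracket_all_forms by (simp add: forms_iff)
qed

lemma hbracket_add_left:
  "smooth_form \<sigma> \<Longrightarrow> smooth_form \<sigma>' \<Longrightarrow> hbracket (\<sigma> + \<sigma>') \<tau> = hbracket \<sigma> \<tau> + hbracket \<sigma>' \<tau>"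
  by (simp add: hbracket_def dir_deriv_add lc_act_add wedge_add_left algebra_simps sum.distrib sum_subtractf)

lemma hbracket_add_right:
  "smooth_form \<tau> \<Longrightarrow> smooth_form \<tau>' \<Longrightarrow> hbracket \<sigma> (\<tau> + \<tau>') = hbracket \<sigma> \<tau> + hbracket \<sigma> \<tau>'"
  by (simp add: hbracket_def dir_deriv_add conn_add wedge_add_right algebra_simps sum.distrib sum_subtractf)

lemma fscale_zero_left: "fscale (\<lambda>_. 0) \<sigma> = 0"
  by (simp add: fun_eq_iff fscale_def)

lemma dir_deriv_cscale:
  "smooth_form \<sigma> \<Longrightarrow> dir_deriv v (fscale (\<lambda>_. c) \<sigma>) = fscale (\<lambda>_. c) (dir_deriv v \<sigma>)"
  by (simp add: dir_deriv_fscale fscale_zero_left)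

lemma conn_cscale: "smooth_form \<sigma> \<Longrightarrow> conn a (fscale (\<lambda>_. c) \<sigma>) = fscale (\<lambda>_. c) (conn a \<sigma>)"
  by (simp add: conn_fscale fscale_zero_left)

lemma hbracket_cscale_left:
  "smooth_form \<sigma> \<Longrightarrow> hbracket (fscale (\<lambda>_. c) \<sigma>) \<tau> = fscale (\<lambda>_. c) (hbracket \<sigma> \<tau>)"
  by (simp add: hbracket_def dir_deriv_cscale fscale_sum fscale_algebra)

lemma hbracket_cscale_right:
  "smooth_form \<tau> \<Longrightarrow> hbracket \<sigma> (fscale (\<lambda>_. c) \<tau>) = fscale (\<lambda>_. c) (hbracket \<sigma> \<tau>)"
  by (simp add: hbracket_def dir_deriv_cscale conn_cscale fscale_sum fscale_algebra)

text \<open>The \<open>ham\<close> part is graded antisymmetric because \<open>br\<close> is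
  antisymmetric. The \<open>lc_act\<close> part of \<open>conn\<close> and the subtracted term of
  \<open>hbracket\<close> are exchanged.\<close>

lemma hbracket_antisym:
  assumes "degree_form k \<sigma>" "degree_form l \<tau>"
  shows "hbracket \<sigma> \<tau> = - fscale (\<lambda>_. (-1) ^ (k * l)) (hbracket \<tau> \<sigma>)"
proof -
  define s :: real where "s = (-1) ^ (k * l)"
  have "s * s = 1" by (simp add: s_def flip: power_mult_distrib)
  then have ss: "s * (s * y) = y" for y by (simp flip: mult.assoc)
  have ss': "s * (b * (s * y)) = b * y" for b y using ss[of y] by (metis mult.left_commute)
  have com: "(\<tau>' \<curlywedge> \<sigma>') x vs = s * (\<sigma>' \<curlywedge> \<tau>') x vs"
    if "degree_form k \<sigma>'" "degree_form l \<tau>'" for \<sigma>' \<tau>' x vs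
    using wedge_commute[OF that(2,1)] by (simp add: fscale_def s_def mult.commute)
  note deg = degree_form_dir_deriv[OF assms(1)] degree_form_dir_deriv[OF assms(2)]
    degree_form_lc_act[OF assms(1)] degree_form_lc_act[OF assms(2)]
  have "(\<Sum>e\<in>Bs. (pd e \<sigma> \<curlywedge> ham e \<tau>) x vs) = - (s * (\<Sum>e\<in>Bs. (pd e \<tau> \<curlywedge> ham e \<sigma>) x vs))" for x vs
  proof -
    have "(\<Sum>e\<in>Bs. (pd e \<sigma> \<curlywedge> ham e \<tau>) x vs) =
        (\<Sum>e\<in>Bs. \<Sum>f\<in>Bs. blinfun_apply x (br e f) * (pd e \<sigma> \<curlywedge> pd f \<tau>) x vs)"
      by (simp add: ham_def wedge_sum_right sum_apply fscale_def)
    also have "\<dots> = (\<Sum>f\<in>Bs. \<Sum>e\<in>Bs. blinfun_apply x (br e f) * (pd e \<sigma> \<curlywedge> pd f \<tau>) x vs)"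
      by (rule sum.swap)
    also have "\<dots> = (\<Sum>f\<in>Bs. \<Sum>e\<in>Bs. - (s * (blinfun_apply x (br f e) * (pd f \<tau> \<curlywedge> pd e \<sigma>) x vs)))"
    proof (intro sum.cong refl)
      fix e f
      show "blinfun_apply x (br e f) * (pd e \<sigma> \<curlywedge> pd f \<tau>) x vs =
        - (s * (blinfun_apply x (br f e) * (pd f \<tau> \<curlywedge> pd e \<sigma>) x vs))"
        using br_swap[of e f] by (simp add: com[OF deg(1,2)] ss' blinfun.minus_right)
    qed
    also have "\<dots> = - (s * (\<Sum>e\<in>Bs. (pd e \<tau> \<curlywedge> ham e \<sigma>) x vs))"
      by (simp add: ham_def wedge_sum_right sum_apply fscale_def sum_negf sum_distrib_left)
    finally show ?thesis .
  qed
  then show ?thesis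
    by (simp add: fun_eq_iff hbracket_def conn_def sum_apply fscale_def wedge_add_right sum.distrib
        sum_subtractf com[OF deg(1,4)] com[OF deg(3,2)] s_def[symmetric] right_diff_distrib distrib_left
        sum_distrib_left ss)
qed

text \<open>The defects of \<open>conn\<close> and \<open>lc_act\<close> against
  \<open>ext_deriv\<close> form the same double sum with the two indices exchanged; this is why the
  formula for \<open>hbracket\<close> needs its second term.\<close>

lemma hbracket_ext_deriv:
  assumes "\<sigma> \<in> forms k" "\<tau> \<in> forms l"
  shows "ext_deriv (hbracket \<sigma> \<tau>) =
    hbracket (ext_deriv \<sigma>) \<tau> + fscale (\<lambda>_. (-1) ^ k) (hbracket \<sigma> (ext_deriv \<tau>))"
proof -
  define s :: real where "s = (-1) ^ k"
  have sm: "smooth_form \<sigma>" "smooth_form \<tau>" "multilin \<sigma>" "multilin \<tau>" and dg: "degree_form k \<sigma>"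
    using assms by (simp_all add: forms_iff all_forms_iff)
  note smi = sm smooth_form_dir_deriv smooth_form_conn smooth_form_lc_act smooth_form_wedge
  have g: "grade_inv (pd e \<sigma>) = fscale (\<lambda>_. s) (pd e \<sigma>)"
    "grade_inv (lc_act e \<sigma>) = fscale (\<lambda>_. s) (lc_act e \<sigma>)" for e
    using dg by (simp_all add: grade_inv_degree degree_form_dir_deriv degree_form_lc_act s_def)
  have c: "const_form u \<curlywedge> pd e \<sigma> = fscale (\<lambda>_. s) (pd e \<sigma> \<curlywedge> const_form u)" for u e
    using wedge_commute[of 1 "const_form u" k "pd e \<sigma>"] const_form_forms[of u] dg
    by (simp add: forms_iff degree_form_dir_deriv s_def)
  have "ext_deriv (hbracket \<sigma> \<tau>) = (\<Sum>e\<in>Bs. ext_deriv (pd e \<sigma> \<curlywedge> conn e \<tau>) - ext_deriv (lc_act e \<sigma> \<curlywedge> pd e \<tau>))"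
    by (simp add: hbracket_def ext_deriv_sum ext_deriv_diff smooth_form_diff smi)
  also have "\<dots> = (\<Sum>e\<in>Bs.
      (pd e (ext_deriv \<sigma>) \<curlywedge> conn e \<tau> - lc_act e (ext_deriv \<sigma>) \<curlywedge> pd e \<tau>) +
      (fscale (\<lambda>_. s) (pd e \<sigma> \<curlywedge> conn e (ext_deriv \<tau>)) - fscale (\<lambda>_. s) (lc_act e \<sigma> \<curlywedge> pd e (ext_deriv \<tau>))) +
      ((\<Sum>f\<in>Bs. const_form (lc e f) \<curlywedge> pd f \<sigma> \<curlywedge> pd e \<tau>) -
       (\<Sum>f\<in>Bs. const_form (lc f e) \<curlywedge> pd e \<sigma> \<curlywedge> pd f \<tau>)))"
    by (intro sum.cong refl)
      (simp add: ext_deriv_wedge smi ext_deriv_dir_deriv ext_deriv_conn ext_deriv_lc_act g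
        wedge_diff_left wedge_diff_right wedge_sum_left wedge_sum_right fscale_algebra fscale_sum
        wedge_assoc[symmetric] c algebra_simps)
  also have "\<dots> = hbracket (ext_deriv \<sigma>) \<tau> + fscale (\<lambda>_. s) (hbracket \<sigma> (ext_deriv \<tau>)) +
      ((\<Sum>e\<in>Bs. \<Sum>f\<in>Bs. const_form (lc e f) \<curlywedge> pd f \<sigma> \<curlywedge> pd e \<tau>) -
       (\<Sum>e\<in>Bs. \<Sum>f\<in>Bs. const_form (lc f e) \<curlywedge> pd e \<sigma> \<curlywedge> pd f \<tau>))"
    unfolding hbracket_def sum.distrib sum_subtractf fscale_sum fscale_algebra by (rule refl)
  also have "(\<Sum>e\<in>Bs. \<Sum>f\<in>Bs. const_form (lc e f) \<curlywedge> pd f \<sigma> \<curlywedge> pd e \<tau>) =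
       (\<Sum>e\<in>Bs. \<Sum>f\<in>Bs. const_form (lc f e) \<curlywedge> pd e \<sigma> \<curlywedge> pd f \<tau>)"
    by (rule sum.swap)
  finally show ?thesis by (simp only: s_def diff_self add_0_right)
qed

lemma hbracket_wedge:
  assumes "\<sigma> \<in> forms k" "\<tau> \<in> forms l" "\<rho> \<in> forms m"
  shows "hbracket \<sigma> (\<tau> \<curlywedge> \<rho>) =
    hbracket \<sigma> \<tau> \<curlywedge> \<rho> + fscale (\<lambda>_. (-1) ^ (k * l)) (\<tau> \<curlywedge> hbracket \<sigma> \<rho>)"
proof -
  have sm: "smooth_form \<tau>" "smooth_form \<rho>" and dg: "degree_form k \<sigma>" "degree_form l \<tau>"
    using assms by (simp_all add: forms_iff all_forms_iff)
  have c: "pd e \<sigma> \<curlywedge> \<tau> \<curlywedge> \<rho>' = fscale (\<lambda>_. (-1) ^ (k * l)) (\<tau> \<curlywedge> pd e \<sigma> \<curlywedge> \<rho>')"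
    "lc_act e \<sigma> \<curlywedge> \<tau> \<curlywedge> \<rho>' = fscale (\<lambda>_. (-1) ^ (k * l)) (\<tau> \<curlywedge> lc_act e \<sigma> \<curlywedge> \<rho>')" for e \<rho>'
    using wedge_commute[OF degree_form_dir_deriv[OF dg(1)] dg(2)]
      wedge_commute[OF degree_form_lc_act[OF dg(1)] dg(2)]
    by (simp_all flip: wedge_assoc)
  have "hbracket \<sigma> (\<tau> \<curlywedge> \<rho>) = (\<Sum>e\<in>Bs. (pd e \<sigma> \<curlywedge> conn e \<tau> - lc_act e \<sigma> \<curlywedge> pd e \<tau>) \<curlywedge> \<rho> +
      fscale (\<lambda>_. (-1) ^ (k * l)) (\<tau> \<curlywedge> (pd e \<sigma> \<curlywedge> conn e \<rho> - lc_act e \<sigma> \<curlywedge> pd e \<rho>)))"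
    unfolding hbracket_def
    by (intro sum.cong refl)
      (simp add: conn_wedge dir_deriv_wedge sm wedge_add_right wedge_diff_left wedge_diff_right wedge_assoc c
        fscale_algebra)
  then show ?thesis
    unfolding hbracket_def by (simp only: sum.distrib wedge_sum_left wedge_sum_right fscale_sum)
qed

lemma hbracket_fun_form: "hbracket (fun_form f) \<sigma> = lc_conn (ext_deriv (fun_form f)) \<sigma>"
  by (simp add: hbracket_def lc_conn_def dir_deriv_fun_form lc_act_def fun_form_wedge ext_deriv_fun_form)

lemma hbracket_fun_fun:
  assumes "smooth f" "smooth g"
  shows "hbracket (fun_form f) (fun_form g) =
    fun_form (bivec_app \<pi>\<^sub>l (ext_deriv (fun_form f)) (ext_deriv (fun_form g)))"
proof -
  note F = ext_deriv_fun_form_forms[OF assms(1)] ext_deriv_fun_form_forms[OF assms(2)]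
  have "fun_deriv (sharp \<pi>\<^sub>l (ext_deriv (fun_form f))) g =
      bivec_app \<pi>\<^sub>l (ext_deriv (fun_form f)) (ext_deriv (fun_form g))"
    using forms_1_apply[OF F(2)]
    by (simp add: fun_eq_iff fun_deriv_def bivec_app_eq[OF F] sharp_eq[OF F(1)] ext_deriv_fun_form dual_map_apply br_linear)
  then show ?thesis
    by (simp add: hbracket_fun_form lc_conn_fun_form[OF F(1) assms(2)])
qed

lemma hawkins_bracket_hbracket: "hawkins_bracket \<pi>\<^sub>l lc_conn hbracket"
  unfolding hawkins_bracket_def
  by (intro conjI allI impI ballI hbracket_forms hbracket_add_left hbracket_add_right
      hbracket_cscale_left hbracket_cscale_right hbracket_antisym hbracket_ext_deriv hbracket_wedge
      hbracket_fun_fun hbracket_fun_form)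
    (auto simp: forms_iff smooth_form_all_forms)

text \<open>Both sides contract the Poisson tensor with the differential of \<open>h\<close> and the
  first derivatives of \<open>\<sigma>\<close>; its antisymmetry gives the sign. In use,
  \<open>h\<close> is a first derivative of \<open>f\<close>, which brings in the Hessian.\<close>

lemma hessian_ham:
  assumes "smooth h"
  shows "(\<Sum>e\<in>Bs. fscale (dd h (dual_vec e)) (ham e \<sigma>)) =
    - (\<Sum>e\<in>Bs. fscale (\<lambda>x. dd h (dual_map (br e) x) x) (pd e \<sigma>))"
proof -
  have h: "dd h (dual_map (br e) x) x = (\<Sum>f\<in>Bs. blinfun_apply x (br e f) * dd h (dual_vec f) x)" for e x
    by (simp add: dual_map_def linear_sum[OF dd_linear[OF assms]] linear_scale[OF dd_linear[OF assms]])
  have "(\<Sum>e\<in>Bs. dd h (dual_vec e) x * ham e \<sigma> x vs) = - (\<Sum>e\<in>Bs. dd h (dual_map (br e) x) x * pd e \<sigma> x vs)"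
    for x vs
  proof -
    have "(\<Sum>e\<in>Bs. dd h (dual_vec e) x * ham e \<sigma> x vs) =
        (\<Sum>e\<in>Bs. \<Sum>f\<in>Bs. dd h (dual_vec e) x * (blinfun_apply x (br e f) * pd f \<sigma> x vs))"
      by (simp add: ham_def sum_apply fscale_def sum_distrib_left)
    also have "\<dots> = (\<Sum>f\<in>Bs. \<Sum>e\<in>Bs. dd h (dual_vec e) x * (blinfun_apply x (br e f) * pd f \<sigma> x vs))"
      by (rule sum.swap)
    also have "\<dots> = (\<Sum>f\<in>Bs. \<Sum>e\<in>Bs. - (blinfun_apply x (br f e) * dd h (dual_vec e) x * pd f \<sigma> x vs))"
    proof (intro sum.cong refl)
      fix e f
      show "dd h (dual_vec e) x * (blinfun_apply x (br e f) * pd f \<sigma> x vs) =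
        - (blinfun_apply x (br f e) * dd h (dual_vec e) x * pd f \<sigma> x vs)"
        using br_swap[of e f] by (simp add: blinfun.minus_right)
    qed
    also have "\<dots> = - (\<Sum>e\<in>Bs. dd h (dual_map (br e) x) x * pd e \<sigma> x vs)"
      by (simp add: h sum_negf sum_distrib_right)
    finally show ?thesis .
  qed
  then show ?thesis by (simp add: fun_eq_iff sum_apply fscale_def)
qed

text \<open>The defect has two sources: the coefficients \<open>dd f (dual_vec k)\<close>, which
  yield the Hessian, and the linear coefficients of \<open>ham k\<close>, which yield structure
  constants.\<close>

lemma lc_conn_pd:
  assumes "smooth f" "smooth_form \<sigma>"
  shows "lc_conn (ext_deriv (fun_form f)) (pd e \<sigma>) = pd e (lc_conn (ext_deriv (fun_form f)) \<sigma>) -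
    ((\<Sum>k\<in>Bs. fscale (dd (dd f (dual_vec k)) (dual_vec e)) (conn k \<sigma>)) +
     (\<Sum>k\<in>Bs. fscale (dd f (dual_vec k)) (\<Sum>l\<in>Bs. fscale (\<lambda>_. br k l \<bullet> e) (pd l \<sigma>))))"
proof -
  have "pd e (lc_conn (ext_deriv (fun_form f)) \<sigma>) =
      (\<Sum>k\<in>Bs. pd e (fscale (dd f (dual_vec k)) (conn k \<sigma>)))"
    unfolding lc_conn_def ext_deriv_fun_form
    by (intro dir_deriv_sum smooth_form_fscale smooth_dd smooth_form_conn assms)
  also have "\<dots> = (\<Sum>k\<in>Bs. fscale (dd (dd f (dual_vec k)) (dual_vec e)) (conn k \<sigma>) +
      fscale (dd f (dual_vec k)) ((\<Sum>l\<in>Bs. fscale (\<lambda>_. br k l \<bullet> e) (pd l \<sigma>)) + conn k (pd e \<sigma>)))"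
    using assms by (simp add: dir_deriv_fscale smooth_dd smooth_form_conn pd_conn)
  finally show ?thesis
    by (simp add: lc_conn_def ext_deriv_fun_form fscale_algebra sum.distrib algebra_simps)
qed

lemma lc_conn_lc_act:
  assumes flat "\<sigma> \<in> all_forms"
  shows "lc_conn \<alpha> (lc_act e \<sigma>) = lc_act e (lc_conn \<alpha> \<sigma>) +
    (\<Sum>k\<in>Bs. fscale (\<lambda>x. \<alpha> x [dual_vec k]) (lc_act (br k e) \<sigma>))"
  by (simp add: lc_conn_def conn_lc_act[OF assms] fscale_algebra sum.distrib lc_act_sum)

lemma lc_conn_conn:
  assumes flat "\<sigma> \<in> all_forms" "smooth f"
  shows "lc_conn (ext_deriv (fun_form f)) (conn e \<sigma>) = conn e (lc_conn (ext_deriv (fun_form f)) \<sigma>) -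
    (\<Sum>k\<in>Bs. fscale (\<lambda>x. dd (dd f (dual_vec k)) (dual_map (br e) x) x) (conn k \<sigma>)) +
    (\<Sum>k\<in>Bs. fscale (dd f (dual_vec k)) (conn (br k e) \<sigma>))"
proof -
  have sm: "smooth_form \<sigma>" using assms(2) by (rule smooth_form_all_forms)
  have cc: "conn k (conn e \<sigma>) = conn e (conn k \<sigma>) + conn (br k e) \<sigma>" for k
    using conn_conn[OF assms(1,2), of k e] by (simp only: diff_eq_eq add.commute)
  have "conn e (lc_conn (ext_deriv (fun_form f)) \<sigma>) =
      (\<Sum>k\<in>Bs. conn e (fscale (dd f (dual_vec k)) (conn k \<sigma>)))"
    unfolding lc_conn_def ext_deriv_fun_form
    by (intro conn_sum smooth_form_fscale smooth_dd smooth_form_conn sm assms)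
  also have "\<dots> = (\<Sum>k\<in>Bs. fscale (\<lambda>x. dd (dd f (dual_vec k)) (dual_map (br e) x) x) (conn k \<sigma>) +
      fscale (dd f (dual_vec k)) (conn e (conn k \<sigma>)))"
    using sm assms(3) by (simp add: conn_fscale smooth_dd smooth_form_conn)
  finally show ?thesis
    by (simp add: lc_conn_def ext_deriv_fun_form cc fscale_algebra sum.distrib)
qed

text \<open>For flat \<open>\<D>\<close>, \<open>\<D>\<close> along an exact form is a derivation of the bracket. The first
  order terms of the defect cancel since \<open>conn\<close> represents the Lie algebra, the second order terms
  by symmetry of the Hessian of \<open>f\<close>.\<close>

lemma lc_conn_hbracket:
  assumes flat "\<sigma> \<in> all_forms" "\<tau> \<in> all_forms" "smooth f"
  defines "D \<equiv> lc_conn (ext_deriv (fun_form f))"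
  shows "D (hbracket \<sigma> \<tau>) = hbracket (D \<sigma>) \<tau> + hbracket \<sigma> (D \<tau>)"
proof -
  have sm: "smooth_form \<sigma>" "smooth_form \<tau>" "multilin \<sigma>" "multilin \<tau>"
    using assms by (simp_all add: all_forms_iff)
  define F where "F k = dd f (dual_vec k)" for k
  define H where "H k e = dd (F k) (dual_vec e)" for k e
  define X where "X k e = (\<lambda>x. dd (F k) (dual_map (br e) x) x)" for k e
  have F: "smooth (F k)" for k unfolding F_def by (rule smooth_dd[OF assms(4)])
  have Hsym: "H k e = H e k" for k e
    by (simp add: fun_eq_iff H_def F_def dd_commute[OF assms(4)])
  \<comment> \<open>\<open>P1\<close> and \<open>Q1\<close> collect the second derivatives of
    \<open>f\<close>; \<open>P2\<close>, \<open>Q2\<close> and \<open>R\<close> collect its first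
    derivatives multiplied by structure constants.\<close>
  define P1 where "P1 e \<sigma> = (\<Sum>k\<in>Bs. fscale (H k e) (conn k \<sigma>))" for e \<sigma>
  define P2 where "P2 e \<sigma> = (\<Sum>k\<in>Bs. fscale (F k) (\<Sum>l\<in>Bs. fscale (\<lambda>_. br k l \<bullet> e) (pd l \<sigma>)))" for e \<sigma>
  define Q1 where "Q1 e \<sigma> = (\<Sum>k\<in>Bs. fscale (X k e) (conn k \<sigma>))" for e \<sigma>
  define Q2 where "Q2 e \<sigma> = (\<Sum>k\<in>Bs. fscale (F k) (conn (br k e) \<sigma>))" for e \<sigma>
  define R where "R e \<sigma> = (\<Sum>k\<in>Bs. fscale (F k) (lc_act (br k e) \<sigma>))" for e \<sigma>
  have c1: "D (pd e \<sigma>) = pd e (D \<sigma>) - (P1 e \<sigma> + P2 e \<sigma>)" if "smooth_form \<sigma>" for e \<sigma>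
    unfolding D_def lc_conn_pd[OF assms(4) that] P1_def P2_def H_def F_def by (rule refl)
  have c2: "D (conn e \<tau>) = conn e (D \<tau>) - Q1 e \<tau> + Q2 e \<tau>" for e
    unfolding D_def lc_conn_conn[OF assms(1,3,4)] Q1_def Q2_def X_def F_def by (rule refl)
  have c3: "D (lc_act e \<sigma>) = lc_act e (D \<sigma>) + R e \<sigma>" for e
    unfolding D_def lc_conn_lc_act[OF assms(1,2)] R_def F_def ext_deriv_fun_form by (rule refl)
  have "D (hbracket \<sigma> \<tau>) = (\<Sum>e\<in>Bs. D (pd e \<sigma> \<curlywedge> conn e \<tau> + fscale (\<lambda>_. -1) (lc_act e \<sigma> \<curlywedge> pd e \<tau>)))"
  proof -
    have "hbracket \<sigma> \<tau> = (\<Sum>e\<in>Bs. pd e \<sigma> \<curlywedge> conn e \<tau> + fscale (\<lambda>_. -1) (lc_act e \<sigma> \<curlywedge> pd e \<tau>))"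
      by (simp add: hbracket_def fscale_def fun_eq_iff sum_apply)
    then show ?thesis
      unfolding D_def by (simp only:)
        (intro lc_conn_sum_right smooth_form_add smooth_form_fscale smooth_const smooth_form_wedge
          smooth_form_dir_deriv smooth_form_conn smooth_form_lc_act sm)
  qed
  also have "\<dots> = (\<Sum>e\<in>Bs. D (pd e \<sigma> \<curlywedge> conn e \<tau>) - D (lc_act e \<sigma> \<curlywedge> pd e \<tau>))"
  proof (intro sum.cong refl)
    fix e
    have "D (fscale (\<lambda>_. -1) \<rho>) = - D \<rho>" if "smooth_form \<rho>" for \<rho>
      using that unfolding D_def lc_conn_def
      by (simp add: conn_cscale fscale_algebra) (simp add: fun_eq_iff sum_apply fscale_def sum_negf)
    then show "D (pd e \<sigma> \<curlywedge> conn e \<tau> + fscale (\<lambda>_. -1) (lc_act e \<sigma> \<curlywedge> pd e \<tau>)) =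
        D (pd e \<sigma> \<curlywedge> conn e \<tau>) - D (lc_act e \<sigma> \<curlywedge> pd e \<tau>)"
      unfolding D_def
      by (subst lc_conn_add_right) (simp_all add: sm smooth_form_fscale smooth_form_wedge
        smooth_form_dir_deriv smooth_form_conn smooth_form_lc_act del: wedge_fscale_left)
  qed
  also have "\<dots> = (\<Sum>e\<in>Bs. (pd e (D \<sigma>) \<curlywedge> conn e \<tau> - lc_act e (D \<sigma>) \<curlywedge> pd e \<tau>) +
      (pd e \<sigma> \<curlywedge> conn e (D \<tau>) - lc_act e \<sigma> \<curlywedge> pd e (D \<tau>)) +
      (- (P1 e \<sigma> \<curlywedge> conn e \<tau>) - pd e \<sigma> \<curlywedge> Q1 e \<tau> + lc_act e \<sigma> \<curlywedge> P1 e \<tau>) +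
      (- (P2 e \<sigma> \<curlywedge> conn e \<tau>) + pd e \<sigma> \<curlywedge> Q2 e \<tau> - R e \<sigma> \<curlywedge> pd e \<tau> + lc_act e \<sigma> \<curlywedge> P2 e \<tau>))"
  proof (intro sum.cong refl)
    fix e
    have 1: "D (pd e \<sigma> \<curlywedge> conn e \<tau>) = D (pd e \<sigma>) \<curlywedge> conn e \<tau> + pd e \<sigma> \<curlywedge> D (conn e \<tau>)"
      unfolding D_def by (intro lc_conn_wedge smooth_form_dir_deriv smooth_form_conn sm)
    have 2: "D (lc_act e \<sigma> \<curlywedge> pd e \<tau>) = D (lc_act e \<sigma>) \<curlywedge> pd e \<tau> + lc_act e \<sigma> \<curlywedge> D (pd e \<tau>)"
      unfolding D_def by (intro lc_conn_wedge smooth_form_dir_deriv smooth_form_lc_act sm)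
    show "D (pd e \<sigma> \<curlywedge> conn e \<tau>) - D (lc_act e \<sigma> \<curlywedge> pd e \<tau>) =
      (pd e (D \<sigma>) \<curlywedge> conn e \<tau> - lc_act e (D \<sigma>) \<curlywedge> pd e \<tau>) +
      (pd e \<sigma> \<curlywedge> conn e (D \<tau>) - lc_act e \<sigma> \<curlywedge> pd e (D \<tau>)) +
      (- (P1 e \<sigma> \<curlywedge> conn e \<tau>) - pd e \<sigma> \<curlywedge> Q1 e \<tau> + lc_act e \<sigma> \<curlywedge> P1 e \<tau>) +
      (- (P2 e \<sigma> \<curlywedge> conn e \<tau>) + pd e \<sigma> \<curlywedge> Q2 e \<tau> - R e \<sigma> \<curlywedge> pd e \<tau> + lc_act e \<sigma> \<curlywedge> P2 e \<tau>)"
      unfolding 1 2 c1[OF sm(1)] c1[OF sm(2)] c2 c3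
      by (simp add: wedge_add_left wedge_add_right wedge_diff_left wedge_diff_right algebra_simps)
  qed
  also have "\<dots> = hbracket (D \<sigma>) \<tau> + hbracket \<sigma> (D \<tau>) +
      (- (\<Sum>e\<in>Bs. P1 e \<sigma> \<curlywedge> conn e \<tau>) - (\<Sum>e\<in>Bs. pd e \<sigma> \<curlywedge> Q1 e \<tau>) + (\<Sum>e\<in>Bs. lc_act e \<sigma> \<curlywedge> P1 e \<tau>)) +
      (- (\<Sum>e\<in>Bs. P2 e \<sigma> \<curlywedge> conn e \<tau>) + (\<Sum>e\<in>Bs. pd e \<sigma> \<curlywedge> Q2 e \<tau>) - (\<Sum>e\<in>Bs. R e \<sigma> \<curlywedge> pd e \<tau>) +
        (\<Sum>e\<in>Bs. lc_act e \<sigma> \<curlywedge> P2 e \<tau>))"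
    unfolding hbracket_def sum.distrib sum_subtractf sum_negf by (rule refl)
  \<comment> \<open>Summation over \<open>e\<close> absorbs \<open>br k l \<bullet> e\<close> into
    the index: linearity of \<open>conn\<close> in its index reassembles
    \<open>conn (br k l)\<close>. The next step does the same with \<open>lc_act\<close>.\<close>
  also have "(\<Sum>e\<in>Bs. P2 e \<sigma> \<curlywedge> conn e \<tau>) = (\<Sum>e\<in>Bs. pd e \<sigma> \<curlywedge> Q2 e \<tau>)"
  proof -
    have "(\<Sum>e\<in>Bs. P2 e \<sigma> \<curlywedge> conn e \<tau>) =
        (\<Sum>e\<in>Bs. \<Sum>k\<in>Bs. \<Sum>l\<in>Bs. fscale (F k) (fscale (\<lambda>_. br k l \<bullet> e) (pd l \<sigma> \<curlywedge> conn e \<tau>)))"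
      by (simp add: P2_def wedge_sum_left fscale_sum)
    also have "\<dots> = (\<Sum>k\<in>Bs. \<Sum>l\<in>Bs. \<Sum>e\<in>Bs. fscale (F k) (fscale (\<lambda>_. br k l \<bullet> e) (pd l \<sigma> \<curlywedge> conn e \<tau>)))"
      by (rule sum_rotate)
    also have "\<dots> = (\<Sum>k\<in>Bs. \<Sum>l\<in>Bs. fscale (F k) (pd l \<sigma> \<curlywedge> conn (br k l) \<tau>))"
    proof (intro sum.cong refl)
      fix k l
      show "(\<Sum>e\<in>Bs. fscale (F k) (fscale (\<lambda>_. br k l \<bullet> e) (pd l \<sigma> \<curlywedge> conn e \<tau>))) =
        fscale (F k) (pd l \<sigma> \<curlywedge> conn (br k l) \<tau>)"
        by (subst conn_expand[OF sm(4), of "br k l"]) (simp add: wedge_sum_right fscale_sum)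
    qed
    also have "\<dots> = (\<Sum>l\<in>Bs. \<Sum>k\<in>Bs. fscale (F k) (pd l \<sigma> \<curlywedge> conn (br k l) \<tau>))"
      by (rule sum.swap)
    finally show ?thesis by (simp add: Q2_def wedge_sum_right)
  qed
  also have "(\<Sum>e\<in>Bs. lc_act e \<sigma> \<curlywedge> P2 e \<tau>) = (\<Sum>e\<in>Bs. R e \<sigma> \<curlywedge> pd e \<tau>)"
  proof -
    have "(\<Sum>e\<in>Bs. lc_act e \<sigma> \<curlywedge> P2 e \<tau>) =
        (\<Sum>e\<in>Bs. \<Sum>k\<in>Bs. \<Sum>l\<in>Bs. fscale (F k) (fscale (\<lambda>_. br k l \<bullet> e) (lc_act e \<sigma> \<curlywedge> pd l \<tau>)))"
      by (simp add: P2_def wedge_sum_right fscale_sum)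
    also have "\<dots> = (\<Sum>k\<in>Bs. \<Sum>l\<in>Bs. \<Sum>e\<in>Bs. fscale (F k) (fscale (\<lambda>_. br k l \<bullet> e) (lc_act e \<sigma> \<curlywedge> pd l \<tau>)))"
      by (rule sum_rotate)
    also have "\<dots> = (\<Sum>k\<in>Bs. \<Sum>l\<in>Bs. fscale (F k) (lc_act (br k l) \<sigma> \<curlywedge> pd l \<tau>))"
    proof (intro sum.cong refl)
      fix k l
      show "(\<Sum>e\<in>Bs. fscale (F k) (fscale (\<lambda>_. br k l \<bullet> e) (lc_act e \<sigma> \<curlywedge> pd l \<tau>))) =
        fscale (F k) (lc_act (br k l) \<sigma> \<curlywedge> pd l \<tau>)"
        by (subst lc_act_expand[OF sm(3), of "br k l"]) (simp add: wedge_sum_left fscale_sum)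
    qed
    also have "\<dots> = (\<Sum>l\<in>Bs. \<Sum>k\<in>Bs. fscale (F k) (lc_act (br k l) \<sigma> \<curlywedge> pd l \<tau>))"
      by (rule sum.swap)
    finally show ?thesis by (simp add: R_def wedge_sum_left)
  qed
  \<comment> \<open>Split \<open>conn k\<close> into \<open>ham k\<close> and
    \<open>lc_act k\<close>. By \<open>hessian_ham\<close> the first part becomes the
    \<open>Q1\<close> sum with a minus sign; the second becomes the remaining \<open>P1\<close> sum
    by symmetry of the Hessian.\<close>
  also have "(\<Sum>e\<in>Bs. P1 e \<sigma> \<curlywedge> conn e \<tau>) =
      (\<Sum>e\<in>Bs. lc_act e \<sigma> \<curlywedge> P1 e \<tau>) - (\<Sum>e\<in>Bs. pd e \<sigma> \<curlywedge> Q1 e \<tau>)"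
  proof -
    have "(\<Sum>e\<in>Bs. P1 e \<sigma> \<curlywedge> conn e \<tau>) = (\<Sum>e\<in>Bs. \<Sum>k\<in>Bs. fscale (H k e) (conn k \<sigma> \<curlywedge> conn e \<tau>))"
      by (simp add: P1_def wedge_sum_left)
    also have "\<dots> = (\<Sum>e\<in>Bs. \<Sum>k\<in>Bs. fscale (H e k) (ham k \<sigma>) \<curlywedge> conn e \<tau> + fscale (H e k) (lc_act k \<sigma> \<curlywedge> conn e \<tau>))"
      unfolding conn_def[of _ \<sigma>] by (simp add: wedge_add_left fscale_algebra Hsym)
    also have "\<dots> = (\<Sum>e\<in>Bs. (\<Sum>k\<in>Bs. fscale (H e k) (ham k \<sigma>)) \<curlywedge> conn e \<tau>) +
        (\<Sum>e\<in>Bs. \<Sum>k\<in>Bs. fscale (H e k) (lc_act k \<sigma> \<curlywedge> conn e \<tau>))"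
      by (simp only: sum.distrib wedge_sum_left)
    also have "(\<Sum>e\<in>Bs. (\<Sum>k\<in>Bs. fscale (H e k) (ham k \<sigma>)) \<curlywedge> conn e \<tau>) =
        - (\<Sum>e\<in>Bs. \<Sum>k\<in>Bs. fscale (X e k) (pd k \<sigma> \<curlywedge> conn e \<tau>))"
      unfolding H_def X_def hessian_ham[OF F] wedge_minus sum_negf by (simp add: wedge_sum_left)
    also have "(\<Sum>e\<in>Bs. \<Sum>k\<in>Bs. fscale (X e k) (pd k \<sigma> \<curlywedge> conn e \<tau>)) =
        (\<Sum>k\<in>Bs. \<Sum>e\<in>Bs. fscale (X e k) (pd k \<sigma> \<curlywedge> conn e \<tau>))"
      by (rule sum.swap)
    also have "\<dots> = (\<Sum>e\<in>Bs. pd e \<sigma> \<curlywedge> Q1 e \<tau>)"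
      by (simp add: Q1_def wedge_sum_right)
    also have "(\<Sum>e\<in>Bs. \<Sum>k\<in>Bs. fscale (H e k) (lc_act k \<sigma> \<curlywedge> conn e \<tau>)) =
        (\<Sum>k\<in>Bs. \<Sum>e\<in>Bs. fscale (H e k) (lc_act k \<sigma> \<curlywedge> conn e \<tau>))"
      by (rule sum.swap)
    also have "\<dots> = (\<Sum>e\<in>Bs. lc_act e \<sigma> \<curlywedge> P1 e \<tau>)"
      by (simp add: P1_def wedge_sum_right)
    finally show ?thesis by (simp only: add.commute diff_conv_add_uminus)
  qed
  finally show ?thesis by (simp add: fun_eq_iff)
qed

lemma metaflat_lc_conn:
  assumes flat
  shows "metaflat \<pi>\<^sub>l lc_conn"
proof -
  have "metacurvature hbracket (\<lambda>_ _ _. 0)"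
    unfolding metacurvature_def
  proof (intro conjI ballI allI impI)
    show "(0 :: 'a dual dform) \<in> forms 2"
      by (simp add: forms_iff all_forms_linear degree_form_linear)
  next
    fix f :: "'a dual \<Rightarrow> real" and \<alpha> \<beta> :: "'a dual dform"
    assume *: "smooth f" "\<alpha> \<in> forms 1" "\<beta> \<in> forms 1"
    let ?D = "lc_conn (ext_deriv (fun_form f))"
    have "?D \<beta> \<in> forms 1"
      using * by (intro lc_conn_forms ext_deriv_fun_form_forms)
    \<comment> \<open>On 1-forms graded antisymmetry means symmetry, which turns the third term of
      the metacurvature into the one required by the derivation property.\<close>
    then have "hbracket (?D \<beta>) \<alpha> = hbracket \<alpha> (?D \<beta>)"
      using hbracket_antisym[of 1 "?D \<beta>" 1 \<alpha>] *(2) by (simp add: forms_iff) (simp add: fscale_def fun_eq_iff)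
    moreover have "?D (hbracket \<alpha> \<beta>) = hbracket (?D \<alpha>) \<beta> + hbracket \<alpha> (?D \<beta>)"
      using * assms by (intro lc_conn_hbracket) (simp_all add: forms_iff)
    ultimately show "0 = hbracket (fun_form f) (hbracket \<alpha> \<beta>) - hbracket (hbracket (fun_form f) \<alpha>) \<beta> -
        hbracket (hbracket (fun_form f) \<beta>) \<alpha>"
      by (simp add: hbracket_fun_form)
  qed (simp_all add: fscale_algebra)
  then show ?thesis
    unfolding metaflat_def using hawkins_bracket_hbracket by (intro exI[of _ hbracket] exI[of _ "\<lambda>_ _ _. 0"]) simp
qed

end

section \<open>Riemannian volume and unimodularity\<close>

lemma multilin_zero_of_span:
  assumes "multilin \<omega>" "span B = UNIV"
    "\<And>bs. set bs \<subseteq> B \<Longrightarrow> length bs = length ws \<Longrightarrow> \<omega> x bs = 0"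
  shows "\<omega> x ws = 0"
  using assms(1,3)
proof (induction ws arbitrary: \<omega>)
  case Nil
  then show ?case by simp
next
  case (Cons w ws)
  have "\<omega> x (b # ws) = 0" if "b \<in> B" for b
  proof -
    have "contr b \<omega> x ws = 0"
    proof (rule Cons.IH[OF multilin_contr[OF Cons.prems(1)]])
      fix bs assume "set bs \<subseteq> B" "length bs = length ws"
      then show "contr b \<omega> x bs = 0" using Cons.prems(2)[of "b # bs"] that by (simp add: interior_prod_def)
    qed
    then show ?thesis by (simp add: interior_prod_def)
  qed
  then show ?case
    using linear_eq_0_on_span[OF multilin_linear[OF Cons.prems(1)], of B x ws w] assms(2) by auto
qed

lemma altern_not_distinct:
  assumes "multilin \<omega>" "altern \<omega>" "\<not> distinct vs"
  shows "\<omega> x vs = 0"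
proof -
  obtain ws v ms us where "vs = ws @ [v] @ ms @ [v] @ us"
    using not_distinct_decomp[OF assms(3)] by blast
  then show ?thesis using altern_repeat[OF assms(1,2)] by simp
qed

lemma altern_move:
  assumes "multilin \<omega>" "altern \<omega>"
  shows "\<bar>\<omega> x (ws @ v # us)\<bar> = \<bar>\<omega> x (v # ws @ us)\<bar>"
proof (induction ws arbitrary: us rule: rev_induct)
  case (snoc u ws)
  then show ?case using altern_swap[OF assms, of x ws u v us] by simp
qed simp

text \<open>Working with absolute values avoids signs of permutations; a multiset then records all
  that matters about the arguments.\<close>

lemma altern_mset:
  assumes "multilin \<omega>" "altern \<omega>" "mset vs = mset us"
  shows "\<bar>\<omega> x vs\<bar> = \<bar>\<omega> x us\<bar>"
  using assms
proof (induction vs arbitrary: \<omega> us)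
  case Nil
  then show ?case by simp
next
  case (Cons v vs)
  have "v \<in> set us" using Cons.prems(3) by (metis list.set_intros(1) set_mset_mset)
  then obtain p q where us: "us = p @ v # q" by (meson split_list)
  then have "mset vs = mset (p @ q)" using Cons.prems(3) by simp
  from Cons.IH[OF multilin_contr[OF Cons.prems(1)] altern_contr[OF Cons.prems(2)] this, of v]
  show ?case using altern_move[OF Cons.prems(1,2), of x p v q] by (simp add: us interior_prod_def)
qed

lemma mset_eq_distinct_full:
  assumes "distinct vs" "distinct us" "set vs \<subseteq> B" "set us \<subseteq> B" "length vs = card B" "length us = card B" "finite B"
  shows "mset vs = mset us"
proof -
  have "set vs = B" "set us = B"
    using assms by (metis card_subset_eq distinct_card)+
  then show ?thesis using assms(1,2) by (metis mset_set_set)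
qed

lemma sum_lists_Suc:
  assumes "finite E"
  shows "(\<Sum>bs | set bs \<subseteq> E \<and> length bs = Suc k. g bs) =
    (\<Sum>e\<in>E. \<Sum>bs | set bs \<subseteq> E \<and> length bs = k. g (e # bs))"
proof -
  have "(\<Sum>bs | set bs \<subseteq> E \<and> length bs = Suc k. g bs) =
      (\<Sum>(bs, e)\<in>{bs. set bs \<subseteq> E \<and> length bs = k} \<times> E. g (e # bs))"
    unfolding lists_length_Suc_eq by (subst sum.reindex) (auto simp: inj_on_def comp_def case_prod_unfold)
  also have "\<dots> = (\<Sum>bs | set bs \<subseteq> E \<and> length bs = k. \<Sum>e\<in>E. g (e # bs))"
    by (simp add: sum.cartesian_product)
  also have "\<dots> = (\<Sum>e\<in>E. \<Sum>bs | set bs \<subseteq> E \<and> length bs = k. g (e # bs))"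
    by (rule sum.swap)
  finally show ?thesis .
qed

text \<open>The basis is exchanged one slot at a time: the induction hypothesis treats the
  contracted form, and the assumed identity treats the remaining slot.\<close>

lemma parseval_multilin:
  assumes "finite E" "finite E'"
    and parseval: "\<And>f :: 'v::real_vector \<Rightarrow> real. linear f \<Longrightarrow> (\<Sum>e\<in>E. (f e)\<^sup>2) = (\<Sum>e\<in>E'. (f e)\<^sup>2)"
    and "multilin \<omega>"
  shows "(\<Sum>bs | set bs \<subseteq> E \<and> length bs = k. (\<omega> x bs)\<^sup>2) = (\<Sum>bs | set bs \<subseteq> E' \<and> length bs = k. (\<omega> x bs)\<^sup>2)"
  using assms(4)
proof (induction k arbitrary: \<omega>)
  case 0
  have "{bs. set bs \<subseteq> A \<and> length bs = 0} = {[]}" for A :: "'v set" by auto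
  then show ?case by simp
next
  case (Suc k)
  have "(\<Sum>bs | set bs \<subseteq> E \<and> length bs = k. (\<omega> x (e # bs))\<^sup>2) =
      (\<Sum>bs | set bs \<subseteq> E' \<and> length bs = k. (\<omega> x (e # bs))\<^sup>2)" for e
    using Suc.IH[OF multilin_contr[OF Suc.prems], of e] by (simp add: interior_prod_def)
  then have "(\<Sum>bs | set bs \<subseteq> E \<and> length bs = Suc k. (\<omega> x bs)\<^sup>2) =
      (\<Sum>e\<in>E. \<Sum>bs | set bs \<subseteq> E' \<and> length bs = k. (\<omega> x (e # bs))\<^sup>2)"
    by (simp add: sum_lists_Suc[OF assms(1)])
  also have "\<dots> = (\<Sum>bs | set bs \<subseteq> E' \<and> length bs = k. \<Sum>e\<in>E. (\<omega> x (e # bs))\<^sup>2)"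
    by (rule sum.swap)
  also have "\<dots> = (\<Sum>bs | set bs \<subseteq> E' \<and> length bs = k. \<Sum>e\<in>E'. (\<omega> x (e # bs))\<^sup>2)"
    by (intro sum.cong refl parseval multilin_linear Suc.prems)
  also have "\<dots> = (\<Sum>e\<in>E'. \<Sum>bs | set bs \<subseteq> E' \<and> length bs = k. (\<omega> x (e # bs))\<^sup>2)"
    by (rule sum.swap)
  finally show ?case by (simp add: sum_lists_Suc[OF assms(2)])
qed

text \<open>Summing the squares of the values of a form of top degree on all lists of basis vectors gives
  the number of orderings of the basis times its squared value on one of them. By Parseval's
  identity the result does not depend on the orthonormal basis; this replaces the statement that
  orthogonal matrices have determinant of absolute value one.\<close>

lemma sum_lists_top_form:
  assumes "multilin \<omega>" "altern \<omega>" "finite E" "distinct vs" "set vs = E"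
  shows "(\<Sum>bs | set bs \<subseteq> E \<and> length bs = card E. (\<omega> x bs)\<^sup>2) = fact (card E) * (\<omega> x vs)\<^sup>2"
proof -
  have len: "length vs = card E" using assms(4,5) distinct_card by metis
  let ?L = "{bs. set bs \<subseteq> E \<and> length bs = card E}"
  have "(\<omega> x bs)\<^sup>2 = (if distinct bs then (\<omega> x vs)\<^sup>2 else 0)" if "bs \<in> ?L" for bs
  proof (cases "distinct bs")
    case True
    then have "mset bs = mset vs"
      using that assms(3,4,5) len by (intro mset_eq_distinct_full[of bs vs E]) auto
    from altern_mset[OF assms(1,2) this, of x] True show ?thesis by (simp add: power2_eq_iff abs_eq_iff)
  next
    case False
    then show ?thesis using altern_not_distinct[OF assms(1,2)] by simp
  qed
  then have "(\<Sum>bs\<in>?L. (\<omega> x bs)\<^sup>2) = (\<Sum>bs\<in>?L. if distinct bs then (\<omega> x vs)\<^sup>2 else 0)"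
    by (intro sum.cong refl)
  also have "\<dots> = (\<Sum>bs\<in>{bs\<in>?L. distinct bs}. (\<omega> x vs)\<^sup>2)"
    using finite_lists_length_eq[OF assms(3)] by (intro sum.inter_filter[symmetric])
  also have "{bs\<in>?L. distinct bs} = {bs. length bs = card E \<and> distinct bs \<and> set bs \<subseteq> E}" by auto
  also have "(\<Sum>bs | length bs = card E \<and> distinct bs \<and> set bs \<subseteq> E. (\<omega> x vs)\<^sup>2) = fact (card E) * (\<omega> x vs)\<^sup>2"
    using card_lists_distinct_length_eq[OF assms(3) order.refl]
    by (simp add: fact_prod)
  finally show ?thesis .
qed

context orthonormal_basis
begin

text \<open>With \<open>r e\<close> the residual of \<open>e\<close> after projection to
  \<open>span E\<close>, summing squared norms over \<open>Bs\<close> and exchanging the sums gives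
  \<open>card Bs - card E = 0\<close>, so all residuals vanish.\<close>

lemma orthonormal_card_spans:
  assumes E: "finite E" "\<And>a b. a \<in> E \<Longrightarrow> b \<in> E \<Longrightarrow> a \<bullet> b = (if a = b then 1 else (0::real))" "card E = card Bs"
  shows "span E = (UNIV :: 'a set)"
proof -
  define r where "r u = u - (\<Sum>f\<in>E. (u \<bullet> f) *\<^sub>R f)" for u
  have rr: "r u \<bullet> r u = u \<bullet> u - (\<Sum>f\<in>E. (u \<bullet> f)\<^sup>2)" for u
  proof -
    have p: "(\<Sum>g\<in>E. (u \<bullet> g) *\<^sub>R g) \<bullet> f = u \<bullet> f" if "f \<in> E" for f
      by (rule basis_coefficient[OF bilinear_inner E(1) E(2)[OF _ that] that])
    then have rf: "r u \<bullet> f = 0" if "f \<in> E" for f using that by (simp add: r_def inner_diff_left)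
    have "r u \<bullet> r u = r u \<bullet> u - (\<Sum>f\<in>E. (u \<bullet> f) * (r u \<bullet> f))"
      by (subst (2) r_def) (simp add: inner_diff_right inner_sum_right)
    also have "\<dots> = r u \<bullet> u" by (simp add: rf)
    also have "\<dots> = u \<bullet> u - (\<Sum>f\<in>E. (u \<bullet> f)\<^sup>2)"
      by (simp add: r_def inner_diff_left inner_diff_right inner_sum_left inner_sum_right power2_eq_square
          inner_commute)
    finally show ?thesis .
  qed
  have "(\<Sum>e\<in>Bs. \<Sum>f\<in>E. (e \<bullet> f)\<^sup>2) = (\<Sum>f\<in>E. \<Sum>e\<in>Bs. (e \<bullet> f)\<^sup>2)" by (rule sum.swap)
  also have "\<dots> = (\<Sum>f\<in>E. f \<bullet> f)"
  proof (rule sum.cong[OF refl])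
    fix f
    show "(\<Sum>e\<in>Bs. (e \<bullet> f)\<^sup>2) = f \<bullet> f"
      using inner_expand[of f f] by (simp add: power2_eq_square inner_commute)
  qed
  also have "\<dots> = (\<Sum>f\<in>E. 1)" using E(2) by (intro sum.cong) auto
  also have "\<dots> = (\<Sum>e\<in>Bs. e \<bullet> e)" using E(3) orthonormal by simp
  finally have "(\<Sum>e\<in>Bs. r e \<bullet> r e) = 0" by (simp add: rr sum_subtractf)
  then have "r e = 0" if "e \<in> Bs" for e
    using that fin sum_nonneg_eq_0_iff[OF fin, of "\<lambda>e. r e \<bullet> r e"] by auto
  then have "e = (\<Sum>f\<in>E. (e \<bullet> f) *\<^sub>R f)" if "e \<in> Bs" for e using that by (simp add: r_def)
  then have "Bs \<subseteq> span E" by (metis (no_types, lifting) span_base span_scale span_sum subsetI)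
  then show ?thesis using spans span_minimal[OF _ subspace_span, of Bs E] by auto
qed

lemma inj_dual_vec: "inj dual_vec"
  by (rule injI) (metis riesz_dual_vec)

lemma dual_vec_riesz: "dual_vec (riesz \<xi>) = \<xi>"
  by (rule blinfun_eqI) (metis dual_vec_apply inner_commute riesz_inner)

lemma span_dual_basis: "span (dual_vec ` Bs) = UNIV"
proof -
  have "v \<in> span (dual_vec ` Bs)" for v
    by (subst dual_expand[symmetric]) (intro span_sum span_scale span_base imageI)
  then show ?thesis by auto
qed

lemma independent_dual_basis: "independent (dual_vec ` Bs)"
proof (rule independent_if_scalars_zero)
  show "finite (dual_vec ` Bs)" using fin by simp
  fix f x assume *: "(\<Sum>x\<in>dual_vec ` Bs. f x *\<^sub>R x) = 0" and "x \<in> dual_vec ` Bs"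
  then obtain e where e: "e \<in> Bs" "x = dual_vec e" by auto
  have "0 = blinfun_apply (\<Sum>x\<in>dual_vec ` Bs. f x *\<^sub>R x) e" by (simp add: *)
  also have "\<dots> = (\<Sum>g\<in>Bs. f (dual_vec g) * (e \<bullet> g))"
    using inj_dual_vec by (subst sum.reindex) (auto simp: inj_on_def inj_def blinfun_apply_sum blinfun.scaleR_left)
  also have "\<dots> = (\<Sum>g\<in>Bs. if g = e then f (dual_vec g) else 0)"
    using orthonormal e(1) by (intro sum.cong) auto
  finally show "f x = 0" using e fin by simp
qed

lemma card_dual_basis: "card (dual_vec ` Bs) = card Bs"
  using inj_dual_vec by (simp add: card_image inj_on_def inj_def)

lemma dim_dual: "dim (UNIV :: 'a dual set) = card Bs"
  using dim_eq_card[OF _ independent_dual_basis, of UNIV] span_dual_basis card_dual_basis by simp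

text \<open>Forms of top degree are determined at each point by one value, since distinct basis
  lists of full length are permutations of each other.\<close>

lemma top_form_zero:
  fixes \<omega> :: "'a dual dform"
  assumes "multilin \<omega>" "altern \<omega>" "distinct bl" "set bl = Bs" "\<omega> x (map dual_vec bl) = 0" "length ws = card Bs"
  shows "\<omega> x ws = 0"
proof (rule multilin_zero_of_span[OF assms(1) span_dual_basis])
  fix bs assume bs: "set bs \<subseteq> dual_vec ` Bs" "length bs = length ws"
  show "\<omega> x bs = 0"
  proof (cases "distinct bs")
    case True
    have "mset bs = mset (map dual_vec bl)"
    proof (rule mset_eq_distinct_full)
      show "distinct (map dual_vec bl)"
        using assms(3) inj_dual_vec by (simp add: distinct_map inj_on_def inj_def)
      show "length (map dual_vec bl) = card (dual_vec ` Bs)"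
        using distinct_card[OF assms(3)] assms(4) card_dual_basis by simp
    qed (use True bs assms(4,6) card_dual_basis fin in auto)
    from altern_mset[OF assms(1,2) this, of x] assms(5) show ?thesis by simp
  next
    case False
    then show ?thesis by (rule altern_not_distinct[OF assms(1,2)])
  qed
qed

lemma beyond_top_form_zero:
  fixes \<omega> :: "'a dual dform"
  assumes "multilin \<omega>" "altern \<omega>" "length ws > card Bs"
  shows "\<omega> x ws = 0"
proof (rule multilin_zero_of_span[OF assms(1) span_dual_basis])
  fix bs assume bs: "set bs \<subseteq> dual_vec ` Bs" "length bs = length ws"
  have "\<not> distinct bs"
  proof
    assume "distinct bs"
    then have "length bs \<le> card (dual_vec ` Bs)"
      using bs(1) fin by (metis card_mono distinct_card finite_imageI)
    then show False using bs(2) assms(3) card_dual_basis by simp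
  qed
  then show "\<omega> x bs = 0" by (rule altern_not_distinct[OF assms(1,2)])
qed

lemma dual_vec_orthonormal: "e \<in> Bs \<Longrightarrow> f \<in> Bs \<Longrightarrow> dual_inner (dual_vec e) (dual_vec f) = (if e = f then 1 else 0)"
  using orthonormal by (simp add: dual_inner_def)

lemma orthonormal_list_basis:
  assumes "distinct bl" "set bl = Bs"
  shows "length (map dual_vec bl) = dim (UNIV :: 'a dual set) \<and>
    (\<forall>i<length (map dual_vec bl). \<forall>j<length (map dual_vec bl).
      dual_inner (map dual_vec bl ! i) (map dual_vec bl ! j) = (if i = j then 1 else 0))"
  using assms distinct_card[OF assms(1)]
  by (auto simp: dim_dual dual_vec_orthonormal nth_eq_iff_index_eq)

lemma riemannian_volume_basis:
  fixes \<mu> :: "'a dual dform"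
  assumes "riemannian_volume (\<lambda>_. dual_inner) \<mu>" "distinct bl" "set bl = Bs"
  shows "\<bar>\<mu> x (map dual_vec bl)\<bar> = 1"
  using assms(1) orthonormal_list_basis[OF assms(2,3)] unfolding riemannian_volume_def by blast

text \<open>The metric is constant, so the same basis is orthonormal at every point, and the value
  \<open>g\<close> on it satisfies \<open>g y * g y = 1\<close>. Differentiating this identity gives
  \<open>g x * dd g v x = 0\<close> with \<open>g x\<close> nonzero.\<close>

lemma dir_deriv_riemannian_volume:
  fixes \<mu> :: "'a dual dform"
  assumes "riemannian_volume (\<lambda>_. dual_inner) \<mu>"
  shows "dir_deriv v \<mu> = 0"
proof (intro ext)
  fix x ws
  have \<mu>: "multilin \<mu>" "altern \<mu>" "smooth_form \<mu>" "degree_form (card Bs) \<mu>"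
    using assms by (simp_all add: riemannian_volume_def forms_iff all_forms_iff dim_dual)
  show "dir_deriv v \<mu> x ws = 0 x ws"
  proof (cases "length ws = card Bs")
    case True
    obtain bl where bl: "set bl = Bs" "distinct bl" using finite_distinct_list[OF fin] by blast
    define g where "g = (\<lambda>y. \<mu> y (map dual_vec bl))"
    have g: "smooth g" unfolding g_def by (rule smooth_formD[OF \<mu>(3)])
    have gg: "g y * g y = 1" for y
      using riemannian_volume_basis[OF assms bl(2,1), of y] unfolding g_def by (metis abs_mult_self_eq mult_1)
    have "dd (\<lambda>y. g y * g y) v x = 2 * (g x * dd g v x)"
      by (simp add: smooth_dd_mult[OF g g])
    then have "g x * dd g v x = 0" by (simp add: gg)
    then have "dd g v x = 0" using gg[of x] by auto
    then have "dir_deriv v \<mu> x (map dual_vec bl) = 0" by (simp add: dir_deriv_def g_def)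
    from top_form_zero[OF multilin_dir_deriv[OF \<mu>(1,3)] altern_dir_deriv[OF \<mu>(2)] bl(2,1) this True]
    show ?thesis by simp
  next
    case False
    then show ?thesis using degree_form_dir_deriv[OF \<mu>(4)] by (simp add: degree_form_def)
  qed
qed

text \<open>Witnesses the existence of a Riemannian volume, without which the third Hawkins
  condition would be vacuous.\<close>

definition vol_form :: "'a list \<Rightarrow> 'a dual dform" where
  "vol_form bl = foldr (\<lambda>e \<omega>. const_form e \<curlywedge> \<omega>) bl (fun_form (\<lambda>_. 1))"

lemma vol_form_forms: "vol_form bl \<in> forms (length bl)"
proof (induction bl)
  case Nil
  then show ?case by (simp add: vol_form_def fun_form_forms)
next
  case (Cons e bl)
  have "const_form e \<curlywedge> vol_form bl \<in> forms (1 + length bl)"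
    using const_form_forms[of e] Cons unfolding forms_iff
    by (intro conjI all_forms_wedge degree_form_wedge) auto
  then show ?case by (simp add: vol_form_def)
qed

lemma contr_const_form_wedge:
  "contr v (const_form u \<curlywedge> \<omega>) = fscale (\<lambda>_. blinfun_apply v u) \<omega> - const_form u \<curlywedge> contr v \<omega>"
proof -
  have "grade_inv (const_form u) = - const_form u"
    by (auto simp: fun_eq_iff grade_inv_def const_form_def one_form_def split: list.splits)
  moreover have "contr v (const_form u) = fun_form (\<lambda>_. blinfun_apply v u)"
    by (simp add: const_form_def contr_one_form)
  ultimately show ?thesis by (simp add: contr_wedge fun_form_wedge)
qed

text \<open>The vanishing of contractions with absent basis vectors strengthens the induction: it
  removes the second term when the head of the list is contracted.\<close>

lemma vol_form_basis:
  assumes "distinct bl" "set bl \<subseteq> Bs"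
  shows "vol_form bl x (map dual_vec bl) = 1 \<and> (\<forall>b\<in>Bs - set bl. contr (dual_vec b) (vol_form bl) = 0)"
  using assms
proof (induction bl)
  case Nil
  then show ?case by (auto simp: vol_form_def fun_form_def fun_eq_iff interior_prod_def)
next
  case (Cons e bl)
  have v: "vol_form (e # bl) = const_form e \<curlywedge> vol_form bl" by (simp add: vol_form_def)
  have c: "contr (dual_vec b) (vol_form (e # bl)) = fscale (\<lambda>_. if e = b then 1 else 0) (vol_form bl)"
    if "b \<in> Bs" "b \<notin> set bl" for b
  proof -
    have "distinct bl" "set bl \<subseteq> Bs" using Cons.prems by auto
    from Cons.IH[OF this] that have z: "contr (dual_vec b) (vol_form bl) = 0" by blast
    have "e \<bullet> b = (if e = b then 1 else 0)" using Cons.prems that orthonormal by simp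
    then show ?thesis unfolding v contr_const_form_wedge z dual_vec_apply wedge_zero
      by (simp add: fun_eq_iff fscale_def)
  qed
  have "vol_form (e # bl) x (map dual_vec (e # bl)) = contr (dual_vec e) (vol_form (e # bl)) x (map dual_vec bl)"
    by (simp add: interior_prod_def)
  then have "vol_form (e # bl) x (map dual_vec (e # bl)) = 1"
    using Cons c[of e] by (simp add: fscale_def)
  moreover have "contr (dual_vec b) (vol_form (e # bl)) = 0" if "b \<in> Bs - set (e # bl)" for b
    using c[of b] that by (auto simp add: fscale_def fun_eq_iff)
  ultimately show ?case by blast
qed

lemma parseval:
  assumes "linear (f :: 'a dual \<Rightarrow> real)"
  obtains u where "(\<Sum>e\<in>Bs. (f (dual_vec e))\<^sup>2) = u \<bullet> u" "f = (\<lambda>\<xi>. blinfun_apply \<xi> u)"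
proof -
  obtain u where "f = (\<lambda>\<xi>. blinfun_apply \<xi> u)" using linear_bidual[OF assms] .
  then show thesis using that[of u] inner_expand[of u u] by (simp add: power2_eq_square)
qed

lemma riemannian_volume_volume:
  assumes bl: "distinct bl" "set bl = Bs"
  shows "riemannian_volume (\<lambda>_. dual_inner) (vol_form bl)"
  unfolding riemannian_volume_def
proof (intro conjI allI impI; (elim conjE)?)
  show "vol_form bl \<in> forms (dim (UNIV :: 'a dual set))"
    using vol_form_forms[of bl] distinct_card[OF bl(1)] bl(2) by (simp add: dim_dual)
  fix x :: "'a dual" and vs :: "'a dual list"
  assume len: "length vs = dim (UNIV :: 'a dual set)"
    and orth: "\<forall>i<length vs. \<forall>j<length vs. dual_inner (vs ! i) (vs ! j) = (if i = j then 1 else 0)"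
  have dist: "distinct vs"
    using orth by (metis distinct_conv_nth zero_neq_one)
  define E where "E = riesz ` set vs"
  have vsE: "dual_vec ` E = set vs" by (auto simp: E_def dual_vec_riesz image_image)
  have cardE: "card E = card Bs"
    using distinct_card[OF dist] len card_image[of dual_vec E] inj_dual_vec by (simp add: vsE dim_dual inj_on_def inj_def)
  have orthE: "a \<bullet> b = (if a = b then 1 else 0)" if ab: "a \<in> E" "b \<in> E" for a b
  proof -
    obtain i j where ij: "i < length vs" "j < length vs" "a = riesz (vs ! i)" "b = riesz (vs ! j)"
      using ab by (auto simp: E_def in_set_conv_nth)
    have "a = b \<longleftrightarrow> i = j"
      using ij dist by (metis dual_vec_riesz nth_eq_iff_index_eq)
    then show ?thesis using orth ij by (simp add: dual_inner_def)
  qed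
  \<comment> \<open>An orthonormal list in the dual is the dual list of another orthonormal basis,
    so the locale can be interpreted a second time and Parseval's identity used for both.\<close>
  have "orthonormal_basis E"
    using orthonormal_card_spans[of E] orthE cardE by unfold_locales (auto simp: E_def)
  then interpret E: orthonormal_basis E .
  have inj: "inj_on dual_vec A" for A using inj_dual_vec by (simp add: inj_on_def inj_def)
  have pars: "(\<Sum>e\<in>dual_vec ` Bs. (f e)\<^sup>2) = (\<Sum>e\<in>dual_vec ` E. (f e)\<^sup>2)" if lf: "linear f" for f :: "'a dual \<Rightarrow> real"
  proof -
    obtain u where u: "(\<Sum>e\<in>Bs. (f (dual_vec e))\<^sup>2) = u \<bullet> u" "f = (\<lambda>\<xi>. blinfun_apply \<xi> u)"
      using parseval[OF lf] .
    have "(\<Sum>e\<in>E. (f (dual_vec e))\<^sup>2) = u \<bullet> u"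
      using E.inner_expand[of u u] by (simp add: u(2) power2_eq_square)
    then show ?thesis using u(1) by (simp add: sum.reindex[OF inj])
  qed
  have \<omega>: "multilin (vol_form bl)" "altern (vol_form bl)"
    using vol_form_forms[of bl] by (simp_all add: forms_iff all_forms_iff)
  have "(\<Sum>bs | set bs \<subseteq> dual_vec ` Bs \<and> length bs = card Bs. (vol_form bl x bs)\<^sup>2) =
      fact (card Bs) * (vol_form bl x (map dual_vec bl))\<^sup>2"
    using sum_lists_top_form[OF \<omega>, of "dual_vec ` Bs" "map dual_vec bl" x] fin bl inj[of Bs]
    unfolding card_dual_basis by (simp add: distinct_map)
  moreover have "(\<Sum>bs | set bs \<subseteq> dual_vec ` E \<and> length bs = card Bs. (vol_form bl x bs)\<^sup>2) =
      fact (card Bs) * (vol_form bl x vs)\<^sup>2"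
    using sum_lists_top_form[OF \<omega> finite_imageI[OF E.fin] dist vsE[symmetric], of x]
    unfolding E.card_dual_basis cardE .
  moreover have "(\<Sum>bs | set bs \<subseteq> dual_vec ` Bs \<and> length bs = card Bs. (vol_form bl x bs)\<^sup>2) =
      (\<Sum>bs | set bs \<subseteq> dual_vec ` E \<and> length bs = card Bs. (vol_form bl x bs)\<^sup>2)"
    by (rule parseval_multilin[OF finite_imageI[OF fin] finite_imageI[OF E.fin] pars \<omega>(1)])
  ultimately have "(vol_form bl x (map dual_vec bl))\<^sup>2 = (vol_form bl x vs)\<^sup>2"
    by simp
  then show "\<bar>vol_form bl x vs\<bar> = 1"
    using vol_form_basis[OF bl(1)] bl(2) by (simp add: abs_square_eq_1)
qed

end

section \<open>Contraction of the volume with the Poisson tensor\<close>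

context metric_lie_algebra
begin

text \<open>Basis independence of the contraction. The basis from \<open>extend_basis\<close> need
  not be orthonormal, so it is traded for the dual basis of \<open>Bs\<close>.\<close>

lemma sum_dual_bases:
  assumes E: "finite E" "independent E" "span E = (UNIV :: 'a dual set)"
    and g: "linear (g :: 'a \<Rightarrow> real)" and h: "linear (h :: 'a dual \<Rightarrow> real)"
  shows "(\<Sum>a\<in>E. g (bidual_rep (\<lambda>v. real_vector.representation E v a)) * h a) =
    (\<Sum>e\<in>Bs. g e * h (dual_vec e))"
proof -
  define u where "u a = bidual_rep (\<lambda>v. real_vector.representation E v a)" for a
  have lin: "linear (\<lambda>v. real_vector.representation E v a)" for a
    using E by (intro linearI) (simp_all add: real_vector.representation_add real_vector.representation_scale)
  have u: "real_vector.representation E v a = blinfun_apply v (u a)" for v a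
  proof -
    obtain w where w: "(\<lambda>v. real_vector.representation E v a) = (\<lambda>v. blinfun_apply v w)"
      using linear_bidual[OF lin] .
    then have "u a = w" by (simp add: u_def)
    then show ?thesis using fun_cong[OF w] by simp
  qed
  have "h (dual_vec e) = (\<Sum>a\<in>E. (u a \<bullet> e) * h a)" for e
  proof -
    have "h (dual_vec e) = h (\<Sum>a\<in>E. real_vector.representation E (dual_vec e) a *\<^sub>R a)"
      using real_vector.sum_representation_eq[OF E(2) _ E(1) order.refl] E(3) by simp
    then show ?thesis by (simp add: linear_sum[OF h] linear_scale[OF h] u)
  qed
  then have "(\<Sum>e\<in>Bs. g e * h (dual_vec e)) = (\<Sum>e\<in>Bs. \<Sum>a\<in>E. (u a \<bullet> e) * g e * h a)"
    by (simp add: sum_distrib_left mult_ac)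
  also have "\<dots> = (\<Sum>a\<in>E. \<Sum>e\<in>Bs. (u a \<bullet> e) * g e * h a)" by (rule sum.swap)
  also have "\<dots> = (\<Sum>a\<in>E. g (u a) * h a)"
    using linear_expand[OF g] by (simp flip: sum_distrib_right)
  finally show ?thesis by (simp add: u_def)
qed

lemma bivec_contract_eq:
  assumes "multilin \<mu>"
  shows "bivec_contract \<pi>\<^sub>l \<mu> =
    fscale (\<lambda>_. 1/2) (\<Sum>e\<in>Bs. \<Sum>f\<in>Bs. fscale (\<lambda>x. blinfun_apply x (br e f)) (contr (dual_vec f) (contr (dual_vec e) \<mu>)))"
proof (intro ext)
  fix x :: "'a dual" and vs
  define E where "E = real_vector.extend_basis ({} :: 'a dual set)"
  have ind: "independent E" and sp: "span E = UNIV"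
    using real_vector.independent_extend_basis[OF real_vector.independent_empty]
      real_vector.span_extend_basis[OF real_vector.independent_empty]
    by (simp_all add: E_def)
  have finE: "finite E"
    using real_vector.independent_span_bound[OF finite_imageI[OF fin] ind, of dual_vec] span_dual_basis by simp
  define u where "u a = bidual_rep (\<lambda>v. real_vector.representation E v a)" for a
  note D = sum_dual_bases[OF finE ind sp, folded u_def]
  have l1: "linear (\<lambda>w. blinfun_apply x (br a w))" "linear (\<lambda>w. blinfun_apply x (br w a))" for a
    using linear_compose[OF br_linear(1), of "blinfun_apply x" a] linear_compose[OF br_linear(2), of "blinfun_apply x" a]
      bounded_linear.linear[OF blinfun.bounded_linear_right[of x]] by (simp_all add: comp_def)
  have l2: "linear (\<lambda>b. \<mu> x (a # b # vs))" "linear (\<lambda>b. \<mu> x (b # a # vs))" for a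
    using multilinD[OF assms, of x "[a]" vs] multilin_linear[OF assms, of x "a # vs"] by simp_all
  have "(\<Sum>a\<in>E. \<Sum>b\<in>E. blinfun_apply x (br (u a) (u b)) * \<mu> x (a # b # vs)) =
      (\<Sum>a\<in>E. \<Sum>f\<in>Bs. blinfun_apply x (br (u a) f) * \<mu> x (a # dual_vec f # vs))"
    by (intro sum.cong refl D l1 l2)
  also have "\<dots> = (\<Sum>f\<in>Bs. \<Sum>a\<in>E. blinfun_apply x (br (u a) f) * \<mu> x (a # dual_vec f # vs))"
    by (rule sum.swap)
  also have "\<dots> = (\<Sum>f\<in>Bs. \<Sum>e\<in>Bs. blinfun_apply x (br e f) * \<mu> x (dual_vec e # dual_vec f # vs))"
    by (intro sum.cong refl D[where g = "\<lambda>w. blinfun_apply x (br w _)" and h = "\<lambda>b. \<mu> x (b # dual_vec _ # vs)"] l1 l2)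
  also have "\<dots> = (\<Sum>e\<in>Bs. \<Sum>f\<in>Bs. blinfun_apply x (br e f) * \<mu> x (dual_vec e # dual_vec f # vs))"
    by (rule sum.swap)
  finally show "bivec_contract \<pi>\<^sub>l \<mu> x vs = fscale (\<lambda>_. 1/2) (\<Sum>e\<in>Bs. \<Sum>f\<in>Bs.
      fscale (\<lambda>x. blinfun_apply x (br e f)) (contr (dual_vec f) (contr (dual_vec e) \<mu>))) x vs"
    by (simp add: bivec_contract_def Let_def linear_poisson_def fscale_def sum_apply interior_prod_def
        E_def[symmetric] u_def[symmetric])
qed

text \<open>The key point is that \<open>const_form u \<curlywedge> \<mu>\<close> vanishes by degree, and so do its contractions.\<close>

lemma ext_deriv_bivec_contract:
  assumes "riemannian_volume (\<lambda>_. dual_inner) \<mu>"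
  shows "ext_deriv (bivec_contract \<pi>\<^sub>l \<mu>) = (\<Sum>e\<in>Bs. fscale (\<lambda>_. \<Sum>f\<in>Bs. br e f \<bullet> f) (contr (dual_vec e) \<mu>))"
proof -
  have \<mu>: "multilin \<mu>" "altern \<mu>" "smooth_form \<mu>" "degree_form (card Bs) \<mu>"
    using assms unfolding riemannian_volume_def forms_iff all_forms_iff dim_dual by simp_all
  have zero: "const_form u \<curlywedge> \<mu> = 0" for u
  proof (intro ext)
    fix x vs
    have cf: "multilin (const_form u)" "altern (const_form u)" "degree_form 1 (const_form u)"
      using const_form_forms[of u] by (simp_all add: forms_iff all_forms_iff)
    show "(const_form u \<curlywedge> \<mu>) x vs = 0 x vs"
    proof (cases "length vs = 1 + card Bs")
      case True
      then show ?thesis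
        using beyond_top_form_zero[OF multilin_wedge[OF cf(1) \<mu>(1)] altern_wedge[OF cf(2) \<mu>(2)], of vs x] by simp
    next
      case False
      then show ?thesis using degree_form_wedge[OF cf(3) \<mu>(4)] unfolding degree_form_def by simp
    qed
  qed
  have key: "const_form u \<curlywedge> contr (dual_vec f) (contr (dual_vec e) \<mu>) =
      fscale (\<lambda>_. u \<bullet> f) (contr (dual_vec e) \<mu>) - fscale (\<lambda>_. u \<bullet> e) (contr (dual_vec f) \<mu>)" for u e f
  proof -
    have "0 = contr (dual_vec f) (contr (dual_vec e) (const_form u \<curlywedge> \<mu>))"
      unfolding zero contr_zero by (rule refl)
    also have "\<dots> = fscale (\<lambda>_. u \<bullet> e) (contr (dual_vec f) \<mu>) - (fscale (\<lambda>_. u \<bullet> f) (contr (dual_vec e) \<mu>) -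
        const_form u \<curlywedge> contr (dual_vec f) (contr (dual_vec e) \<mu>))"
      unfolding contr_const_form_wedge contr_diff contr_fscale dual_vec_apply by (rule refl)
    finally show ?thesis by (simp add: fun_eq_iff)
  qed
  \<comment> \<open>The volume has constant coefficients, so only the linear coefficients of the
    Poisson tensor are differentiated.\<close>
  have d0: "ext_deriv (contr (dual_vec f) (contr (dual_vec e) \<mu>)) = 0" for e f
  proof (intro ext)
    fix x vs
    have "dd (\<lambda>y. \<mu> y ws) v x = 0" for v ws
      using fun_cong[OF fun_cong[OF dir_deriv_riemannian_volume[OF assms, of v]]] by (simp add: dir_deriv_def)
    then show "ext_deriv (contr (dual_vec f) (contr (dual_vec e) \<mu>)) x vs = 0 x vs"
      by (simp add: ext_deriv_def interior_prod_def)
  qed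
  note sm = \<mu>(3) smooth_form_contr smooth_form_fscale smooth_form_sum smooth_apply
  have cscale: "ext_deriv (fscale (\<lambda>_. c) \<sigma>) = fscale (\<lambda>_. c) (ext_deriv \<sigma>)"
    if "smooth_form \<sigma>" for c and \<sigma> :: "'a dual dform"
    using that by (simp add: fun_eq_iff ext_deriv_def fscale_def smooth_form_def smooth_dd_cmult sum_distrib_left mult_ac)
  have "ext_deriv (bivec_contract \<pi>\<^sub>l \<mu>) = fscale (\<lambda>_. 1/2) (\<Sum>e\<in>Bs. \<Sum>f\<in>Bs.
      const_form (br e f) \<curlywedge> contr (dual_vec f) (contr (dual_vec e) \<mu>))"
    unfolding bivec_contract_eq[OF \<mu>(1)]
    by (subst cscale, intro sm, subst ext_deriv_sum, intro sm, subst ext_deriv_sum, intro sm)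
      (simp add: ext_deriv_fscale sm d0 ext_deriv_linear_fun fscale_algebra)
  also have "\<dots> = fscale (\<lambda>_. 1/2) (\<Sum>e\<in>Bs. \<Sum>f\<in>Bs.
      fscale (\<lambda>_. br e f \<bullet> f) (contr (dual_vec e) \<mu>) - fscale (\<lambda>_. br e f \<bullet> e) (contr (dual_vec f) \<mu>))"
    by (simp only: key)
  also have "\<dots> = (\<Sum>e\<in>Bs. fscale (\<lambda>_. \<Sum>f\<in>Bs. br e f \<bullet> f) (contr (dual_vec e) \<mu>))"
  proof (intro ext)
    fix x vs
    \<comment> \<open>Exchanging the indices and using antisymmetry shows that the two halves
      contribute equally, which absorbs the factor \<open>1/2\<close>.\<close>
    have "(\<Sum>e\<in>Bs. \<Sum>f\<in>Bs. (br e f \<bullet> e) * contr (dual_vec f) \<mu> x vs) =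
        (\<Sum>e\<in>Bs. \<Sum>f\<in>Bs. - ((br e f \<bullet> f) * contr (dual_vec e) \<mu> x vs))"
    proof (subst sum.swap, intro sum.cong refl)
      fix e f
      show "(br f e \<bullet> f) * contr (dual_vec e) \<mu> x vs = - ((br e f \<bullet> f) * contr (dual_vec e) \<mu> x vs)"
        using br_swap[of f e] by simp
    qed
    then show "fscale (\<lambda>_. 1/2) (\<Sum>e\<in>Bs. \<Sum>f\<in>Bs.
        fscale (\<lambda>_. br e f \<bullet> f) (contr (dual_vec e) \<mu>) - fscale (\<lambda>_. br e f \<bullet> e) (contr (dual_vec f) \<mu>)) x vs =
      (\<Sum>e\<in>Bs. fscale (\<lambda>_. \<Sum>f\<in>Bs. br e f \<bullet> f) (contr (dual_vec e) \<mu>)) x vs"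
      by (simp add: fscale_def sum_apply sum_subtractf sum_negf sum_distrib_right)
  qed
  finally show ?thesis .
qed

lemma unimodular_iff_volume:
  "unimodular \<longleftrightarrow> (\<forall>\<mu>. riemannian_volume (\<lambda>_. dual_inner) \<mu> \<longrightarrow> ext_deriv (bivec_contract \<pi>\<^sub>l \<mu>) = 0)"
proof
  assume unimodular
  then show "\<forall>\<mu>. riemannian_volume (\<lambda>_. dual_inner) \<mu> \<longrightarrow> ext_deriv (bivec_contract \<pi>\<^sub>l \<mu>) = 0"
    by (auto simp: ext_deriv_bivec_contract unimodular_def fun_eq_iff sum_apply fscale_def)
next
  assume *: "\<forall>\<mu>. riemannian_volume (\<lambda>_. dual_inner) \<mu> \<longrightarrow> ext_deriv (bivec_contract \<pi>\<^sub>l \<mu>) = 0"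
  have tr: "(\<Sum>f\<in>Bs. br e f \<bullet> f) = 0" if e: "e \<in> Bs" for e
  proof -
    \<comment> \<open>Putting \<open>e\<close> first and evaluating on the rest of the basis
      isolates its trace: for any other \<open>g\<close> a basis vector is repeated.\<close>
    obtain bl where bl: "set bl = Bs - {e}" "distinct bl"
      using finite_distinct_list[of "Bs - {e}"] fin by blast
    then have el: "distinct (e # bl)" "set (e # bl) = Bs" using e by auto
    define \<mu> where "\<mu> = vol_form (e # bl)"
    have vol: "riemannian_volume (\<lambda>_. dual_inner) \<mu>"
      unfolding \<mu>_def by (rule riemannian_volume_volume[OF el])
    have \<mu>: "multilin \<mu>" "altern \<mu>"
      using vol unfolding riemannian_volume_def forms_iff all_forms_iff by simp_all
    have one: "\<mu> x (dual_vec e # map dual_vec bl) = 1" for x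
      using vol_form_basis[OF el(1) equalityD1[OF el(2)], of x] by (simp add: \<mu>_def)
    have "(\<Sum>g\<in>Bs. (\<Sum>f\<in>Bs. br g f \<bullet> f) * \<mu> 0 (dual_vec g # map dual_vec bl)) = 0"
      using *[rule_format, OF vol] ext_deriv_bivec_contract[OF vol]
      by (simp add: fun_eq_iff sum_apply fscale_def interior_prod_def)
    moreover have "\<mu> 0 (dual_vec g # map dual_vec bl) = (if g = e then 1 else 0)" if "g \<in> Bs" for g
    proof (cases "g = e")
      case False
      then have "\<not> distinct (dual_vec g # map dual_vec bl)" using bl that by auto
      then show ?thesis using altern_not_distinct[OF \<mu>] False by simp
    qed (simp add: one)
    ultimately have "(\<Sum>g\<in>Bs. if g = e then (\<Sum>f\<in>Bs. br g f \<bullet> f) else 0) = 0"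
      by (simp add: if_distrib cong: if_cong)
    then show ?thesis using e fin by simp
  qed
  show unimodular
    unfolding unimodular_def
  proof
    fix u
    have "linear (\<lambda>u. \<Sum>f\<in>Bs. br u f \<bullet> f)"
      by (rule linearI) (simp_all add: br_simps inner_add_left sum.distrib sum_distrib_left)
    from linear_expand[OF this, of u] tr show "(\<Sum>f\<in>Bs. br u f \<bullet> f) = 0" by simp
  qed
qed

section \<open>Uniqueness of the connection on constant forms\<close>

text \<open>Cometric pairings of constant forms are constant, so compatibility becomes skewness and
  torsion freeness gives the bracket at each point; \<open>lc_unique\<close> then leaves no
  choice.\<close>

lemma metric_connection_const_form:
  assumes "metric_contravariant_connection \<pi>\<^sub>l (\<lambda>_. dual_inner) D"
  shows "D (const_form a) (const_form b) = const_form (lc a b)"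
proof -
  have D: "D (const_form a) (const_form b) \<in> forms 1" for a b
    using assms const_form_forms unfolding metric_contravariant_connection_def contravariant_connection_def by blast
  have pc: "dir_deriv v (const_form u) = 0" for v u
    by (auto simp: fun_eq_iff dir_deriv_def const_form_def one_form_def)
  have "form_vec (D (const_form a) (const_form b)) x = lc a b" for x
  proof (rule lc_unique[where m = "\<lambda>a b. form_vec (D (const_form a) (const_form b)) x"])
    fix a b c
    have "fun_deriv (sharp \<pi>\<^sub>l (const_form a)) (cometric (\<lambda>_. dual_inner) (const_form b) (const_form c)) x =
        cometric (\<lambda>_. dual_inner) (D (const_form a) (const_form b)) (const_form c) x +
        cometric (\<lambda>_. dual_inner) (const_form b) (D (const_form a) (const_form c)) x"
      using assms const_form_forms unfolding metric_contravariant_connection_def metric_compatible_def by blast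
    moreover have "cometric (\<lambda>_. dual_inner) (const_form b) (const_form c) = (\<lambda>_. b \<bullet> c)"
      by (rule ext) (simp only: cometric_eq[OF const_form_forms const_form_forms] form_vec_const_form)
    ultimately show "form_vec (D (const_form a) (const_form b)) x \<bullet> c = - (b \<bullet> form_vec (D (const_form a) (const_form c)) x)"
      by (simp add: fun_deriv_def cometric_eq[OF D const_form_forms] cometric_eq[OF const_form_forms D])
  next
    fix a b
    have T: "D (const_form a) (const_form b) - D (const_form b) (const_form a) = koszul_bracket \<pi>\<^sub>l (const_form a) (const_form b)"
      using assms const_form_forms unfolding metric_contravariant_connection_def torsion_free_def by blast
    show "form_vec (D (const_form a) (const_form b)) x - form_vec (D (const_form b) (const_form a)) x = br a b"
    proof (rule dual_separates)
      fix \<xi> :: "'a dual"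
      have "(D (const_form a) (const_form b) - D (const_form b) (const_form a)) x [\<xi>] = blinfun_apply \<xi> (br a b)"
        unfolding T koszul_bracket_apply[OF const_form_forms const_form_forms] by (simp add: pc)
      then show "blinfun_apply \<xi> (form_vec (D (const_form a) (const_form b)) x - form_vec (D (const_form b) (const_form a)) x) =
          blinfun_apply \<xi> (br a b)"
        by (simp add: forms_1_apply[OF D] blinfun.diff_right)
    qed
  qed
  then show ?thesis
    by (intro forms_1_eqI D const_form_forms) (simp add: forms_1_apply[OF D])
qed

lemma koszul_bracket_const_form: "koszul_bracket \<pi>\<^sub>l (const_form a) (const_form b) = const_form (br a b)"
proof -
  have "torsion_free \<pi>\<^sub>l lc_conn" by (rule torsion_free_lc_conn)
  then have "koszul_bracket \<pi>\<^sub>l (const_form a) (const_form b) =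
      lc_conn (const_form a) (const_form b) - lc_conn (const_form b) (const_form a)"
    using const_form_forms unfolding torsion_free_def by metis
  then show ?thesis
    by (simp only: metric_connection_const_form[OF metric_connection_lc_conn] lc_torsion flip: const_form_diff)
qed

lemma hawkins_conditions_iff:
  "hawkins_conditions \<pi>\<^sub>l (\<lambda>_. dual_inner) \<longleftrightarrow> milnor_lie_algebra br"
proof
  assume H: "hawkins_conditions \<pi>\<^sub>l (\<lambda>_. dual_inner)"
  then obtain D where D: "metric_contravariant_connection \<pi>\<^sub>l (\<lambda>_. dual_inner) D" "flat_connection \<pi>\<^sub>l D"
    unfolding hawkins_conditions_def by blast
  note Dc = metric_connection_const_form[OF D(1)]
  have flat
    unfolding flat_def
  proof (intro allI)
    fix a b c
    have "D (const_form a) (D (const_form b) (const_form c)) - D (const_form b) (D (const_form a) (const_form c)) -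
        D (koszul_bracket \<pi>\<^sub>l (const_form a) (const_form b)) (const_form c) = 0"
      using D(2) const_form_forms unfolding flat_connection_def by blast
    then have "const_form (lc a (lc b c) - lc b (lc a c) - lc (br a b) c) = 0"
      by (simp only: Dc koszul_bracket_const_form const_form_diff)
    \<comment> \<open>\<open>form_vec\<close> at any point, here \<open>0\<close>, recovers the
      vector from its constant form.\<close>
    from arg_cong[OF this, of "\<lambda>\<alpha>. form_vec \<alpha> 0"]
    have "lc a (lc b c) - lc b (lc a c) - lc (br a b) c = 0"
      by (simp add: form_vec_def[of 0])
    then show "lc (br a b) c = lc a (lc b c) - lc b (lc a c)" by simp
  qed
  moreover have unimodular
    using H unfolding unimodular_iff_volume hawkins_conditions_def by blast
  ultimately show "milnor_lie_algebra br" by (simp add: milnor_iff)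
next
  assume "milnor_lie_algebra br"
  then have "flat" "unimodular" by (simp_all add: milnor_iff)
  then show "hawkins_conditions \<pi>\<^sub>l (\<lambda>_. dual_inner)"
    unfolding hawkins_conditions_def
    using metric_connection_lc_conn derivation_extended_lc_conn flat_lc_conn metaflat_lc_conn
      unimodular_iff_volume by blast
qed

end

theorem corollary1p1:
  fixes br :: "'a::real_inner \<Rightarrow> 'a \<Rightarrow> 'a"
  assumes "\<exists>E :: 'a set. finite E \<and> span E = UNIV"
    and "lie_algebra br"
  shows "hawkins_conditions (linear_poisson br) (\<lambda>_. dual_inner) \<longleftrightarrow> milnor_lie_algebra br"
proof -
  obtain E :: "'a set" where E: "finite E" "span E = UNIV" using assms(1) by blast
  show ?thesis
  proof (rule orthonormal_basis_exists[OF E subspace_UNIV])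
    fix Bs :: "'a set"
    assume Bs: "finite Bs" "\<And>a b. a \<in> Bs \<Longrightarrow> b \<in> Bs \<Longrightarrow> a \<bullet> b = (if a = b then 1 else 0)"
      "span Bs = UNIV"
    interpret metric_lie_algebra Bs br
      by unfold_locales (rule Bs assms(2) | assumption)+
    show ?thesis by (rule hawkins_conditions_iff)
  qed
qed

end
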